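(* Let $R=k[\mathbf{P}^N]$, let $x$ be an indeterminate so that $R\subseteq R[x]=k[\mathbf{P}^{N+1}]$, and let $q:R[x]\to R$ be the quotient map with $q(x)=0$ that is the identity on $R$, corresponding to the inclusion $\mathbf{P}^N\subseteq\mathbf{P}^{N+1}$ as a hyperplane. Let $0\ne I\subsetneq R$ be a homogeneous ideal and $I'=IR[x]$ its extension. Then: (a) $\rho(I)=\rho(I')$; hence $\rho(Z)=\rho(C(Z))$ for any nontrivial subscheme $Z\subsetneq\mathbf{P}^N$, where $C(Z)\subset\mathbf{P}^{N+1}$ is the projective cone over $Z$, i.e. the subscheme defined by $I(Z)R[x]$; (b) $\rho(I)=\rho(q^{-1}(I))$; hence if $I=I(Z)$ for a nontrivial subscheme $Z\subsetneq\mathbf{P}^N\subseteq\mathbf{P}^{N+1}$, then $\rho(Z)$ is well defined, whether we regard $Z$ as being in $\mathbf{P}^N$ or in $\mathbf{P}^{N+1}$; and (c) $\rho(mZ)\le\rho(Z)$ for any (nontrivial) fat flat subscheme $Z\subsetneq\mathbf{P}^N$ and any integer $m\ge 1$.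
   Context: $k$ is an arbitrary algebraically closed field, $N\ge 1$, and $k[\mathbf{P}^N]=k[x_0,\dots,x_N]$ is the polynomial ring with its standard grading. Symbolic powers: for a homogeneous ideal $0\ne I\subsetneq R$ in a polynomial ring $R$ and $m\ge 1$, $I^{(m)}$ is the contraction to $R$ of $I^mR_A$, where $R_A$ is the localization of $R$ at the multiplicative system $A$ equal to the complement of the union of the associated primes of $I$. Resurgence: $\rho(I)=\sup\{m/r : m,r\ge 1 \text{ integers},\ I^{(m)}\not\subseteq I^r\}$, and for a subscheme $Z$ of projective space with saturated homogeneous ideal $I(Z)$, $\rho(Z)=\rho(I(Z))$. Nontrivial means the ideal is neither $(0)$ nor $(1)$. A fat flat subscheme $Z=m_1L_1+\cdots+m_nL_n\subsetneq\mathbf{P}^N$ is the subscheme with ideal $I(Z)=\bigcap_i I(L_i)^{m_i}$, where the $L_i\subsetneq\mathbf{P}^N$ are proper linear subspaces, none containing another, and the $m_i$ are nonnegative integers. Then $mZ=mm_1L_1+\cdots+mm_nL_n$, with $I(mZ)=\bigcap_i I(L_i)^{mm_i}=I(Z)^{(m)}$. *)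

theory Defs
  imports
    "HOL-Library.Poly_Mapping"
    "HOL-Library.Extended_Real"
    "HOL-Algebra.Ideal_Product"
    "HOL-Algebra.Algebraic_Closure_Type"
    "HOL-Analysis.Cartesian_Space"
begin

section \<open>Symbolic powers and resurgence in a commutative ring\<close>

text \<open>The class of the fraction \<open>a/s\<close> in the localization of \<open>R\<close> at a multiplicative system \<open>A\<close>.\<close>

definition fraction :: "('a, 'b) ring_scheme \<Rightarrow> 'a set \<Rightarrow> 'a \<Rightarrow> 'a \<Rightarrow> ('a \<times> 'a) set" where
  "fraction R A a s =
    {(b, t). b \<in> carrier R \<and> t \<in> A \<and>
       (\<exists>u\<in>A. u \<otimes>\<^bsub>R\<^esub> (a \<otimes>\<^bsub>R\<^esub> t \<ominus>\<^bsub>R\<^esub> b \<otimes>\<^bsub>R\<^esub> s) = \<zero>\<^bsub>R\<^esub>)}"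

text \<open>The operations are unions over all representatives; each of these unions is over equal
  classes, so it is just the class computed from any choice of representatives.\<close>

definition localization :: "('a, 'b) ring_scheme \<Rightarrow> 'a set \<Rightarrow> ('a \<times> 'a) set ring" where
  "localization R A =
    \<lparr> carrier = {fraction R A a s | a s. a \<in> carrier R \<and> s \<in> A},
      monoid.mult = (\<lambda>U V. \<Union>(a, s)\<in>U. \<Union>(b, t)\<in>V.
               fraction R A (a \<otimes>\<^bsub>R\<^esub> b) (s \<otimes>\<^bsub>R\<^esub> t)),
      one = fraction R A \<one>\<^bsub>R\<^esub> \<one>\<^bsub>R\<^esub>,
      ring.zero = fraction R A \<zero>\<^bsub>R\<^esub> \<one>\<^bsub>R\<^esub>,
      add = (\<lambda>U V. \<Union>(a, s)\<in>U. \<Union>(b, t)\<in>V.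
               fraction R A (a \<otimes>\<^bsub>R\<^esub> t \<oplus>\<^bsub>R\<^esub> b \<otimes>\<^bsub>R\<^esub> s) (s \<otimes>\<^bsub>R\<^esub> t)) \<rparr>"

definition associated_primes :: "('a, 'b) ring_scheme \<Rightarrow> 'a set \<Rightarrow> 'a set set" where
  "associated_primes R I =
    {P. primeideal P R \<and> (\<exists>f\<in>carrier R. P = {a \<in> carrier R. a \<otimes>\<^bsub>R\<^esub> f \<in> I})}"

definition ideal_power :: "('a, 'b) ring_scheme \<Rightarrow> 'a set \<Rightarrow> nat \<Rightarrow> 'a set" where
  "ideal_power R I m = I [^]\<^bsub>ideals_set R\<^esub> m"

definition symbolic_power :: "('a, 'b) ring_scheme \<Rightarrow> 'a set \<Rightarrow> nat \<Rightarrow> 'a set" where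
  "symbolic_power R I m =
    (let A = carrier R - \<Union>(associated_primes R I);
         \<phi> = (\<lambda>f. fraction R A f \<one>\<^bsub>R\<^esub>)
     in {f \<in> carrier R. \<phi> f \<in> Idl\<^bsub>localization R A\<^esub> (\<phi> ` ideal_power R I m)})"

definition resurgence :: "('a, 'b) ring_scheme \<Rightarrow> 'a set \<Rightarrow> ereal" where
  "resurgence R I =
    Sup {ereal (real m / real r) | m r.
           1 \<le> m \<and> 1 \<le> r \<and> \<not> symbolic_power R I m \<subseteq> ideal_power R I r}"

section \<open>Polynomial rings\<close>

text \<open>Polynomials over \<open>'k\<close> in variables indexed by \<open>'n\<close>: finitely supported functions from
  exponent vectors to coefficients. The ring \<open>k[\<^bold>P\<^sup>N]\<close> is the case where \<open>'n\<close> has \<open>N + 1\<close> elements,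
  and \<open>k[\<^bold>P\<^sup>N][x]\<close> is then the ring with index type \<open>'n option\<close>, where \<open>x = Var None\<close>.\<close>

type_synonym ('n, 'k) mpoly = "('n \<Rightarrow>\<^sub>0 nat) \<Rightarrow>\<^sub>0 'k"

abbreviation mpoly_ring :: "('n, 'k::comm_ring_1) mpoly ring" where
  "mpoly_ring \<equiv> ring_of_type_algebra"

definition Const :: "'k::comm_ring_1 \<Rightarrow> ('n, 'k) mpoly" where
  "Const c = Poly_Mapping.single 0 c"

definition Var :: "'n \<Rightarrow> ('n, 'k::comm_ring_1) mpoly" where
  "Var i = Poly_Mapping.single (Poly_Mapping.single i 1) 1"

text \<open>The value of \<open>f\<close> when \<open>c\<close> is applied to the coefficients and \<open>\<sigma> i\<close> is substituted for the
  \<open>i\<close>-th variable.\<close>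

definition poly_subst ::
    "('k::comm_ring_1 \<Rightarrow> 'b::comm_ring_1) \<Rightarrow> ('n::finite \<Rightarrow> 'b) \<Rightarrow> ('n, 'k) mpoly \<Rightarrow> 'b" where
  "poly_subst c \<sigma> f =
    (\<Sum>\<mu>\<in>Poly_Mapping.keys f.
       c (Poly_Mapping.lookup f \<mu>) * (\<Prod>i\<in>UNIV. \<sigma> i ^ Poly_Mapping.lookup \<mu> i))"

definition incl :: "('n::finite, 'k::comm_ring_1) mpoly \<Rightarrow> ('n option, 'k) mpoly" where
  "incl = poly_subst Const (\<lambda>i. Var (Some i))"

definition quot :: "('n::finite option, 'k::comm_ring_1) mpoly \<Rightarrow> ('n, 'k) mpoly" where
  "quot = poly_subst Const (\<lambda>j. case j of None \<Rightarrow> 0 | Some i \<Rightarrow> Var i)"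

definition extended_ideal ::
    "('n::finite, 'k::comm_ring_1) mpoly set \<Rightarrow> ('n option, 'k) mpoly set" where
  "extended_ideal I = Idl\<^bsub>mpoly_ring\<^esub> (incl ` I)"

definition homogeneous :: "('n::finite, 'k::comm_ring_1) mpoly \<Rightarrow> bool" where
  "homogeneous f \<longleftrightarrow>
    (\<exists>d. \<forall>\<mu>\<in>Poly_Mapping.keys f. (\<Sum>i\<in>UNIV. Poly_Mapping.lookup \<mu> i) = d)"

definition homogeneous_ideal :: "('n::finite, 'k::comm_ring_1) mpoly set \<Rightarrow> bool" where
  "homogeneous_ideal I \<longleftrightarrow> (\<exists>S. (\<forall>f\<in>S. homogeneous f) \<and> I = Idl\<^bsub>mpoly_ring\<^esub> S)"

section \<open>Subschemes of projective space\<close>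

definition saturation :: "('n::finite, 'k::comm_ring_1) mpoly set \<Rightarrow> ('n, 'k) mpoly set" where
  "saturation J =
    {f. \<exists>t. \<forall>g\<in>ideal_power mpoly_ring (Idl\<^bsub>mpoly_ring\<^esub> (range Var)) t. g * f \<in> J}"

text \<open>Closed subschemes of projective space over a field are in bijection with saturated
  homogeneous ideals, and are represented by them; \<open>ideal_of Z\<close> is the ideal \<open>I(Z)\<close>.\<close>

typedef (overloaded) ('n::finite, 'k::field) subscheme =
    "{I :: ('n, 'k) mpoly set. homogeneous_ideal I \<and> saturation I = I}"
  morphisms ideal_of Abs_subscheme
proof -
  interpret ring "mpoly_ring :: ('n, 'k) mpoly ring"
    by (rule ring_from_type_algebra)
  have "homogeneous (1 :: ('n, 'k) mpoly)"
    by (simp add: homogeneous_def)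
  moreover have "(UNIV :: ('n, 'k) mpoly set) = Idl\<^bsub>mpoly_ring\<^esub> {1}"
    using genideal_one by (simp add: ring_of_type_algebra_def)
  ultimately have "homogeneous_ideal (UNIV :: ('n, 'k) mpoly set)"
    unfolding homogeneous_ideal_def by blast
  moreover have "saturation (UNIV :: ('n, 'k) mpoly set) = UNIV"
    by (simp add: saturation_def)
  ultimately show ?thesis
    by blast
qed

text \<open>The subscheme defined by a homogeneous ideal \<open>J\<close>, which need not be saturated.\<close>

definition subscheme_of :: "('n::finite, 'k::field) mpoly set \<Rightarrow> ('n, 'k) subscheme" where
  "subscheme_of J = Abs_subscheme (saturation J)"

definition nontrivial :: "('n::finite, 'k::field) subscheme \<Rightarrow> bool" where
  "nontrivial Z \<longleftrightarrow> ideal_of Z \<noteq> {0} \<and> ideal_of Z \<noteq> UNIV"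

definition resurgence_scheme :: "('n::finite, 'k::field) subscheme \<Rightarrow> ereal" where
  "resurgence_scheme Z = resurgence mpoly_ring (ideal_of Z)"

definition cone :: "('n::finite, 'k::field) subscheme \<Rightarrow> ('n option, 'k) subscheme" where
  "cone Z = subscheme_of (extended_ideal (ideal_of Z))"

text \<open>\<open>Z\<close> regarded as a subscheme of the next larger projective space, via the inclusion of the
  hyperplane \<open>x = 0\<close>.\<close>

definition hyperplane_image ::
    "('n::finite, 'k::field) subscheme \<Rightarrow> ('n option, 'k) subscheme" where
  "hyperplane_image Z = subscheme_of (quot -` ideal_of Z)"

text \<open>A linear subspace of projective space is given by its affine cone, a vector subspace \<open>V\<close>;
  its points are the lines spanned by the nonzero vectors of \<open>V\<close>. In particular \<open>V = {0}\<close>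
  is the empty subspace, whose ideal is the unit ideal.\<close>

definition linear_ideal :: "('k::field ^ 'n) set \<Rightarrow> ('n::finite, 'k) mpoly set" where
  "linear_ideal V =
    Idl\<^bsub>mpoly_ring\<^esub> {f. homogeneous f \<and> (\<forall>v\<in>V. v \<noteq> 0 \<longrightarrow> poly_subst id (\<lambda>i. v $ i) f = 0)}"

definition flats :: "nat \<Rightarrow> (nat \<Rightarrow> ('k::field ^ 'n::finite) set) \<Rightarrow> bool" where
  "flats n L \<longleftrightarrow>
    (\<forall>i<n. vec.subspace (L i) \<and> L i \<noteq> UNIV) \<and>
    (\<forall>i<n. \<forall>j<n. i \<noteq> j \<longrightarrow> \<not> L i \<subseteq> L j)"

text \<open>The subscheme \<open>\<mu>\<^sub>0 L\<^sub>0 + \<dots> + \<mu>\<^sub>n\<^sub>-\<^sub>1 L\<^sub>n\<^sub>-\<^sub>1\<close>.\<close>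

definition fat_flat ::
    "nat \<Rightarrow> (nat \<Rightarrow> ('k::field ^ 'n) set) \<Rightarrow> (nat \<Rightarrow> nat) \<Rightarrow> ('n::finite, 'k) subscheme" where
  "fat_flat n L \<mu> = subscheme_of (\<Inter>i<n. ideal_power mpoly_ring (linear_ideal (L i)) (\<mu> i))"

end

theory Submission
  imports Defs
begin

text \<open>Write \<open>I\<^sup>(\<^sup>m\<^sup>)\<close> as the set of all \<open>f\<close> with \<open>s f \<in> I\<^sup>m\<close> for some \<open>s\<close> outside the associated primes of \<open>I\<close>.

  (a) In \<open>R[x]\<close> both \<open>I\<^sup>m\<close> and \<open>I\<^sup>(\<^sup>m\<^sup>)\<close> extend coefficientwise. For symbolic powers this needs that a
  polynomial \<open>s\<close> which is a zero divisor modulo \<open>J = I\<^sup>(\<^sup>m\<^sup>)\<close> is killed modulo \<open>J\<close> by a constant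
  \<open>c \<notin> J\<close> (McCoy); the ideal \<open>J : c\<close> then consists of zero divisors modulo \<open>I\<close>, so by prime avoidance
  it lies in a single associated prime.

  (b) For \<open>I' = I + (x)\<close>, a polynomial lies in \<open>I'\<^sup>m\<close> (in \<open>I'\<^sup>(\<^sup>m\<^sup>)\<close>) iff its coefficient at \<open>x\<^sup>j\<close> lies in
  \<open>I\<^sup>m\<^sup>-\<^sup>j\<close> (in \<open>I\<^sup>(\<^sup>m\<^sup>-\<^sup>j\<^sup>)\<close>). A failure of containment for \<open>(m, r)\<close> thus gives one for \<open>(m - j, r - j)\<close>, whose
  ratio is at least \<open>m / r\<close> if \<open>m \<ge> r\<close>; and if \<open>m < r\<close>, then \<open>I\<^sup>m\<close> is not contained in \<open>I\<^sup>r\<close> anyway.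

  (c) Powers of the ideal \<open>P\<close> of a linear subspace are \<open>P\<close>-primary, hence
  \<open>I(Z)\<^sup>(\<^sup>m\<^sup>) = I(mZ)\<close>. If \<open>I(mZ)\<^sup>(\<^sup>s\<^sup>) = I(Z)\<^sup>(\<^sup>s\<^sup>m\<^sup>)\<close> is not contained in \<open>I(mZ)\<^sup>r\<close>, then it is not contained in the
  smaller ideal \<open>I(Z)\<^sup>m\<^sup>r\<close> either.\<close>

section \<open>Ideals, ideal powers and symbolic powers in a commutative ring\<close>

text \<open>For (a), a full description of the associated primes of IR[x] is avoided. Two partial
  facts suffice: constants off the associated primes of I stay off those of IR[x], and P[x] is
  associated to IR[x] whenever P is associated to I. The first needs that zero divisors modulo I lie
  in associated primes, and prime avoidance needs that there are finitely many of these primes; this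
  is the reason for Hilbert's basis theorem. For (b), the case m < r uses homogeneity: a proper
  nonzero homogeneous ideal has positive initial degree, so its powers are told apart by initial
  degrees. For (c), a linear change of coordinates turns a linear subspace into a coordinate
  subspace. The powers of its ideal are given by the degree in some of the variables, and
  primariness becomes a statement about lowest coefficients over a domain. Algebraic closedness
  enters through the infinitude of k, by which polynomials are determined by their values. The empty
  subspace must be treated apart, since its ideal is the unit ideal and not the irrelevant
  one.\<close>

abbreviation ring_of :: "'a::comm_ring_1 ring" where
  "ring_of \<equiv> ring_of_type_algebra"

text \<open>A ring is a module over itself and its ideals are the submodules. The theory of spans
  then applies: \<open>idl.subspace\<close> is being an ideal, \<open>idl.span\<close> the generated
  ideal.\<close>

interpretation idl: Modules.module "(*) :: 'a::comm_ring_1 \<Rightarrow> 'a \<Rightarrow> 'a"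
  by unfold_locales (simp_all add: algebra_simps)

declare idl.scale_scale [simp del] \<comment> \<open>loops with \<open>mult.assoc\<close>\<close>

interpretation ring_of: cring "ring_of :: 'a::comm_ring_1 ring"
  by (rule cring_from_type_algebra)

lemma ring_of_simps [simp]:
  "carrier (ring_of :: 'a::comm_ring_1 ring) = UNIV"
  "x \<otimes>\<^bsub>ring_of\<^esub> y = x * (y :: 'a)"
  "x \<oplus>\<^bsub>ring_of\<^esub> y = x + (y :: 'a)"
  "\<one>\<^bsub>ring_of\<^esub> = (1 :: 'a)"
  "\<zero>\<^bsub>ring_of\<^esub> = (0 :: 'a)"
  by (simp_all add: ring_of_type_algebra_def)

lemma ring_of_uminus [simp]: "\<ominus>\<^bsub>ring_of\<^esub> x = - (x :: 'a::comm_ring_1)"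
  using ring_of.minus_equality[of "- x" x] by simp

lemma ring_of_minus [simp]: "x \<ominus>\<^bsub>ring_of\<^esub> y = x - (y :: 'a::comm_ring_1)"
  by (simp add: a_minus_def)

lemma ideal_ring_of_iff: "ideal I ring_of \<longleftrightarrow> idl.subspace (I :: 'a::comm_ring_1 set)"
proof
  assume "ideal I (ring_of :: 'a ring)"
  then interpret ideal I "ring_of :: 'a ring" .
  show "idl.subspace I"
    using zero_closed a_closed I_l_closed by (simp add: idl.subspace_def)
next
  assume I: "idl.subspace I"
  have "- x \<in> I" if "x \<in> I" for x
    using idl.subspace_neg[OF I that] .
  moreover have "inv\<^bsub>add_monoid ring_of\<^esub> x = - x" for x :: 'a
    using ring_of_uminus[of x] by (simp add: a_inv_def)
  ultimately have "subgroup I (add_monoid (ring_of :: 'a ring))"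
    using I by (auto simp: subgroup_def idl.subspace_def)
  moreover have "x * a \<in> I" "a * x \<in> I" if "a \<in> I" for a x
    using idl.subspace_scale[OF I that, of x] by (simp_all add: mult.commute)
  ultimately show "ideal I (ring_of :: 'a ring)"
    by (intro idealI ring_of.ring_axioms) simp_all
qed

lemma genideal_ring_of: "Idl\<^bsub>ring_of\<^esub> S = idl.span (S :: 'a::comm_ring_1 set)"
proof
  show "Idl\<^bsub>ring_of\<^esub> S \<subseteq> idl.span S"
    unfolding genideal_def ideal_ring_of_iff using idl.span_superset[of S] by auto
  show "idl.span S \<subseteq> Idl\<^bsub>ring_of\<^esub> S"
    unfolding genideal_def ideal_ring_of_iff using idl.span_minimal by auto
qed

lemma subspace_UNIV_iff: "idl.subspace I \<Longrightarrow> I = UNIV \<longleftrightarrow> (1 :: 'a::comm_ring_1) \<in> I"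
  by (metis UNIV_I UNIV_eq_I idl.subspace_scale mult.right_neutral)

section \<open>Prime ideals, colon ideals and associated primes\<close>

definition prime_idl :: "'a::comm_ring_1 set \<Rightarrow> bool" where
  "prime_idl P \<longleftrightarrow> idl.subspace P \<and> 1 \<notin> P \<and> (\<forall>a b. a * b \<in> P \<longrightarrow> a \<in> P \<or> b \<in> P)"

lemma prime_idlD:
  assumes "prime_idl P"
  shows "idl.subspace P" "1 \<notin> P" "a * b \<in> P \<Longrightarrow> a \<in> P \<or> b \<in> P"
  using assms by (auto simp: prime_idl_def)

lemma prime_idl_mult_iff: "prime_idl P \<Longrightarrow> a * b \<in> P \<longleftrightarrow> a \<in> P \<or> b \<in> P"
  by (metis idl.subspace_scale mult.commute prime_idlD(1,3))

lemma primeideal_ring_of_iff: "primeideal P ring_of \<longleftrightarrow> prime_idl (P :: 'a::comm_ring_1 set)"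
proof
  assume "primeideal P (ring_of :: 'a ring)"
  then interpret primeideal P "ring_of :: 'a ring" .
  have P: "idl.subspace P"
    using is_ideal ideal_ring_of_iff by blast
  show "prime_idl P"
    using I_notcarr I_prime P subspace_UNIV_iff[OF P] by (auto simp: prime_idl_def)
next
  assume P: "prime_idl P"
  then have "1 \<notin> P"
    by (rule prime_idlD)
  then have "UNIV \<noteq> P"
    by blast
  then show "primeideal P (ring_of :: 'a ring)"
    using P by (intro primeidealI) (auto simp: ideal_ring_of_iff prime_idl_def ring_of.is_cring)
qed

definition colon :: "'a::comm_ring_1 set \<Rightarrow> 'a \<Rightarrow> 'a set" where
  "colon I f = {a. a * f \<in> I}"

lemma subspace_colon: "idl.subspace I \<Longrightarrow> idl.subspace (colon I f)"
  by (rule idl.subspaceI)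
    (simp_all add: colon_def distrib_right mult.assoc idl.subspace_0 idl.subspace_add idl.subspace_scale)

lemma associated_primes_ring_of:
  "associated_primes ring_of I = {P. prime_idl P \<and> (\<exists>f :: 'a::comm_ring_1. P = colon I f)}"
  by (simp add: associated_primes_def primeideal_ring_of_iff colon_def)

abbreviation ass :: "'a::comm_ring_1 set \<Rightarrow> 'a set set" where
  "ass I \<equiv> associated_primes ring_of I"

lemma assI: "prime_idl (colon I f) \<Longrightarrow> colon I f \<in> ass I"
  by (auto simp: associated_primes_ring_of)

lemma assE:
  assumes "P \<in> ass I"
  obtains f where "prime_idl P" "P = colon I f" "f \<notin> I"
proof -
  obtain f where f: "prime_idl P" "P = colon I f"
    using assms by (auto simp: associated_primes_ring_of)
  then have "f \<notin> I"
    using prime_idlD(2)[OF f(1)] by (auto simp: colon_def)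
  with f show ?thesis
    by (rule that)
qed

section \<open>Powers of ideals\<close>

abbreviation ipow :: "'a::comm_ring_1 set \<Rightarrow> nat \<Rightarrow> 'a set" where
  "ipow I m \<equiv> ideal_power ring_of I m"

lemma ipow_0 [simp]: "ipow I 0 = UNIV"
  by (simp add: ideal_power_def nat_pow_def ideals_set_def)

lemma ipow_Suc: "ipow I (Suc m) = ideal_prod ring_of (ipow I m) I"
  by (simp add: ideal_power_def nat_pow_def ideals_set_def)

lemma subspace_ipow: "idl.subspace I \<Longrightarrow> idl.subspace (ipow I m)"
proof (induction m)
  case (Suc m)
  then show ?case
    using ring_of.ideal_prod_is_ideal by (simp add: ipow_Suc flip: ideal_ring_of_iff)
qed simp

lemma ipow_1 [simp]:
  assumes "idl.subspace I"
  shows "ipow I (Suc 0) = I"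
proof -
  have "ideal UNIV (ring_of :: 'a ring)" "ideal I ring_of"
    using assms by (auto simp: ideal_ring_of_iff)
  then show ?thesis
    using ring_of.ideal_prod_commute[of I UNIV] ring_of.ideal_prod_one[of I]
    by (simp add: ipow_Suc)
qed

text \<open>The universal property of the product ideal. Together with \<open>mult_ipow_Suc\<close>
  it is all that is used about powers from here on; \<open>ideal_prod\<close> is not unfolded
  again.\<close>

lemma ipow_Suc_least:
  assumes "idl.subspace J" "\<And>a b. a \<in> ipow I m \<Longrightarrow> b \<in> I \<Longrightarrow> a * b \<in> J"
  shows "ipow I (Suc m) \<subseteq> J"
proof
  fix x assume "x \<in> ipow I (Suc m)"
  then have "x \<in> ideal_prod ring_of (ipow I m) I"
    by (simp add: ipow_Suc)
  then show "x \<in> J"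
    by induction (simp_all add: assms(2) idl.subspace_add[OF assms(1)])
qed

lemma mult_ipow_Suc: "a \<in> ipow I m \<Longrightarrow> b \<in> I \<Longrightarrow> a * b \<in> ipow I (Suc m)"
  using ideal_prod.prod[of a "ipow I m" b I ring_of] by (simp add: ipow_Suc)

lemma ipow_add_least:
  assumes I: "idl.subspace I" and J: "idl.subspace J"
    and prod: "\<And>a b. a \<in> ipow I m \<Longrightarrow> b \<in> ipow I n \<Longrightarrow> a * b \<in> J"
  shows "ipow I (m + n) \<subseteq> J"
  using J prod
proof (induction n arbitrary: J)
  case 0
  show ?case
    using "0.prems"(2)[of _ 1] by auto
next
  case (Suc n)
  have "ipow I (Suc (m + n)) \<subseteq> J"
  proof (rule ipow_Suc_least[OF Suc.prems(1)])
    fix a b assume a: "a \<in> ipow I (m + n)" and b: "b \<in> I"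
    \<comment> \<open>The last factor b is moved into the target: the induction hypothesis is
      applied to J : b in place of J, which is why J is kept arbitrary.\<close>
    have "ipow I (m + n) \<subseteq> colon J b"
    proof (rule Suc.IH[OF subspace_colon[OF Suc.prems(1)]])
      fix c d assume "c \<in> ipow I m" "d \<in> ipow I n"
      then have "c * (d * b) \<in> J"
        using b by (intro Suc.prems(2) mult_ipow_Suc)
      then show "c * d \<in> colon J b"
        by (simp add: colon_def mult.assoc)
    qed
    then show "a * b \<in> J"
      using a by (auto simp: colon_def)
  qed
  then show ?case
    by simp
qed

lemma mult_ipow:
  assumes I: "idl.subspace I" and "a \<in> ipow I m" "b \<in> ipow I n"
  shows "a * b \<in> ipow I (m + n)"
proof -
  have "ipow I n \<subseteq> colon (ipow I (m + n)) a"
    if "a \<in> ipow I m" for a n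
    using that
  proof (induction n arbitrary: a)
    case 0
    then show ?case
      by (auto simp: colon_def intro!: idl.subspace_scale subspace_ipow I)
  next
    case (Suc n)
    show ?case
    proof (rule ipow_Suc_least[OF subspace_colon[OF subspace_ipow[OF I]]])
      fix c b assume "c \<in> ipow I n" "b \<in> I"
      then have "c * a \<in> ipow I (m + n)"
        using Suc by (auto simp: colon_def)
      then have "c * a * b \<in> ipow I (Suc (m + n))"
        using \<open>b \<in> I\<close> by (rule mult_ipow_Suc)
      then show "c * b \<in> colon (ipow I (m + Suc n)) a"
        by (simp add: colon_def mult_ac)
    qed
  qed
  then have "b \<in> colon (ipow I (m + n)) a"
    using assms by blast
  then show ?thesis
    by (simp add: colon_def mult.commute)
qed

lemma ipow_antimono:
  assumes "idl.subspace I" "m \<le> n"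
  shows "ipow I n \<subseteq> ipow I m"
proof -
  note P = subspace_ipow[OF assms(1), of m]
  have "ipow I (m + (n - m)) \<subseteq> ipow I m"
  proof (rule ipow_add_least[OF assms(1) P])
    fix a b assume "a \<in> ipow I m"
    then show "a * b \<in> ipow I m"
      using idl.subspace_scale[OF P, of a b] by (simp add: mult.commute)
  qed
  then show ?thesis
    using assms by simp
qed

lemma ipow_mono:
  assumes "idl.subspace J" "I \<subseteq> J"
  shows "ipow I m \<subseteq> ipow J m"
proof (induction m)
  case (Suc m)
  then show ?case
    using assms by (intro ipow_Suc_least subspace_ipow) (auto intro: mult_ipow_Suc)
qed simp

lemma ipow_ipow_subset:
  assumes "idl.subspace I"
  shows "ipow (ipow I a) s \<subseteq> ipow I (a * s)"
proof (induction s)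
  case (Suc s)
  then have "ipow (ipow I a) (Suc s) \<subseteq> ipow I (a * s + a)"
    by (intro ipow_Suc_least subspace_ipow assms mult_ipow) auto
  then show ?case
    by (simp add: add.commute)
qed simp

lemma ipow_mult_subset:
  assumes "idl.subspace I"
  shows "ipow I (a * s) \<subseteq> ipow (ipow I a) s"
proof (induction s)
  case (Suc s)
  have "ipow I (a * s + a) \<subseteq> ipow (ipow I a) (Suc s)"
    using Suc by (intro ipow_add_least subspace_ipow assms mult_ipow_Suc) auto
  then show ?case
    by (simp add: add.commute)
qed simp

lemma power_mem_ipow:
  assumes "idl.subspace I" "x \<in> I"
  shows "x ^ m \<in> ipow I m"
proof (induction m)
  case (Suc m)
  then show ?case
    using mult_ipow_Suc[OF Suc assms(2)] by (simp add: mult.commute)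
qed simp

subsection \<open>The localization\<close>

text \<open>Evaluates the operations of \<open>localization\<close>, which are unions over all
  representatives. The two given members make the index sets nonempty, so a union of equal sets
  collapses to that set.\<close>

lemma UN_UN_constant:
  assumes "(a, s) \<in> U" "(b, t) \<in> V"
    and "\<And>a s b t. (a, s) \<in> U \<Longrightarrow> (b, t) \<in> V \<Longrightarrow> f a s b t = C"
  shows "(\<Union>(a, s)\<in>U. \<Union>(b, t)\<in>V. f a s b t) = C"
proof -
  have "(\<Union>(b, t)\<in>V. f a s b t) = (\<Union>q\<in>V. C)" if "(a, s) \<in> U" for a s
    using assms(3)[OF that] by (intro SUP_cong) auto
  then have "(case p of (a, s) \<Rightarrow> \<Union>(b, t)\<in>V. f a s b t) = (\<Union>q\<in>V. C)" if "p \<in> U" for p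
    using that by (cases p) (simp only: prod.case)
  then have "(\<Union>(a, s)\<in>U. \<Union>(b, t)\<in>V. f a s b t) = (\<Union>p\<in>U. \<Union>q\<in>V. C)"
    by (rule SUP_cong[OF refl])
  also have "\<dots> = C"
    using assms(1,2) by auto
  finally show ?thesis .
qed

context
  fixes A :: "'a::comm_ring_1 set"
  assumes one_A: "1 \<in> A" and mult_A: "\<And>s t. s \<in> A \<Longrightarrow> t \<in> A \<Longrightarrow> s * t \<in> A"
begin

abbreviation (input) fracA :: "'a \<Rightarrow> 'a \<Rightarrow> ('a \<times> 'a) set" where
  "fracA a s \<equiv> fraction ring_of A a s"

lemma mem_fraction:
  "(b, t) \<in> fracA a s \<longleftrightarrow> t \<in> A \<and> (\<exists>u\<in>A. u * (a * t - b * s) = 0)"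
  by (simp add: fraction_def)

lemma fraction_self: "s \<in> A \<Longrightarrow> (a, s) \<in> fracA a s"
  using one_A by (auto simp: mem_fraction)

lemma fraction_eq_iff:
  assumes "s \<in> A" "t \<in> A"
  shows "fracA a s = fracA b t \<longleftrightarrow> (\<exists>u\<in>A. u * (a * t - b * s) = 0)"
proof
  assume "fracA a s = fracA b t"
  then have "(b, t) \<in> fracA a s"
    using fraction_self[OF assms(2)] by simp
  then show "\<exists>u\<in>A. u * (a * t - b * s) = 0"
    by (simp add: mem_fraction)
next
  have "fracA a s \<subseteq> fracA b t"
    if u: "u \<in> A" "u * (a * t - b * s) = 0" and s: "s \<in> A" for a b s t u
  proof (rule subsetI, clarify)
    fix c r assume "(c, r) \<in> fracA a s"
    then obtain v where v: "r \<in> A" "v \<in> A" "v * (a * r - c * s) = 0"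
      by (auto simp: mem_fraction)
    \<comment> \<open>Transitivity through the fraction a/s. The denominator s enters the multiplier
      because it may be a zero divisor and cannot be cancelled.\<close>
    have "(u * v * s) * (b * r - c * t)
        = u * t * (v * (a * r - c * s)) - v * r * (u * (a * t - b * s))"
      by (simp add: algebra_simps)
    then have "(u * v * s) * (b * r - c * t) = 0"
      using u v by simp
    then show "(c, r) \<in> fracA b t"
      using u v s mult_A by (auto simp: mem_fraction)
  qed
  note sub = this
  assume "\<exists>u\<in>A. u * (a * t - b * s) = 0"
  then obtain u where u: "u \<in> A" "u * (a * t - b * s) = 0"
    by blast
  moreover have "u * (b * s - a * t) = 0"
    using u(2) by (simp add: algebra_simps)
  ultimately show "fracA a s = fracA b t"
    using sub assms by (meson subset_antisym)
qed

abbreviation (input) locA :: "('a \<times> 'a) set ring" where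
  "locA \<equiv> localization ring_of A"

lemma carrier_localization: "carrier locA = {fracA a s | a s. s \<in> A}"
  by (simp add: localization_def)

lemma fraction_carrier: "s \<in> A \<Longrightarrow> fracA a s \<in> carrier locA"
  by (auto simp: carrier_localization)

lemma localization_mult:
  assumes "s \<in> A" "t \<in> A"
  shows "fracA a s \<otimes>\<^bsub>locA\<^esub> fracA b t = fracA (a * b) (s * t)"
proof -
  have "fracA (a' * b') (s' * t') = fracA (a * b) (s * t)"
    if reps: "(a', s') \<in> fracA a s" "(b', t') \<in> fracA b t" for a' s' b' t'
  proof -
    obtain u v where u: "s' \<in> A" "u \<in> A" "u * (a * s' - a' * s) = 0"
      and v: "t' \<in> A" "v \<in> A" "v * (b * t' - b' * t) = 0"
      using reps by (auto simp: mem_fraction)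
    have "u * v * ((a' * b') * (s * t) - (a * b) * (s' * t'))
        = - (v * b * t' * (u * (a * s' - a' * s)) + u * a' * s * (v * (b * t' - b' * t)))"
      by (simp add: algebra_simps)
    then have "u * v * ((a' * b') * (s * t) - (a * b) * (s' * t')) = 0"
      using u v by simp
    then show ?thesis
      using u v assms mult_A by (subst fraction_eq_iff) blast+
  qed
  note * = this
  have "fracA a s \<otimes>\<^bsub>locA\<^esub> fracA b t = (\<Union>(a', s')\<in>fracA a s. \<Union>(b', t')\<in>fracA b t. fracA (a' * b') (s' * t'))"
    unfolding localization_def by simp
  also have "\<dots> = fracA (a * b) (s * t)"
    by (rule UN_UN_constant[OF fraction_self[OF assms(1)] fraction_self[OF assms(2)]]) (rule *)
  finally show ?thesis .
qed

lemma localization_add: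
  assumes "s \<in> A" "t \<in> A"
  shows "fracA a s \<oplus>\<^bsub>locA\<^esub> fracA b t = fracA (a * t + b * s) (s * t)"
proof -
  have "fracA (a' * t' + b' * s') (s' * t') = fracA (a * t + b * s) (s * t)"
    if reps: "(a', s') \<in> fracA a s" "(b', t') \<in> fracA b t" for a' s' b' t'
  proof -
    obtain u v where u: "s' \<in> A" "u \<in> A" "u * (a * s' - a' * s) = 0"
      and v: "t' \<in> A" "v \<in> A" "v * (b * t' - b' * t) = 0"
      using reps by (auto simp: mem_fraction)
    have "u * v * ((a' * t' + b' * s') * (s * t) - (a * t + b * s) * (s' * t'))
        = - (v * t * t' * (u * (a * s' - a' * s)) + u * s * s' * (v * (b * t' - b' * t)))"
      by (simp add: algebra_simps)
    then have "u * v * ((a' * t' + b' * s') * (s * t) - (a * t + b * s) * (s' * t')) = 0"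
      using u v by simp
    then show ?thesis
      using u v assms mult_A by (subst fraction_eq_iff) blast+
  qed
  note * = this
  have "fracA a s \<oplus>\<^bsub>locA\<^esub> fracA b t = (\<Union>(a', s')\<in>fracA a s. \<Union>(b', t')\<in>fracA b t. fracA (a' * t' + b' * s') (s' * t'))"
    unfolding localization_def by simp
  also have "\<dots> = fracA (a * t + b * s) (s * t)"
    by (rule UN_UN_constant[OF fraction_self[OF assms(1)] fraction_self[OF assms(2)]]) (rule *)
  finally show ?thesis .
qed

lemma localization_zero_one: "\<zero>\<^bsub>locA\<^esub> = fracA 0 1" "\<one>\<^bsub>locA\<^esub> = fracA 1 1"
  by (simp_all add: localization_def)

lemmas localization_simps =
  localization_mult localization_add localization_zero_one mult_A one_A fraction_carrier

lemma fraction_eqI: "s \<in> A \<Longrightarrow> t \<in> A \<Longrightarrow> a * t = b * s \<Longrightarrow> fracA a s = fracA b t"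
  using one_A by (subst fraction_eq_iff) auto

lemma ring_localization: "ring locA"
proof (intro ringI abelian_groupI monoidI)
  fix x assume "x \<in> carrier locA"
  then obtain a s where "x = fracA a s" "s \<in> A"
    by (auto simp: carrier_localization)
  moreover have "fracA (- a) s \<oplus>\<^bsub>locA\<^esub> fracA a s = \<zero>\<^bsub>locA\<^esub>"
    using \<open>s \<in> A\<close> by (simp add: localization_simps, intro fraction_eqI) (auto simp: localization_simps)
  ultimately show "\<exists>y\<in>carrier locA. y \<oplus>\<^bsub>locA\<^esub> x = \<zero>\<^bsub>locA\<^esub>"
    by (blast intro: fraction_carrier)
next
  fix x y z assume "x \<in> carrier locA" "y \<in> carrier locA" "z \<in> carrier locA"
  then obtain a s b t c r where xyz: "x = fracA a s" "s \<in> A" "y = fracA b t" "t \<in> A" "z = fracA c r" "r \<in> A"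
    by (auto simp: carrier_localization)
  show "(x \<oplus>\<^bsub>locA\<^esub> y) \<otimes>\<^bsub>locA\<^esub> z = x \<otimes>\<^bsub>locA\<^esub> z \<oplus>\<^bsub>locA\<^esub> y \<otimes>\<^bsub>locA\<^esub> z"
    and "z \<otimes>\<^bsub>locA\<^esub> (x \<oplus>\<^bsub>locA\<^esub> y) = z \<otimes>\<^bsub>locA\<^esub> x \<oplus>\<^bsub>locA\<^esub> z \<otimes>\<^bsub>locA\<^esub> y"
    unfolding xyz using xyz(2,4,6)
    by (simp_all add: localization_simps)
      (rule fraction_eqI; simp add: localization_simps algebra_simps)+
qed (auto simp: carrier_localization localization_simps algebra_simps intro!: fraction_eqI,
     (blast intro: localization_simps)+)

text \<open>Contraction of an extended ideal. The fractions with numerator in I already form an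
  ideal of the localization, so the generated ideal contains nothing else, and it remains to unwind
  an equality f/1 = a/s.\<close>

lemma fraction_in_extension_iff:
  assumes I: "idl.subspace I"
  shows "fracA f 1 \<in> Idl\<^bsub>locA\<^esub> ((\<lambda>a. fracA a 1) ` I) \<longleftrightarrow> (\<exists>s\<in>A. s * f \<in> I)"
proof
  assume "\<exists>s\<in>A. s * f \<in> I"
  then obtain s where s: "s \<in> A" "s * f \<in> I"
    by blast
  have "fracA f 1 = fracA 1 s \<otimes>\<^bsub>locA\<^esub> fracA (s * f) 1"
    using s by (simp add: localization_simps) (intro fraction_eqI, auto simp: localization_simps)
  then show "fracA f 1 \<in> Idl\<^bsub>locA\<^esub> ((\<lambda>a. fracA a 1) ` I)"
    unfolding genideal_def using s
    by (auto intro!: ideal.I_l_closed fraction_carrier)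
next
  define J where "J = {fracA a s | a s. a \<in> I \<and> s \<in> A}"
  interpret ring locA
    by (rule ring_localization)
  have "ideal J locA"
  proof (rule idealI[OF ring_localization])
    show "subgroup J (add_monoid locA)"
    proof (rule group.subgroupI)
      show "Group.group (add_monoid locA)"
        using add.is_group .
      show "J \<subseteq> carrier (add_monoid locA)"
        by (auto simp: J_def carrier_localization)
      show "J \<noteq> {}"
        using one_A idl.subspace_0[OF I] by (auto simp: J_def)
    next
      fix x assume "x \<in> J"
      then obtain a s where x: "x = fracA a s" "a \<in> I" "s \<in> A"
        by (auto simp: J_def)
      have "fracA (- a) s \<oplus>\<^bsub>locA\<^esub> x = \<zero>\<^bsub>locA\<^esub>"
        using x by (simp add: localization_simps, intro fraction_eqI) (auto simp: localization_simps)
      then have "\<ominus>\<^bsub>locA\<^esub> x = fracA (- a) s"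
        using x by (intro minus_equality) (auto simp: localization_simps)
      then show "inv\<^bsub>add_monoid locA\<^esub> x \<in> J"
        using x idl.subspace_neg[OF I] by (auto simp: J_def a_inv_def)
    next
      fix x y assume "x \<in> J" "y \<in> J"
      then obtain a s b t where x: "x = fracA a s" "a \<in> I" "s \<in> A" and y: "y = fracA b t" "b \<in> I" "t \<in> A"
        by (auto simp: J_def)
      have "t * a + s * b \<in> I"
        using x y I by (intro idl.subspace_add idl.subspace_scale)
      moreover have "x \<otimes>\<^bsub>add_monoid locA\<^esub> y = fracA (t * a + s * b) (s * t)"
        using x y by (simp add: localization_simps mult.commute)
      ultimately show "x \<otimes>\<^bsub>add_monoid locA\<^esub> y \<in> J"
        using x y mult_A unfolding J_def by blast
    qed
  next
    fix x y assume "x \<in> J" "y \<in> carrier locA"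
    then obtain a s b t where x: "x = fracA a s" "a \<in> I" "s \<in> A" and y: "y = fracA b t" "t \<in> A"
      by (auto simp: J_def carrier_localization)
    have "b * a \<in> I"
      using x I by (intro idl.subspace_scale)
    moreover have "y \<otimes>\<^bsub>locA\<^esub> x = fracA (b * a) (t * s)" "x \<otimes>\<^bsub>locA\<^esub> y = fracA (b * a) (t * s)"
      using x y by (simp_all add: localization_simps mult.commute)
    ultimately show "y \<otimes>\<^bsub>locA\<^esub> x \<in> J" "x \<otimes>\<^bsub>locA\<^esub> y \<in> J"
      using x y mult_A unfolding J_def by blast+
  qed
  moreover have "(\<lambda>a. fracA a 1) ` I \<subseteq> J"
    using one_A by (auto simp: J_def)
  moreover assume "fracA f 1 \<in> Idl\<^bsub>locA\<^esub> ((\<lambda>a. fracA a 1) ` I)"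
  ultimately have "fracA f 1 \<in> J"
    unfolding genideal_def by blast
  then obtain a s where as: "fracA f 1 = fracA a s" "a \<in> I" "s \<in> A"
    by (auto simp: J_def)
  then obtain u where u: "u \<in> A" "u * (f * s - a * 1) = 0"
    using fraction_eq_iff[OF one_A as(3)] by blast
  then have "(u * s) * f = u * a"
    by (simp add: algebra_simps)
  moreover have "u * a \<in> I"
    using as I by (intro idl.subspace_scale)
  ultimately show "\<exists>s\<in>A. s * f \<in> I"
    using u as mult_A by metis
qed

end

subsection \<open>Symbolic powers and resurgence\<close>

definition ass_comp :: "'a::comm_ring_1 set \<Rightarrow> 'a set" where
  "ass_comp I = - \<Union>(ass I)"

lemma one_ass_comp: "1 \<in> ass_comp I"
  by (auto simp: ass_comp_def associated_primes_ring_of prime_idl_def)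

lemma mult_ass_comp: "s \<in> ass_comp I \<Longrightarrow> t \<in> ass_comp I \<Longrightarrow> s * t \<in> ass_comp I"
  by (auto simp: ass_comp_def associated_primes_ring_of prime_idl_def)

lemma prod_ass_comp: "(\<And>x. x \<in> K \<Longrightarrow> g x \<in> ass_comp I) \<Longrightarrow> prod g K \<in> ass_comp I"
  by (induction K rule: infinite_finite_induct) (auto simp: one_ass_comp mult_ass_comp)

abbreviation sympow :: "'a::comm_ring_1 set \<Rightarrow> nat \<Rightarrow> 'a set" where
  "sympow I m \<equiv> symbolic_power ring_of I m"

lemma sympow_iff:
  assumes "idl.subspace I"
  shows "f \<in> sympow I m \<longleftrightarrow> (\<exists>s\<in>ass_comp I. s * f \<in> ipow I m)"
  using fraction_in_extension_iff[OF one_ass_comp mult_ass_comp subspace_ipow[OF assms], where f = f]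
  by (auto simp: symbolic_power_def Let_def ass_comp_def Compl_eq_Diff_UNIV)

lemma subspace_sympow:
  assumes "idl.subspace I"
  shows "idl.subspace (sympow I m)"
  unfolding idl.subspace_def
proof (intro conjI allI ballI)
  note P = subspace_ipow[OF assms]
  show "0 \<in> sympow I m"
    using one_ass_comp idl.subspace_0[OF P] by (auto simp: sympow_iff assms)
  fix x assume "x \<in> sympow I m"
  then obtain s where s: "s \<in> ass_comp I" "s * x \<in> ipow I m"
    by (auto simp: sympow_iff assms)
  show "c * x \<in> sympow I m" for c
    using s idl.subspace_scale[OF P s(2), of c] by (auto simp: sympow_iff assms mult.left_commute)
  fix y assume "y \<in> sympow I m"
  then obtain t where t: "t \<in> ass_comp I" "t * y \<in> ipow I m"
    by (auto simp: sympow_iff assms)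
  have "(s * t) * (x + y) = t * (s * x) + s * (t * y)"
    by (simp add: algebra_simps)
  also have "\<dots> \<in> ipow I m"
    by (intro idl.subspace_add idl.subspace_scale[OF P s(2)] idl.subspace_scale[OF P t(2)] P)
  finally show "x + y \<in> sympow I m"
    using s t mult_ass_comp by (auto simp: sympow_iff assms)
qed

lemma ipow_subset_sympow: "idl.subspace I \<Longrightarrow> ipow I m \<subseteq> sympow I m"
  using one_ass_comp by (force simp: sympow_iff)

text \<open>Elements off the associated primes of I are not zero divisors modulo a symbolic power:
  the two denominators multiply.\<close>

lemma sympow_cancel:
  assumes "idl.subspace I" "s \<in> ass_comp I" "s * f \<in> sympow I m"
  shows "f \<in> sympow I m"
proof -
  obtain t where "t \<in> ass_comp I" "t * (s * f) \<in> ipow I m"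
    using assms by (auto simp: sympow_iff)
  then show ?thesis
    using assms mult_ass_comp by (auto simp: sympow_iff simp flip: mult.assoc)
qed

lemma sympow_antimono:
  assumes "idl.subspace I" "m \<le> n"
  shows "sympow I n \<subseteq> sympow I m"
  using ipow_antimono[OF assms] unfolding subset_iff sympow_iff[OF assms(1)] by blast

text \<open>The product of the individual denominators works. It serves to recombine the finitely
  many coefficients of a polynomial, which lie in symbolic powers of varying exponent.\<close>

lemma sympow_common_denominator:
  assumes I: "idl.subspace I" and "finite K" "\<And>x. x \<in> K \<Longrightarrow> f x \<in> sympow I (m x)"
  shows "\<exists>s\<in>ass_comp I. \<forall>x\<in>K. s * f x \<in> ipow I (m x)"
proof -
  have "\<forall>x\<in>K. \<exists>s. s \<in> ass_comp I \<and> s * f x \<in> ipow I (m x)"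
    using assms(3) unfolding sympow_iff[OF I] by blast
  then have "\<exists>s. \<forall>x\<in>K. s x \<in> ass_comp I \<and> s x * f x \<in> ipow I (m x)"
    by (rule bchoice)
  then obtain s where s: "\<And>x. x \<in> K \<Longrightarrow> s x \<in> ass_comp I" "\<And>x. x \<in> K \<Longrightarrow> s x * f x \<in> ipow I (m x)"
    by blast
  have "prod s K * f x \<in> ipow I (m x)" if "x \<in> K" for x
  proof -
    have "prod s K * f x = prod s (K - {x}) * (s x * f x)"
      using prod.remove[OF assms(2) that, of s] by (simp add: mult_ac)
    then show ?thesis
      using s that by (simp add: idl.subspace_scale subspace_ipow I)
  qed
  moreover have "prod s K \<in> ass_comp I"
    using s(1) by (rule prod_ass_comp)
  ultimately show ?thesis
    by blast
qed

text \<open>It is enough to match each failure of containment for I with a failure for J of at least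
  the same ratio.\<close>

lemma resurgence_mono:
  assumes "\<And>m r. 1 \<le> m \<Longrightarrow> 1 \<le> r \<Longrightarrow> \<not> sympow I m \<subseteq> ipow I r \<Longrightarrow>
      \<exists>m' r'. 1 \<le> m' \<and> 1 \<le> r' \<and> \<not> sympow J m' \<subseteq> ipow J r' \<and> real m / real r \<le> real m' / real r'"
  shows "resurgence ring_of I \<le> resurgence ring_of J"
  unfolding resurgence_def
proof (rule Sup_mono)
  fix a assume "a \<in> {ereal (real m / real r) | m r.
      1 \<le> m \<and> 1 \<le> r \<and> \<not> sympow I m \<subseteq> ipow I r}"
  then obtain m r where a: "a = ereal (real m / real r)"
    and mr: "1 \<le> m" "1 \<le> r" "\<not> sympow I m \<subseteq> ipow I r"
    by blast
  from assms[OF mr] obtain m' r' where *: "1 \<le> m'" "1 \<le> r'" "\<not> sympow J m' \<subseteq> ipow J r'"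
    and le: "real m / real r \<le> real m' / real r'"
    by blast
  from * have "ereal (real m' / real r') \<in> {ereal (real m / real r) | m r.
      1 \<le> m \<and> 1 \<le> r \<and> \<not> sympow J m \<subseteq> ipow J r}"
    by blast
  moreover have "a \<le> ereal (real m' / real r')"
    using le a by simp
  ultimately show "\<exists>b\<in>{ereal (real m / real r) | m r.
      1 \<le> m \<and> 1 \<le> r \<and> \<not> sympow J m \<subseteq> ipow J r}. a \<le> b"
    by (rule bexI[rotated])
qed

lemma resurgence_cong:
  assumes "\<And>m r. sympow I m \<subseteq> ipow I r \<longleftrightarrow> sympow J m \<subseteq> ipow J r"
  shows "resurgence ring_of I = resurgence ring_of J"
  using assms by (simp add: resurgence_def)

subsection \<open>Ring homomorphisms\<close>

locale ring_morphism =
  fixes h :: "'a::comm_ring_1 \<Rightarrow> 'b::comm_ring_1"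
  assumes h_one [simp]: "h 1 = 1"
    and h_add [simp]: "h (x + y) = h x + h y"
    and h_mult [simp]: "h (x * y) = h x * h y"
begin

lemma h_zero [simp]: "h 0 = 0"
  using h_add[of 0 0] by simp

lemma h_uminus [simp]: "h (- x) = - h x"
  using h_add[of x "- x"] by (simp add: eq_neg_iff_add_eq_0 add.commute)

lemma h_diff [simp]: "h (x - y) = h x - h y"
  using h_add[of x "- y"] by simp

lemma h_power [simp]: "h (x ^ n) = h x ^ n"
  by (induction n) simp_all

lemma h_sum [simp]: "h (sum g K) = (\<Sum>x\<in>K. h (g x))"
  by (induction K rule: infinite_finite_induct) simp_all

lemma h_prod [simp]: "h (prod g K) = (\<Prod>x\<in>K. h (g x))"
  by (induction K rule: infinite_finite_induct) simp_all

lemma subspace_vimage: "idl.subspace J \<Longrightarrow> idl.subspace (h -` J)"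
  by (rule idl.subspaceI) (simp_all add: idl.subspace_0 idl.subspace_add idl.subspace_scale)

lemma prime_idl_vimage: "prime_idl P \<Longrightarrow> prime_idl (h -` P)"
  by (simp add: prime_idl_def subspace_vimage)

lemma ipow_subset_vimage:
  assumes "idl.subspace J" "I \<subseteq> h -` J"
  shows "ipow I m \<subseteq> h -` ipow J m"
proof (induction m)
  case (Suc m)
  then show ?case
    using assms by (intro ipow_Suc_least subspace_vimage subspace_ipow) (auto intro!: mult_ipow_Suc)
qed simp

end

lemma ring_morphism_comp:
  "ring_morphism f \<Longrightarrow> ring_morphism g \<Longrightarrow> ring_morphism (\<lambda>x. f (g x))"
  by (simp add: ring_morphism_def)

lemma ring_morphism_inverse:
  assumes "ring_morphism h" "\<And>x. g (h x) = x" "\<And>y. h (g y) = y"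
  shows "ring_morphism g"
  using assms unfolding ring_morphism_def by metis

section \<open>Transport along an isomorphism of rings\<close>

context
  fixes h :: "'a::comm_ring_1 \<Rightarrow> 'b::comm_ring_1" and g
  assumes h: "ring_morphism h" and gh: "\<And>x. g (h x) = x" and hg: "\<And>y. h (g y) = y"
begin

lemma ipow_vimage_iso:
  assumes "idl.subspace K"
  shows "ipow (h -` K) m = h -` ipow K m"
proof -
  interpret h: ring_morphism h by (rule h)
  interpret g: ring_morphism g by (rule ring_morphism_inverse[OF h gh hg])
  have "ipow K m \<subseteq> g -` ipow (h -` K) m"
    by (intro g.ipow_subset_vimage h.subspace_vimage assms) (auto simp: hg)
  then have "g (h x) \<in> ipow (h -` K) m" if "h x \<in> ipow K m" for x
    using that by blast
  then have "h -` ipow K m \<subseteq> ipow (h -` K) m"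
    by (auto simp: gh)
  then show ?thesis
    using h.ipow_subset_vimage[OF assms, of "h -` K" m] by blast
qed

lemma colon_vimage_iso: "colon (h -` K) f = h -` colon K (h f)"
  by (auto simp: colon_def ring_morphism.h_mult[OF h])

lemma ass_comp_vimage_iso: "ass_comp (h -` K) = h -` ass_comp K"
proof -
  interpret h: ring_morphism h by (rule h)
  interpret g: ring_morphism g by (rule ring_morphism_inverse[OF h gh hg])
  have "h -` P \<in> ass (h -` K)" if P: "P \<in> ass K" for P
  proof -
    obtain f where f: "prime_idl P" "P = colon K f"
      using P by (rule assE)
    then have "h -` P = colon (h -` K) (g f)"
      by (simp add: colon_vimage_iso hg)
    then show ?thesis
      using f h.prime_idl_vimage by (metis assI)
  qed
  moreover have "g -` P \<in> ass K" if P: "P \<in> ass (h -` K)" for P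
  proof -
    obtain f where f: "prime_idl P" "P = colon (h -` K) f"
      using P by (rule assE)
    then have "g -` P = colon K (h f)"
      by (auto simp: colon_def hg)
    then show ?thesis
      using f g.prime_idl_vimage by (metis assI)
  qed
  ultimately show ?thesis
    unfolding ass_comp_def by (fastforce simp: gh)
qed

lemma sympow_vimage_iso:
  assumes "idl.subspace K"
  shows "sympow (h -` K) m = h -` sympow K m"
proof -
  interpret h: ring_morphism h by (rule h)
  have "(\<exists>s. h s \<in> ass_comp K \<and> h s * h f \<in> ipow K m) \<longleftrightarrow>
      (\<exists>s. s \<in> ass_comp K \<and> s * h f \<in> ipow K m)" for f
    using hg by metis
  then show ?thesis
    by (auto simp: set_eq_iff sympow_iff assms h.subspace_vimage ipow_vimage_iso ass_comp_vimage_iso Bex_def)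
qed

lemma resurgence_vimage_iso:
  assumes "idl.subspace K"
  shows "resurgence ring_of (h -` K) = resurgence ring_of K"
proof (rule resurgence_cong)
  have "h -` S \<subseteq> h -` T \<longleftrightarrow> S \<subseteq> T" for S T
    unfolding subset_iff vimage_eq using hg by metis
  then show "sympow (h -` K) m \<subseteq> ipow (h -` K) r \<longleftrightarrow> sympow K m \<subseteq> ipow K r" for m r
    by (simp add: sympow_vimage_iso ipow_vimage_iso assms)
qed

end

section \<open>Associated primes in a Noetherian ring\<close>

text \<open>The ascending chain condition, stated as well-foundedness of reverse strict inclusion so
  that it provides maximal elements and Noetherian induction directly. The argument is a token for
  the type.\<close>

definition noetherian :: "'a::comm_ring_1 itself \<Rightarrow> bool" where
  "noetherian _ \<longleftrightarrow> wf {(J, I :: 'a set). idl.subspace I \<and> idl.subspace J \<and> I \<subset> J}"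

lemma noetherian_maximal:
  assumes "noetherian TYPE('a::comm_ring_1)" "I \<in> F" "\<And>I. I \<in> F \<Longrightarrow> idl.subspace (I :: 'a set)"
  obtains M where "M \<in> F" "\<And>J. J \<in> F \<Longrightarrow> M \<subseteq> J \<Longrightarrow> J = M"
proof -
  obtain M where M: "M \<in> F"
    and max: "\<And>J. (J, M) \<in> {(J, I :: 'a set). idl.subspace I \<and> idl.subspace J \<and> I \<subset> J} \<Longrightarrow> J \<notin> F"
    using wfE_min[OF assms(1)[unfolded noetherian_def] assms(2)] by blast
  have "J = M" if "J \<in> F" "M \<subseteq> J" for J
    using max[of J] that assms(3) M by blast
  with M show ?thesis
    by (rule that)
qed

lemma colon_subset_colon_mult:
  assumes "idl.subspace I"
  shows "colon I g \<subseteq> colon I (b * g)"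
proof
  fix c assume "c \<in> colon I g"
  then have "b * (c * g) \<in> I"
    using assms by (simp add: colon_def idl.subspace_scale)
  then show "c \<in> colon I (b * g)"
    by (simp add: colon_def mult_ac)
qed

text \<open>A maximal member I : g of the family of proper colon ideals containing I : h is prime:
  if ab lies in I : g and b does not, then I : bg belongs to the family, contains I : g and hence
  equals it, and a lies in I : bg.\<close>

lemma ex_ass_supset_colon:
  assumes "noetherian TYPE('a::comm_ring_1)" and I: "idl.subspace (I :: 'a set)" and "h \<notin> I"
  shows "\<exists>P\<in>ass I. colon I h \<subseteq> P"
proof -
  define F where "F = {colon I g | g. g \<notin> I \<and> colon I h \<subseteq> colon I g}"
  have "colon I h \<in> F"
    using assms(3) unfolding F_def by blast
  then obtain M where "M \<in> F" and max: "\<And>J. J \<in> F \<Longrightarrow> M \<subseteq> J \<Longrightarrow> J = M"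
    by (rule noetherian_maximal[OF assms(1)]) (auto simp: F_def intro: subspace_colon I)
  then obtain g where g: "M = colon I g" "g \<notin> I" "colon I h \<subseteq> colon I g"
    unfolding F_def by blast
  have "a \<in> M" if ab: "a * b \<in> M" and b: "b \<notin> M" for a b
  proof -
    have sub: "M \<subseteq> colon I (b * g)"
      unfolding g by (rule colon_subset_colon_mult[OF I])
    have "b * g \<notin> I"
      using b by (simp add: g colon_def)
    then have "colon I (b * g) \<in> F"
      using sub g unfolding F_def by blast
    then have "colon I (b * g) = M"
      using sub by (rule max)
    moreover have "a \<in> colon I (b * g)"
      using ab by (simp add: g colon_def mult.assoc)
    ultimately show ?thesis
      by simp
  qed
  moreover have "1 \<notin> M"
    using g by (simp add: colon_def)
  ultimately have "prime_idl M"
    unfolding prime_idl_def g(1) using subspace_colon[OF I, of g] by blast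
  then show ?thesis
    using g assI by blast
qed

text \<open>Otherwise a product of elements of the \<open>A i\<close> outside P would lie in the
  intersection but not in P. For empty T the intersection is the whole ring, which is not contained
  in P.\<close>

lemma prime_idl_INT_subset:
  assumes "finite T" "\<And>i. i \<in> T \<Longrightarrow> idl.subspace (A i)" "prime_idl P" "(\<Inter>i\<in>T. A i) \<subseteq> P"
  shows "\<exists>i\<in>T. A i \<subseteq> P"
  using assms(1,2,4)
proof (induction T)
  case empty
  then show ?case
    using prime_idlD(2)[OF assms(3)] by auto
next
  case (insert i T)
  show ?case
  proof (rule ccontr)
    assume neg: "\<not> (\<exists>i\<in>insert i T. A i \<subseteq> P)"
    then have "\<not> (\<Inter>i\<in>T. A i) \<subseteq> P"
      using insert by blast
    then obtain b where b: "b \<in> (\<Inter>i\<in>T. A i)" "b \<notin> P"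
      by blast
    obtain a where a: "a \<in> A i" "a \<notin> P"
      using neg by blast
    have "a * b \<in> A j" if "j \<in> insert i T" for j
      using that
    proof
      assume "j = i"
      then show ?thesis
        using idl.subspace_scale[OF insert.prems(1)[of i] a(1), of b] by (simp add: mult.commute)
    next
      assume "j \<in> T"
      then show ?thesis
        using b by (intro idl.subspace_scale insert.prems(1)) auto
    qed
    then have "a * b \<in> P"
      using insert.prems(2) by blast
    then show False
      using a b prime_idlD(3)[OF assms(3)] by blast
  qed
qed

lemma colon_Int: "colon (I \<inter> J) f = colon I f \<inter> colon J f"
  by (auto simp: colon_def)

lemma ass_Int_subset:
  assumes "idl.subspace J" "idl.subspace K"
  shows "ass (J \<inter> K) \<subseteq> ass J \<union> ass K"
proof
  fix P assume "P \<in> ass (J \<inter> K)"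
  then obtain f where "prime_idl P" "P = colon (J \<inter> K) f"
    by (rule assE)
  then have f: "prime_idl P" "P = colon J f \<inter> colon K f"
    by (simp_all add: colon_Int)
  \<comment> \<open>The two ideals are indexed by the booleans to fit the lemma on finite
    intersections.\<close>
  let ?A = "\<lambda>b. if b then colon J f else colon K f"
  have "\<exists>b\<in>{True, False}. ?A b \<subseteq> P"
    using f by (intro prime_idl_INT_subset) (auto intro: subspace_colon assms)
  then have "P = colon J f \<or> P = colon K f"
    using f(2) by auto
  then show "P \<in> ass J \<union> ass K"
    using f(1) assI by blast
qed

text \<open>The submodule of R/I generated by f is a copy of the domain R/P, in which every nonzero
  element has annihilator P; x represents such an element.\<close>

lemma colon_eq_ass:
  assumes I: "idl.subspace I" and P: "prime_idl P" "P = colon I f" and x: "x = a * f + y" "y \<in> I" "x \<notin> I"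
  shows "colon I x = P"
proof -
  have iff: "c * x \<in> I \<longleftrightarrow> c * (a * f) \<in> I" for c
  proof -
    have "c * y \<in> I"
      using I x by (intro idl.subspace_scale)
    moreover have "c * x - c * (a * f) = c * y"
      by (simp add: x algebra_simps)
    ultimately show ?thesis
      using idl.subspace_add[OF I, of "c * y" "c * (a * f)"]
        idl.subspace_diff[OF I, of "c * x" "c * y"] by (auto simp: x algebra_simps)
  qed
  have "a \<notin> P"
    using iff[of 1] x P by (simp add: colon_def)
  have "c \<in> colon I x \<longleftrightarrow> c * a \<in> P" for c
    using iff P(2) by (simp add: colon_def mult.assoc)
  then show ?thesis
    using prime_idl_mult_iff[OF P(1)] \<open>a \<notin> P\<close> by blast
qed

lemma subspace_insert:
  assumes I: "idl.subspace I"
  shows "idl.subspace {a * f + y | a y. y \<in> I}"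
proof (rule idl.subspaceI)
  show "0 \<in> {a * f + y | a y. y \<in> I}"
    using idl.subspace_0[OF I] by (metis (mono_tags, lifting) CollectI add_0 mult_zero_left)
  fix x assume "x \<in> {a * f + y | a y. y \<in> I}"
  then obtain a y where x: "x = a * f + y" "y \<in> I"
    by blast
  have "c * x = (c * a) * f + c * y" "c * y \<in> I" for c
    using x I by (simp_all add: algebra_simps idl.subspace_scale)
  then show "c * x \<in> {a * f + y | a y. y \<in> I}" for c
    by blast
  fix z assume "z \<in> {a * f + y | a y. y \<in> I}"
  then obtain b w where z: "z = b * f + w" "w \<in> I"
    by blast
  have "x + z = (a + b) * f + (y + w)" "y + w \<in> I"
    using x z I by (simp_all add: algebra_simps idl.subspace_add)
  then show "x + z \<in> {a * f + y | a y. y \<in> I}"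
    by blast
qed

text \<open>Noetherian induction: an ideal with two distinct associated primes \<open>I : f\<close> and \<open>I : g\<close> is the
  intersection of the strictly larger ideals \<open>I + (f)\<close> and \<open>I + (g)\<close>.\<close>

lemma finite_ass:
  assumes "noetherian TYPE('a::comm_ring_1)" "idl.subspace (I :: 'a set)"
  shows "finite (ass I)"
  using assms(1)[unfolded noetherian_def] assms(2)
proof (induction I rule: wf_induct_rule)
  case (less I)
  note I = less.prems
  show ?case
  proof (cases "\<exists>P\<in>ass I. \<exists>Q\<in>ass I. P \<noteq> Q")
    case False
    then have "ass I \<subseteq> {SOME P. P \<in> ass I}"
      by (metis singleton_iff someI subsetI)
    then show ?thesis
      by (rule finite_subset) simp
  next
    case True
    then obtain P Q where PQ: "P \<in> ass I" "Q \<in> ass I" "P \<noteq> Q"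
      by blast
    obtain f where f: "prime_idl P" "P = colon I f" "f \<notin> I"
      using PQ(1) by (rule assE)
    obtain g where g: "prime_idl Q" "Q = colon I g" "g \<notin> I"
      using PQ(2) by (rule assE)
    define J where "J f = {a * f + y | a y. y \<in> I}" for f
    have J: "idl.subspace (J f)" for f
      unfolding J_def by (rule subspace_insert[OF I])
    have sub: "I \<subseteq> J f" for f
    proof
      fix y assume "y \<in> I"
      moreover have "y = 0 * f + y"
        by simp
      ultimately show "y \<in> J f"
        unfolding J_def by blast
    qed
    have mem: "f \<in> J f" for f
    proof -
      have "f = 1 * f + 0" "0 \<in> I"
        using idl.subspace_0[OF I] by simp_all
      then show ?thesis
        unfolding J_def by blast
    qed
    have fin: "finite (ass (J f))" if "f \<notin> I" for f
    proof (rule less.IH[OF _ J])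
      have "I \<subset> J f"
        using sub[of f] mem[of f] that by blast
      then show "(J f, I) \<in> {(J, I). idl.subspace I \<and> idl.subspace J \<and> I \<subset> J}"
        using I J by blast
    qed
    \<comment> \<open>A common element outside I would have both P and Q as its annihilator modulo
      I.\<close>
    have "x \<in> I" if x: "x \<in> J f" "x \<in> J g" for x
    proof (rule ccontr)
      assume nx: "x \<notin> I"
      obtain a y where "x = a * f + y" "y \<in> I"
        using x(1) unfolding J_def by blast
      then have "colon I x = P"
        using nx by (rule colon_eq_ass[OF I f(1,2)])
      moreover obtain b z where "x = b * g + z" "z \<in> I"
        using x(2) unfolding J_def by blast
      then have "colon I x = Q"
        using nx by (rule colon_eq_ass[OF I g(1,2)])
      ultimately show False
        using PQ(3) by simp
    qed
    then have "I = J f \<inter> J g"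
      using sub by blast
    then have "ass I \<subseteq> ass (J f) \<union> ass (J g)"
      using ass_Int_subset[OF J J] by metis
    then show ?thesis
      using fin[OF f(3)] fin[OF g(3)] by (meson finite_UnI finite_subset)
  qed
qed

text \<open>By induction there is for each Q in F an element \<open>x Q\<close> of I avoiding all
  the other members of F. If each \<open>x Q\<close> lies in its own Q, the element sought is the
  sum of one of them and the product of the others.\<close>

lemma prime_avoidance:
  assumes "finite F" "\<And>P. P \<in> F \<Longrightarrow> prime_idl P" and I: "idl.subspace I"
    and "\<And>P. P \<in> F \<Longrightarrow> \<not> I \<subseteq> P"
  shows "\<exists>x\<in>I. \<forall>P\<in>F. x \<notin> P"
  using assms(1,2,4)
proof (induction F rule: finite_psubset_induct)
  case (psubset F)
  show ?case
  proof (cases "\<exists>Q. F \<subseteq> {Q}")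
    case True
    then show ?thesis
      using psubset.prems(2) idl.subspace_0[OF I] by blast
  next
    case False
    have "\<exists>x\<in>I. \<forall>P\<in>F - {Q}. x \<notin> P" if "Q \<in> F" for Q
      using that psubset.prems by (intro psubset.IH) auto
    then have "\<forall>Q\<in>F. \<exists>x. x \<in> I \<and> (\<forall>P\<in>F - {Q}. x \<notin> P)"
      by blast
    then have "\<exists>x. \<forall>Q\<in>F. x Q \<in> I \<and> (\<forall>P\<in>F - {Q}. x Q \<notin> P)"
      by (rule bchoice)
    then obtain x where x: "\<And>Q. Q \<in> F \<Longrightarrow> x Q \<in> I" "\<And>P Q. Q \<in> F \<Longrightarrow> P \<in> F \<Longrightarrow> P \<noteq> Q \<Longrightarrow> x Q \<notin> P"
      by blast
    show ?thesis
    proof (cases "\<exists>Q\<in>F. x Q \<notin> Q")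
      case True
      then show ?thesis
        using x by metis
    next
      case inF: False
      obtain Q R where Q: "Q \<in> F" and R: "R \<in> F" "R \<noteq> Q"
        using False by blast
      \<comment> \<open>The product p lies in every member of F except Q, while \<open>x Q\<close>
        lies in Q and in no other member; so the sum avoids all of them. The second member R makes
        the product nonempty, which puts p into I.\<close>
      define p where "p = (\<Prod>P\<in>F - {Q}. x P)"
      have p_mem: "p \<in> J" if "P \<in> F - {Q}" "x P \<in> J" "idl.subspace J" for P J
      proof -
        have "p = (\<Prod>P\<in>F - {Q} - {P}. x P) * x P"
          unfolding p_def using psubset.hyps that(1) by (subst prod.remove[of _ P]) (auto simp: mult.commute)
        then show ?thesis
          using that by (simp add: idl.subspace_scale)
      qed
      have p_notin: "p \<notin> Q"
      proof -
        have "prod x S \<notin> Q" if "S \<subseteq> F - {Q}" for S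
          using finite_subset[OF that] psubset.hyps that
        proof (induction S rule: infinite_finite_induct)
          case (insert P S)
          then show ?case
            using x(2)[of P Q] Q prime_idlD(3)[OF psubset.prems(1)[OF Q], of "x P" "prod x S"] by auto
        qed (use prime_idlD(2)[OF psubset.prems(1)[OF Q]] in auto)
        then show ?thesis
          unfolding p_def by blast
      qed
      have "x Q + p \<notin> P" if P: "P \<in> F" for P
      proof (cases "P = Q")
        case True
        have "x Q \<in> Q"
          using inF Q by blast
        then show ?thesis
          using p_notin idl.subspace_diff[OF prime_idlD(1)[OF psubset.prems(1)[OF Q]], of "x Q + p" "x Q"] True
          by auto
      next
        case False
        have "p \<in> P"
          using False P inF by (intro p_mem[of P] prime_idlD(1) psubset.prems(1)) auto
        moreover have "x Q \<notin> P"
          using x(2) Q P False by blast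
        ultimately show ?thesis
          using idl.subspace_diff[OF prime_idlD(1)[OF psubset.prems(1)[OF P]], of "x Q + p" p] by auto
      qed
      moreover have "x Q + p \<in> I"
        using x(1) Q R by (intro idl.subspace_add[OF I] p_mem[of R] I) auto
      ultimately show ?thesis
        by blast
    qed
  qed
qed

section \<open>Extension of ideals to a polynomial ring in one variable\<close>

text \<open>The extension IR[x], described by coefficients. That it is generated by the constants
  from I is the content of \<open>const_mem_ext_ideal\<close> and
  \<open>ext_ideal_subset\<close>.\<close>

definition ext_ideal :: "'a::comm_ring_1 set \<Rightarrow> 'a poly set" where
  "ext_ideal I = {p. \<forall>n. Polynomial.coeff p n \<in> I}"

lemma ext_idealI: "(\<And>n. Polynomial.coeff p n \<in> I) \<Longrightarrow> p \<in> ext_ideal I"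
  and ext_idealD: "p \<in> ext_ideal I \<Longrightarrow> Polynomial.coeff p n \<in> I"
  by (simp_all add: ext_ideal_def)

lemma subspace_ext_ideal_mult:
  assumes "idl.subspace K" "\<And>a b. a \<in> I \<Longrightarrow> b \<in> J \<Longrightarrow> a * b \<in> K" "p \<in> ext_ideal I" "q \<in> ext_ideal J"
  shows "p * q \<in> ext_ideal K"
  by (intro ext_idealI, unfold coeff_mult, intro idl.subspace_sum assms)
    (auto intro: ext_idealD assms(3,4))

lemma subspace_ext_ideal:
  assumes "idl.subspace I"
  shows "idl.subspace (ext_ideal I)"
proof (rule idl.subspaceI)
  show "c * p \<in> ext_ideal I" if "p \<in> ext_ideal I" for c p
    by (rule subspace_ext_ideal_mult[OF assms, of UNIV I])
      (use that in \<open>auto intro: idl.subspace_scale[OF assms] simp: ext_ideal_def\<close>)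
qed (use assms in \<open>auto simp: ext_ideal_def idl.subspace_0 idl.subspace_add\<close>)

lemma const_mem_ext_ideal: "idl.subspace I \<Longrightarrow> [:a:] \<in> ext_ideal I \<longleftrightarrow> a \<in> I"
  by (auto simp: ext_ideal_def coeff_pCons idl.subspace_0 split: nat.splits)

lemma ext_ideal_mono: "I \<subseteq> J \<Longrightarrow> ext_ideal I \<subseteq> ext_ideal J"
  by (auto simp: ext_ideal_def)

lemma ext_ideal_subset_iff:
  assumes "idl.subspace I" "idl.subspace J"
  shows "ext_ideal I \<subseteq> ext_ideal J \<longleftrightarrow> I \<subseteq> J"
  using ext_ideal_mono const_mem_ext_ideal[OF assms(1)] const_mem_ext_ideal[OF assms(2)] by blast

lemma ring_morphism_const: "ring_morphism (\<lambda>a :: 'a::comm_ring_1. [:a:])"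
  by unfold_locales (simp_all add: one_pCons)

lemma ring_morphism_coeff_0: "ring_morphism (\<lambda>p :: 'a::comm_ring_1 poly. Polynomial.coeff p 0)"
  by unfold_locales (simp_all add: coeff_mult)

lemma poly_eq_sum_const_mult:
  fixes p :: "'a::comm_ring_1 poly"
  shows "p = (\<Sum>i\<le>Polynomial.degree p. [:Polynomial.coeff p i:] * Polynomial.monom 1 i)"
  by (subst (1) poly_as_sum_of_monoms[symmetric]) (simp add: smult_monom)

lemma ext_ideal_subset:
  assumes "idl.subspace J" "\<And>a. a \<in> I \<Longrightarrow> [:a:] \<in> J"
  shows "ext_ideal I \<subseteq> J"
proof
  fix p assume p: "p \<in> ext_ideal I"
  have "[:Polynomial.coeff p i:] * Polynomial.monom 1 i \<in> J" for i
    using idl.subspace_scale[OF assms(1) assms(2)[OF ext_idealD[OF p, of i]], of "Polynomial.monom 1 i"]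
    by (simp only: mult.commute)
  then have "(\<Sum>i\<le>Polynomial.degree p. [:Polynomial.coeff p i:] * Polynomial.monom 1 i) \<in> J"
    by (rule idl.subspace_sum[OF assms(1)])
  then show "p \<in> J"
    unfolding poly_eq_sum_const_mult[of p, symmetric] .
qed

lemma ipow_ext_ideal:
  assumes I: "idl.subspace I"
  shows "ipow (ext_ideal I) m = ext_ideal (ipow I m)"
proof
  show "ipow (ext_ideal I) m \<subseteq> ext_ideal (ipow I m)"
  proof (induction m)
    case 0
    then show ?case
      by (simp add: ext_ideal_def)
  next
    case (Suc m)
    show ?case
    proof (rule ipow_Suc_least[OF subspace_ext_ideal[OF subspace_ipow[OF I]]])
      fix p q assume "p \<in> ipow (ext_ideal I) m" "q \<in> ext_ideal I"
      then show "p * q \<in> ext_ideal (ipow I (Suc m))"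
        using Suc by (intro subspace_ext_ideal_mult[OF subspace_ipow[OF I] mult_ipow_Suc]) auto
    qed
  qed
  have "ipow I m \<subseteq> (\<lambda>a. [:a:]) -` ipow (ext_ideal I) m"
    by (intro ring_morphism.ipow_subset_vimage ring_morphism_const subspace_ext_ideal I)
      (auto simp: const_mem_ext_ideal I)
  then show "ext_ideal (ipow I m) \<subseteq> ipow (ext_ideal I) m"
    by (intro ext_ideal_subset subspace_ipow subspace_ext_ideal I) auto
qed

text \<open>The argument of Gauss: if i and j are the first positions where p and q have
  coefficients outside P, then the coefficient of pq at i + j is congruent modulo P to the product
  of these two.\<close>

lemma prime_idl_ext_ideal:
  assumes P: "prime_idl P"
  shows "prime_idl (ext_ideal P)"
  unfolding prime_idl_def
proof (intro conjI allI impI)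
  note sP = prime_idlD(1)[OF P]
  show "idl.subspace (ext_ideal P)"
    by (rule subspace_ext_ideal[OF sP])
  show "1 \<notin> ext_ideal P"
    using prime_idlD(2)[OF P] by (simp add: one_pCons const_mem_ext_ideal[OF sP])
  fix p q assume pq: "p * q \<in> ext_ideal P"
  show "p \<in> ext_ideal P \<or> q \<in> ext_ideal P"
  proof (rule ccontr)
    assume "\<not> (p \<in> ext_ideal P \<or> q \<in> ext_ideal P)"
    then have ex: "\<exists>i. Polynomial.coeff p i \<notin> P" "\<exists>j. Polynomial.coeff q j \<notin> P"
      by (auto simp: ext_ideal_def)
    define i where "i = (LEAST i. Polynomial.coeff p i \<notin> P)"
    define j where "j = (LEAST j. Polynomial.coeff q j \<notin> P)"
    have i: "Polynomial.coeff p i \<notin> P" "\<And>k. k < i \<Longrightarrow> Polynomial.coeff p k \<in> P"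
      using LeastI_ex[OF ex(1)] not_less_Least unfolding i_def by blast+
    have j: "Polynomial.coeff q j \<notin> P" "\<And>k. k < j \<Longrightarrow> Polynomial.coeff q k \<in> P"
      using LeastI_ex[OF ex(2)] not_less_Least unfolding j_def by blast+
    let ?t = "\<lambda>k. Polynomial.coeff p k * Polynomial.coeff q (i + j - k)"
    have "Polynomial.coeff (p * q) (i + j) = ?t i + sum ?t ({..i + j} - {i})"
      unfolding coeff_mult by (rule sum.remove) auto
    moreover have "sum ?t ({..i + j} - {i}) \<in> P"
    proof (rule idl.subspace_sum[OF sP])
      fix k assume "k \<in> {..i + j} - {i}"
      then consider "k < i" | "i + j - k < j"
        by fastforce
      then show "?t k \<in> P"
        using i(2) j(2) prime_idl_mult_iff[OF P] by cases blast+
    qed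
    ultimately have "?t i \<in> P"
      using ext_idealD[OF pq, of "i + j"] idl.subspace_diff[OF sP] by (metis add_diff_cancel_right')
    then show False
      using i(1) j(1) prime_idlD(3)[OF P] by auto
  qed
qed

text \<open>McCoy's theorem modulo \<open>J\<close>: an annihilator of minimal degree is killed by all coefficients of
  \<open>s\<close>, since otherwise multiplying it by a coefficient of \<open>s\<close> lowers its degree.\<close>

lemma mccoy:
  assumes J: "idl.subspace J" and "f \<notin> ext_ideal J" "s * f \<in> ext_ideal J"
  shows "\<exists>c. c \<notin> J \<and> (\<forall>i. Polynomial.coeff s i * c \<in> J)"
  using assms(2,3)
proof (induction "Polynomial.degree f" arbitrary: f rule: less_induct)
  case less
  note sJ = subspace_ext_ideal[OF J]
  show ?case
  proof (cases "\<forall>i. Polynomial.smult (Polynomial.coeff s i) f \<in> ext_ideal J")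
    case True
    obtain n where "Polynomial.coeff f n \<notin> J"
      using less.prems(1) by (auto simp: ext_ideal_def)
    moreover have "Polynomial.coeff s i * Polynomial.coeff f n \<in> J" for i
      using ext_idealD[OF True[rule_format], of i n] by simp
    ultimately show ?thesis
      by blast
  next
    case False
    define bad where "bad = {i. Polynomial.smult (Polynomial.coeff s i) f \<notin> ext_ideal J}"
    have "bad \<subseteq> {..Polynomial.degree s}"
    proof
      fix i assume "i \<in> bad"
      then have "Polynomial.coeff s i \<noteq> 0"
        using idl.subspace_0[OF sJ] by (auto simp: bad_def)
      then show "i \<in> {..Polynomial.degree s}"
        by (simp add: le_degree)
    qed
    then have fin: "finite bad" "bad \<noteq> {}"
      using False finite_subset by (auto simp: bad_def)
    define i where "i = Max bad"
    have i: "i \<in> bad"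
      unfolding i_def using fin by (rule Max_in)
    have above: "Polynomial.coeff s k * Polynomial.coeff f l \<in> J" if "k > i" for k l
    proof -
      have "k \<notin> bad"
        using that Max_ge[OF fin(1), of k] unfolding i_def by auto
      then show ?thesis
        using ext_idealD[of "Polynomial.smult (Polynomial.coeff s k) f" J l] by (simp add: bad_def)
    qed
    define n where "n = Polynomial.degree f"
    define a where "a = Polynomial.coeff s i * Polynomial.coeff f n"
    let ?t = "\<lambda>k. Polynomial.coeff s k * Polynomial.coeff f (i + n - k)"
    \<comment> \<open>Modulo J only the term k = i survives: for k > i the coefficient of s kills f,
      by maximality of i, and for k < i the coefficient of f lies beyond its degree.\<close>
    have "Polynomial.coeff (s * f) (i + n) = ?t i + sum ?t ({..i + n} - {i})"
      unfolding coeff_mult by (rule sum.remove) auto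
    moreover have "sum ?t ({..i + n} - {i}) \<in> J"
    proof (rule idl.subspace_sum[OF J])
      fix k assume "k \<in> {..i + n} - {i}"
      then consider "k > i" | "i + n - k > n"
        by fastforce
      then show "?t k \<in> J"
      proof cases
        case 2
        then show ?thesis
          using idl.subspace_0[OF J] by (simp add: coeff_eq_0 n_def)
      qed (rule above)
    qed
    ultimately have a: "a \<in> J"
      using ext_idealD[OF less.prems(2), of "i + n"] idl.subspace_diff[OF J]
      unfolding a_def by (metis add_diff_cancel_left' add_diff_cancel_right')
    have mon: "Polynomial.monom a n \<in> ext_ideal J"
      using a idl.subspace_0[OF J] by (auto simp: ext_ideal_def)
    \<comment> \<open>The subtracted leading term lies in J, so g is the multiple of f modulo J,
      still not zero there, but of smaller degree.\<close>
    define g where "g = Polynomial.smult (Polynomial.coeff s i) f - Polynomial.monom a n"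
    have g: "g \<notin> ext_ideal J"
      using i idl.subspace_add[OF sJ _ mon, of g] by (auto simp: bad_def g_def)
    have "Polynomial.degree g \<le> n"
      unfolding g_def n_def
      by (intro degree_diff_le degree_smult_le) (simp add: degree_monom_le)
    moreover have "Polynomial.coeff g n = 0"
      by (simp add: g_def a_def)
    moreover have "g \<noteq> 0"
      using g idl.subspace_0[OF sJ] by auto
    ultimately have "Polynomial.degree g < n"
      using leading_coeff_0_iff[of g] by (metis le_neq_implies_less)
    moreover have "s * g \<in> ext_ideal J"
    proof -
      have "s * g = [:Polynomial.coeff s i:] * (s * f) - s * Polynomial.monom a n"
        by (simp add: g_def algebra_simps)
      then show ?thesis
        using less.prems(2) mon by (metis idl.subspace_diff idl.subspace_scale sJ)
    qed
    ultimately show ?thesis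
      using g less.hyps[of g] by (simp add: n_def)
  qed
qed

lemma colon_ext_ideal: "colon (ext_ideal I) [:g:] = ext_ideal (colon I g)"
  by (auto simp: colon_def ext_ideal_def mult.commute)

lemma ext_ideal_ass: "P \<in> ass I \<Longrightarrow> ext_ideal P \<in> ass (ext_ideal I)"
  by (elim assE) (metis assI colon_ext_ideal prime_idl_ext_ideal)

text \<open>If the constant s kills h modulo IR[x], then it kills some coefficient of h that is not
  in I, and the annihilator of that coefficient lies in an associated prime of I.\<close>

lemma const_ass_comp_ext_ideal:
  assumes "noetherian TYPE('a::comm_ring_1)" "idl.subspace (I :: 'a set)" and s: "s \<in> ass_comp I"
  shows "[:s:] \<in> ass_comp (ext_ideal I)"
proof (rule ccontr)
  assume "[:s:] \<notin> ass_comp (ext_ideal I)"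
  then obtain Q where "Q \<in> ass (ext_ideal I)" "[:s:] \<in> Q"
    by (auto simp: ass_comp_def)
  then obtain h where h: "h \<notin> ext_ideal I" "[:s:] \<in> colon (ext_ideal I) h"
    by (auto elim!: assE)
  then obtain j where j: "Polynomial.coeff h j \<notin> I"
    by (auto simp: ext_ideal_def)
  then obtain P where "P \<in> ass I" "colon I (Polynomial.coeff h j) \<subseteq> P"
    using ex_ass_supset_colon[OF assms(1,2)] by blast
  moreover have "s \<in> colon I (Polynomial.coeff h j)"
    using h by (simp add: colon_def ext_ideal_def)
  ultimately show False
    using s by (auto simp: ass_comp_def)
qed

lemma sympow_ext_ideal:
  assumes noeth: "noetherian TYPE('a::comm_ring_1)" and I: "idl.subspace (I :: 'a set)"
  shows "sympow (ext_ideal I) m = ext_ideal (sympow I m)"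
proof
  note sI = subspace_ext_ideal[OF I]
  show "ext_ideal (sympow I m) \<subseteq> sympow (ext_ideal I) m"
  proof (rule ext_ideal_subset[OF subspace_sympow[OF sI]])
    fix a assume "a \<in> sympow I m"
    then obtain s where s: "s \<in> ass_comp I" "s * a \<in> ipow I m"
      by (auto simp: sympow_iff I)
    then have "[:s:] * [:a:] \<in> ipow (ext_ideal I) m"
      by (simp add: ipow_ext_ideal I const_mem_ext_ideal subspace_ipow mult.commute)
    then show "[:a:] \<in> sympow (ext_ideal I) m"
      using const_ass_comp_ext_ideal[OF noeth I s(1)] unfolding sympow_iff[OF sI] by blast
  qed
  show "sympow (ext_ideal I) m \<subseteq> ext_ideal (sympow I m)"
  proof (rule subsetI, rule ccontr)
    note J = subspace_sympow[OF I, of m]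
    fix f assume "f \<in> sympow (ext_ideal I) m" and f: "f \<notin> ext_ideal (sympow I m)"
    then obtain s where s: "s \<in> ass_comp (ext_ideal I)" "s * f \<in> ext_ideal (ipow I m)"
      by (auto simp: sympow_iff sI ipow_ext_ideal I)
    have "s * f \<in> ext_ideal (sympow I m)"
      using s(2) ext_ideal_mono[OF ipow_subset_sympow[OF I]] by blast
    then obtain c where c: "c \<notin> sympow I m" "\<And>i. Polynomial.coeff s i * c \<in> sympow I m"
      using mccoy[OF J f] by blast
    define K where "K = colon (sympow I m) c"
    have K: "idl.subspace K"
      unfolding K_def by (rule subspace_colon[OF J])
    have "b \<notin> ass_comp I" if "b \<in> K" for b
      using that c(1) sympow_cancel[OF I, of b c m] by (auto simp: K_def colon_def)
    then have "\<not> (\<exists>b\<in>K. \<forall>P\<in>ass I. b \<notin> P)"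
      by (auto simp: ass_comp_def)
    \<comment> \<open>A single prime is essential: coefficients of s scattered over several
      associated primes would not place s in any P[x].\<close>
    then obtain P where P: "P \<in> ass I" "K \<subseteq> P"
      using prime_avoidance[OF finite_ass[OF noeth I] _ K] by (metis assE)
    have "Polynomial.coeff s i \<in> P" for i
      using c(2)[of i] P(2) by (auto simp: K_def colon_def)
    then have "s \<in> ext_ideal P"
      by (rule ext_idealI)
    then show False
      using s(1) ext_ideal_ass[OF P(1)] by (auto simp: ass_comp_def)
  qed
qed

theorem resurgence_ext_ideal:
  assumes "noetherian TYPE('a::comm_ring_1)" and I: "idl.subspace (I :: 'a set)"
  shows "resurgence ring_of (ext_ideal I) = resurgence ring_of I"
  by (rule resurgence_cong)
    (simp add: sympow_ext_ideal[OF assms] ipow_ext_ideal[OF I] ext_ideal_subset_iff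
      subspace_sympow[OF I] subspace_ipow[OF I])

section \<open>Contraction of ideals to a polynomial ring in one variable\<close>

definition contr_ideal :: "'a::comm_ring_1 set \<Rightarrow> 'a poly set" where
  "contr_ideal I = (\<lambda>p. Polynomial.coeff p 0) -` I"

lemma mem_contr_ideal: "p \<in> contr_ideal I \<longleftrightarrow> Polynomial.coeff p 0 \<in> I"
  by (simp add: contr_ideal_def)

lemma subspace_contr_ideal: "idl.subspace I \<Longrightarrow> idl.subspace (contr_ideal I)"
  unfolding contr_ideal_def by (rule ring_morphism.subspace_vimage[OF ring_morphism_coeff_0])

lemma colon_contr_ideal: "colon (contr_ideal I) f = contr_ideal (colon I (Polynomial.coeff f 0))"
  by (auto simp: colon_def contr_ideal_def coeff_mult)

lemma prime_idl_contr_ideal_iff: "prime_idl (contr_ideal P) \<longleftrightarrow> prime_idl P"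
proof
  assume "prime_idl P"
  then show "prime_idl (contr_ideal P)"
    unfolding contr_ideal_def by (rule ring_morphism.prime_idl_vimage[OF ring_morphism_coeff_0])
next
  assume "prime_idl (contr_ideal P)"
  then have "prime_idl ((\<lambda>a. [:a:]) -` contr_ideal P)"
    by (rule ring_morphism.prime_idl_vimage[OF ring_morphism_const])
  then show "prime_idl P"
    by (simp add: contr_ideal_def vimage_def)
qed

text \<open>R[x]/(I + (x)) is R/I, and a colon of \<open>contr_ideal I\<close> depends only on the
  constant coefficient. Hence the associated primes are exactly the ideals P + (x) with P associated
  to I.\<close>

lemma ass_comp_contr_ideal: "ass_comp (contr_ideal I) = contr_ideal (ass_comp I)"
proof -
  have "ass (contr_ideal I) = contr_ideal ` ass I"
  proof
    show "ass (contr_ideal I) \<subseteq> contr_ideal ` ass I"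
    proof
      fix Q assume "Q \<in> ass (contr_ideal I)"
      then obtain f where "prime_idl Q" "Q = colon (contr_ideal I) f"
        by (rule assE)
      then have "Q = contr_ideal (colon I (Polynomial.coeff f 0))" "prime_idl (colon I (Polynomial.coeff f 0))"
        by (simp_all add: colon_contr_ideal prime_idl_contr_ideal_iff)
      then show "Q \<in> contr_ideal ` ass I"
        using assI by blast
    qed
    show "contr_ideal ` ass I \<subseteq> ass (contr_ideal I)"
    proof
      fix Q assume "Q \<in> contr_ideal ` ass I"
      then obtain f where "Q = contr_ideal (colon I f)" "prime_idl (colon I f)"
        by (auto elim!: assE)
      then show "Q \<in> ass (contr_ideal I)"
        using assI[of "contr_ideal I" "[:f:]"] by (simp add: colon_contr_ideal prime_idl_contr_ideal_iff)
    qed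
  qed
  then show ?thesis
    by (auto simp: ass_comp_def mem_contr_ideal)
qed

text \<open>The subtraction is truncated: for j \<ge> m the condition reads
  \<open>ipow I 0 = UNIV\<close> and is void, since x^j then lies in the m-th power by
  itself.\<close>

lemma ipow_contr_ideal:
  assumes I: "idl.subspace I"
  shows "ipow (contr_ideal I) m = {p. \<forall>j. Polynomial.coeff p j \<in> ipow I (m - j)}"
proof
  note sI = subspace_contr_ideal[OF I]
  have sub: "idl.subspace {p. \<forall>j. Polynomial.coeff p j \<in> ipow I (m - j)}" for m
  proof (rule idl.subspaceI)
    fix p q assume q: "q \<in> {p. \<forall>j. Polynomial.coeff p j \<in> ipow I (m - j)}"
    have "Polynomial.coeff p i * Polynomial.coeff q (j - i) \<in> ipow I (m - j)" for i j
    proof -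
      have "Polynomial.coeff q (j - i) \<in> ipow I (m - j)"
        using q ipow_antimono[OF I, of "m - j" "m - (j - i)"] diff_le_mono2[of "j - i" j m] by auto
      then show ?thesis
        by (intro idl.subspace_scale subspace_ipow I)
    qed
    then show "p * q \<in> {p. \<forall>j. Polynomial.coeff p j \<in> ipow I (m - j)}"
      by (auto simp: coeff_mult intro!: idl.subspace_sum subspace_ipow I)
  qed (auto simp: idl.subspace_0 idl.subspace_add subspace_ipow I)
  show "ipow (contr_ideal I) m \<subseteq> {p. \<forall>j. Polynomial.coeff p j \<in> ipow I (m - j)}"
  proof (induction m)
    case (Suc m)
    show ?case
    proof (rule ipow_Suc_least[OF sub], intro CollectI allI)
      fix p q j assume p: "p \<in> ipow (contr_ideal I) m" and q: "q \<in> contr_ideal I"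
      show "Polynomial.coeff (p * q) j \<in> ipow I (Suc m - j)"
        unfolding coeff_mult
      proof (rule idl.subspace_sum[OF subspace_ipow[OF I]])
        fix i assume "i \<in> {..j}"
        have pi: "Polynomial.coeff p i \<in> ipow I (m - i)"
          using p Suc by blast
        \<comment> \<open>Only the constant coefficient of q is known to lie in I, and it is needed
          only for i = j. For i < j the coefficient of p alone lies in a high enough power.\<close>
        show "Polynomial.coeff p i * Polynomial.coeff q (j - i) \<in> ipow I (Suc m - j)"
        proof (cases "i = j")
          case True
          have "Polynomial.coeff p i * Polynomial.coeff q 0 \<in> ipow I (Suc (m - i))"
            using pi q by (intro mult_ipow_Suc) (simp_all add: mem_contr_ideal)
          moreover have "Suc m - i \<le> Suc (m - i)"
            by arith
          ultimately show ?thesis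
            using ipow_antimono[OF I, of "Suc m - i" "Suc (m - i)"] True by auto
        next
          case False
          then have "Suc m - j \<le> m - i"
            using \<open>i \<in> {..j}\<close> by auto
          then have "Polynomial.coeff p i \<in> ipow I (Suc m - j)"
            using ipow_antimono[OF I] pi by blast
          then show ?thesis
            using idl.subspace_scale[OF subspace_ipow[OF I]] by (simp add: mult.commute)
        qed
      qed
    qed
  qed simp
  show "{p. \<forall>j. Polynomial.coeff p j \<in> ipow I (m - j)} \<subseteq> ipow (contr_ideal I) m"
  proof clarify
    fix p assume p: "\<forall>j. Polynomial.coeff p j \<in> ipow I (m - j)"
    have "[:Polynomial.coeff p j:] * Polynomial.monom 1 j \<in> ipow (contr_ideal I) m" for j
    proof -
      have "ipow I (m - j) \<subseteq> (\<lambda>a. [:a:]) -` ipow (contr_ideal I) (m - j)"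
        by (intro ring_morphism.ipow_subset_vimage ring_morphism_const sI) (auto simp: mem_contr_ideal)
      then have "[:Polynomial.coeff p j:] \<in> ipow (contr_ideal I) (m - j)"
        using p by blast
      moreover have "Polynomial.monom 1 1 \<in> contr_ideal I"
        using idl.subspace_0[OF I] by (simp add: mem_contr_ideal)
      then have "Polynomial.monom 1 1 ^ j \<in> ipow (contr_ideal I) j"
        by (rule power_mem_ipow[OF sI])
      then have "Polynomial.monom 1 j \<in> ipow (contr_ideal I) j"
        by (simp add: monom_power)
      ultimately have "[:Polynomial.coeff p j:] * Polynomial.monom 1 j \<in> ipow (contr_ideal I) ((m - j) + j)"
        by (rule mult_ipow[OF sI])
      \<comment> \<open>An inequality because for j > m the truncated exponent gives j on the
        right.\<close>
      moreover have "m \<le> (m - j) + j"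
        by simp
      ultimately show ?thesis
        using ipow_antimono[OF sI] by blast
    qed
    then have "(\<Sum>i\<le>Polynomial.degree p. [:Polynomial.coeff p i:] * Polynomial.monom 1 i)
        \<in> ipow (contr_ideal I) m"
      by (rule idl.subspace_sum[OF subspace_ipow[OF sI]])
    then show "p \<in> ipow (contr_ideal I) m"
      unfolding poly_eq_sum_const_mult[of p, symmetric] .
  qed
qed

text \<open>From left to right the system for the coefficients of f is triangular: the constant
  coefficient of s times \<open>coeff f j\<close> is \<open>coeff (s * f) j\<close> minus terms with
  earlier coefficients of f, which lie in smaller symbolic powers, and the constant coefficient of s
  can be cancelled. From right to left a common denominator, taken as a constant polynomial,
  suffices.\<close>

lemma sympow_contr_ideal:
  assumes I: "idl.subspace I"
  shows "sympow (contr_ideal I) m = {p. \<forall>j. Polynomial.coeff p j \<in> sympow I (m - j)}"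
proof (rule subset_antisym; rule subsetI)
  note sI = subspace_contr_ideal[OF I]
  fix f assume "f \<in> sympow (contr_ideal I) m"
  then obtain s where s0: "Polynomial.coeff s 0 \<in> ass_comp I"
    and sf: "\<And>j. Polynomial.coeff (s * f) j \<in> ipow I (m - j)"
    by (auto simp: sympow_iff sI ipow_contr_ideal I ass_comp_contr_ideal mem_contr_ideal)
  have "Polynomial.coeff f j \<in> sympow I (m - j)" for j
  proof (induction j rule: less_induct)
    case (less j)
    note S = subspace_sympow[OF I, of "m - j"]
    let ?t = "\<lambda>i. Polynomial.coeff s i * Polynomial.coeff f (j - i)"
    have "Polynomial.coeff (s * f) j = ?t 0 + sum ?t ({..j} - {0})"
      unfolding coeff_mult by (rule sum.remove) auto
    moreover have "sum ?t ({..j} - {0}) \<in> sympow I (m - j)"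
    proof (intro idl.subspace_sum[OF S] idl.subspace_scale[OF S])
      fix i assume "i \<in> {..j} - {0}"
      then have "Polynomial.coeff f (j - i) \<in> sympow I (m - (j - i))"
        by (intro less) auto
      then show "Polynomial.coeff f (j - i) \<in> sympow I (m - j)"
        using sympow_antimono[OF I, of "m - j" "m - (j - i)"] diff_le_mono2[of "j - i" j m] by auto
    qed
    moreover have "Polynomial.coeff (s * f) j \<in> sympow I (m - j)"
      using sf ipow_subset_sympow[OF I] by blast
    ultimately have "?t 0 \<in> sympow I (m - j)"
      using idl.subspace_diff[OF S] by (metis add_diff_cancel_right')
    then show ?case
      using sympow_cancel[OF I s0] by simp
  qed
  then show "f \<in> {p. \<forall>j. Polynomial.coeff p j \<in> sympow I (m - j)}"
    by blast
next
  note sI = subspace_contr_ideal[OF I]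
  fix f assume "f \<in> {p. \<forall>j. Polynomial.coeff p j \<in> sympow I (m - j)}"
  then have "\<And>j. Polynomial.coeff f j \<in> sympow I (m - j)"
    by blast
  then obtain s where s: "s \<in> ass_comp I"
    "\<And>j. j \<le> Polynomial.degree f \<Longrightarrow> s * Polynomial.coeff f j \<in> ipow I (m - j)"
    using sympow_common_denominator[OF I, of "{..Polynomial.degree f}" "Polynomial.coeff f" "\<lambda>j. m - j"]
    by auto
  have "Polynomial.coeff ([:s:] * f) j \<in> ipow I (m - j)" for j
    using s(2)[of j] idl.subspace_0[OF subspace_ipow[OF I]]
    by (cases "j \<le> Polynomial.degree f") (simp_all add: coeff_eq_0)
  then have "[:s:] * f \<in> ipow (contr_ideal I) m"
    by (simp add: ipow_contr_ideal[OF I])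
  moreover have "[:s:] \<in> ass_comp (contr_ideal I)"
    using s by (simp add: ass_comp_contr_ideal mem_contr_ideal)
  ultimately show "f \<in> sympow (contr_ideal I) m"
    unfolding sympow_iff[OF sI] by blast
qed

theorem resurgence_contr_ideal:
  assumes I: "idl.subspace I" and strict: "\<And>m r. m < r \<Longrightarrow> \<not> ipow I m \<subseteq> ipow I r"
  shows "resurgence ring_of (contr_ideal I) = resurgence ring_of I"
proof (rule antisym)
  show "resurgence ring_of I \<le> resurgence ring_of (contr_ideal I)"
  proof (rule resurgence_mono)
    fix m r :: nat assume mr: "1 \<le> m" "1 \<le> r" "\<not> sympow I m \<subseteq> ipow I r"
    then obtain a where a: "a \<in> sympow I m" "a \<notin> ipow I r"
      by blast
    have "[:a:] \<in> sympow (contr_ideal I) m"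
      using a(1) idl.subspace_0[OF subspace_sympow[OF I]]
      by (simp add: sympow_contr_ideal[OF I] coeff_pCons split: nat.splits)
    moreover have "Polynomial.coeff [:a:] 0 \<notin> ipow I (r - 0)"
      using a(2) by simp
    then have "[:a:] \<notin> ipow (contr_ideal I) r"
      unfolding ipow_contr_ideal[OF I] by blast
    ultimately show "\<exists>m' r'. 1 \<le> m' \<and> 1 \<le> r' \<and> \<not> sympow (contr_ideal I) m' \<subseteq> ipow (contr_ideal I) r' \<and>
        real m / real r \<le> real m' / real r'"
      using mr(1,2) by blast
  qed
  show "resurgence ring_of (contr_ideal I) \<le> resurgence ring_of I"
  proof (rule resurgence_mono)
    fix m r :: nat
    assume mr: "1 \<le> m" "1 \<le> r" "\<not> sympow (contr_ideal I) m \<subseteq> ipow (contr_ideal I) r"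
    show "\<exists>m' r'. 1 \<le> m' \<and> 1 \<le> r' \<and> \<not> sympow I m' \<subseteq> ipow I r' \<and> real m / real r \<le> real m' / real r'"
    proof (cases "m < r")
      case True
      then have "\<not> sympow I m \<subseteq> ipow I r"
        using strict ipow_subset_sympow[OF I] by blast
      then show ?thesis
        using mr(1,2) by blast
    next
      case False
      obtain f where "f \<in> sympow (contr_ideal I) m" "f \<notin> ipow (contr_ideal I) r"
        using mr(3) by blast
      then obtain j where j: "Polynomial.coeff f j \<in> sympow I (m - j)" "Polynomial.coeff f j \<notin> ipow I (r - j)"
        by (auto simp: sympow_contr_ideal[OF I] ipow_contr_ideal[OF I])
      \<comment> \<open>For j \<ge> r the power \<open>ipow I (r - j)\<close> is the whole ring and
        excludes nothing.\<close>
      then have "j < r"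
        by (cases "j < r") simp_all
      \<comment> \<open>After expansion this is j r \<le> j m, which holds as r \<le> m.\<close>
      have "real m * real (r - j) \<le> real (m - j) * real r"
        using False \<open>j < r\<close> by (simp add: of_nat_diff algebra_simps mult_left_mono)
      then have "real m / real r \<le> real (m - j) / real (r - j)"
        using \<open>j < r\<close> mr by (simp add: divide_simps)
      moreover have "1 \<le> m - j" "1 \<le> r - j"
        using False \<open>j < r\<close> by auto
      ultimately show ?thesis
        using j by blast
    qed
  qed
qed

section \<open>Substitution homomorphisms\<close>

lemma sum_single_lookup:
  "(\<Sum>\<mu>\<in>Poly_Mapping.keys f. Poly_Mapping.single \<mu> (Poly_Mapping.lookup f \<mu>)) = f"
proof (rule poly_mapping_eqI)
  fix \<nu>
  have "Poly_Mapping.lookup (Poly_Mapping.single \<mu> (Poly_Mapping.lookup f \<mu>)) \<nu>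
      = (if \<mu> = \<nu> then Poly_Mapping.lookup f \<nu> else 0)" for \<mu>
    by (simp add: lookup_single)
  then show "Poly_Mapping.lookup (\<Sum>\<mu>\<in>Poly_Mapping.keys f.
      Poly_Mapping.single \<mu> (Poly_Mapping.lookup f \<mu>)) \<nu> = Poly_Mapping.lookup f \<nu>"
    by (simp add: lookup_sum in_keys_iff)
qed

lemma ring_morphism_Const: "ring_morphism (Const :: 'k::comm_ring_1 \<Rightarrow> ('n, 'k) mpoly)"
  by unfold_locales (simp_all add: Const_def single_add mult_single)

lemma Var_power: "(Var i :: ('n, 'k::comm_ring_1) mpoly) ^ n = Poly_Mapping.single (Poly_Mapping.single i n) 1"
  by (induction n) (simp_all add: Var_def mult_single flip: single_add)

lemma single_eq_Const_mult_prod_Var: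
  fixes \<mu> :: "'n::finite \<Rightarrow>\<^sub>0 nat" and a :: "'k::comm_ring_1"
  shows "Poly_Mapping.single \<mu> a = Const a * (\<Prod>i\<in>UNIV. Var i ^ Poly_Mapping.lookup \<mu> i)"
proof -
  have "(\<Prod>i\<in>S. Poly_Mapping.single (g i) (1 :: 'k)) = Poly_Mapping.single (\<Sum>i\<in>S. g i) 1"
    for S and g :: "'n \<Rightarrow> 'n \<Rightarrow>\<^sub>0 nat"
    by (induction S rule: infinite_finite_induct) (simp_all add: mult_single)
  moreover have "(\<Sum>i\<in>UNIV. Poly_Mapping.single i (Poly_Mapping.lookup \<mu> i)) = \<mu>"
  proof (rule poly_mapping_eqI)
    fix j
    have "Poly_Mapping.lookup (Poly_Mapping.single i (Poly_Mapping.lookup \<mu> i)) j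
        = (if i = j then Poly_Mapping.lookup \<mu> j else 0)" for i
      by (simp add: lookup_single)
    then show "Poly_Mapping.lookup (\<Sum>i\<in>UNIV. Poly_Mapping.single i (Poly_Mapping.lookup \<mu> i)) j
        = Poly_Mapping.lookup \<mu> j"
      by (simp add: lookup_sum)
  qed
  ultimately show ?thesis
    by (simp add: Var_power Const_def mult_single)
qed

text \<open>Constants and variables generate the ring. Identities between composed substitutions are
  proved below by checking them on these generators.\<close>

lemma ring_morphism_eqI:
  fixes g h :: "('n::finite, 'k::comm_ring_1) mpoly \<Rightarrow> 'b::comm_ring_1"
  assumes "ring_morphism g" "ring_morphism h"
    and "\<And>c. g (Const c) = h (Const c)" "\<And>i. g (Var i) = h (Var i)"
  shows "g f = h f"
proof -
  interpret g: ring_morphism g by fact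
  interpret h: ring_morphism h by fact
  have "g (Poly_Mapping.single \<mu> a) = h (Poly_Mapping.single \<mu> a)" for \<mu> a
    by (simp add: single_eq_Const_mult_prod_Var assms(3,4))
  then have "g (\<Sum>\<mu>\<in>Poly_Mapping.keys f. Poly_Mapping.single \<mu> (Poly_Mapping.lookup f \<mu>))
      = h (\<Sum>\<mu>\<in>Poly_Mapping.keys f. Poly_Mapping.single \<mu> (Poly_Mapping.lookup f \<mu>))"
    by simp
  then show ?thesis
    by (simp only: sum_single_lookup)
qed

context
  fixes c :: "'k::comm_ring_1 \<Rightarrow> 'b::comm_ring_1" and \<sigma> :: "'n::finite \<Rightarrow> 'b"
  assumes c: "ring_morphism c"
begin

text \<open>Cancellation may shrink the support of a sum; a common larger index set lets the sums
  for f, g and f + g be compared termwise.\<close>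

lemma poly_subst_superset:
  assumes "finite K" "Poly_Mapping.keys f \<subseteq> K"
  shows "poly_subst c \<sigma> f =
    (\<Sum>\<mu>\<in>K. c (Poly_Mapping.lookup f \<mu>) * (\<Prod>i\<in>UNIV. \<sigma> i ^ Poly_Mapping.lookup \<mu> i))"
  unfolding poly_subst_def
  by (intro sum.mono_neutral_left assms) (auto simp: in_keys_iff ring_morphism.h_zero[OF c])

lemma poly_subst_single:
  "poly_subst c \<sigma> (Poly_Mapping.single \<mu> a) = c a * (\<Prod>i\<in>UNIV. \<sigma> i ^ Poly_Mapping.lookup \<mu> i)"
  by (subst poly_subst_superset[of "{\<mu>}"]) auto

lemma poly_subst_add: "poly_subst c \<sigma> (f + g) = poly_subst c \<sigma> f + poly_subst c \<sigma> g"
proof -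
  let ?K = "Poly_Mapping.keys f \<union> Poly_Mapping.keys g"
  have "Poly_Mapping.keys (f + g) \<subseteq> ?K"
    by (rule keys_add)
  then show ?thesis
    by (simp add: poly_subst_superset[of ?K] lookup_add ring_morphism.h_add[OF c] distrib_right sum.distrib)
qed

lemma poly_subst_sum: "poly_subst c \<sigma> (sum g K) = (\<Sum>x\<in>K. poly_subst c \<sigma> (g x))"
proof (induction K rule: infinite_finite_induct)
qed (simp_all add: poly_subst_add, simp_all add: poly_subst_def)

lemma poly_subst_mult: "poly_subst c \<sigma> (f * g) = poly_subst c \<sigma> f * poly_subst c \<sigma> g"
proof -
  let ?s = "\<lambda>f \<mu>. Poly_Mapping.single \<mu> (Poly_Mapping.lookup f \<mu>)"
  have single: "poly_subst c \<sigma> (Poly_Mapping.single \<mu> a * Poly_Mapping.single \<nu> b)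
      = poly_subst c \<sigma> (Poly_Mapping.single \<mu> a) * poly_subst c \<sigma> (Poly_Mapping.single \<nu> b)" for \<mu> \<nu> a b
    by (simp add: mult_single poly_subst_single lookup_add power_add prod.distrib
        ring_morphism.h_mult[OF c] mult_ac)
  have "poly_subst c \<sigma> (sum (?s f) (Poly_Mapping.keys f) * sum (?s g) (Poly_Mapping.keys g))
      = poly_subst c \<sigma> (sum (?s f) (Poly_Mapping.keys f)) * poly_subst c \<sigma> (sum (?s g) (Poly_Mapping.keys g))"
    by (simp only: sum_product poly_subst_sum single)
  then show ?thesis
    by (simp only: sum_single_lookup)
qed

lemma poly_subst_Const: "poly_subst c \<sigma> (Const a) = c a"
  by (simp add: Const_def poly_subst_single)

lemma poly_subst_Var: "poly_subst c \<sigma> (Var i) = \<sigma> i"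
proof -
  have "(\<Prod>j\<in>UNIV. \<sigma> j ^ Poly_Mapping.lookup (Poly_Mapping.single i 1) j) = (\<Prod>j\<in>UNIV. if i = j then \<sigma> j else 1)"
    by (intro prod.cong) (auto simp: lookup_single)
  then show ?thesis
    by (simp add: Var_def poly_subst_single ring_morphism.h_one[OF c])
qed

lemma ring_morphism_poly_subst: "ring_morphism (poly_subst c \<sigma>)"
proof
  have "poly_subst c \<sigma> (Const 1) = 1"
    by (simp only: poly_subst_Const ring_morphism.h_one[OF c])
  then show "poly_subst c \<sigma> 1 = 1"
    by (simp add: Const_def)
qed (rule poly_subst_add poly_subst_mult)+

end

lemma ring_morphism_map_poly:
  assumes "ring_morphism h"
  shows "ring_morphism (map_poly h)"
proof -
  interpret h: ring_morphism h by fact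
  show ?thesis
  proof
    show "map_poly h 1 = 1"
      by (simp add: one_pCons map_poly_pCons)
  qed (simp_all add: poly_eq_iff coeff_map_poly coeff_mult)
qed

lemma ring_morphism_poly: "ring_morphism (\<lambda>p. poly p a)"
  by unfold_locales simp_all

lemma ring_morphism_Const_const: "ring_morphism (\<lambda>c :: 'k::comm_ring_1. [:Const c :: ('n, 'k) mpoly:])"
  by (rule ring_morphism_comp[OF ring_morphism_const ring_morphism_Const])

lemma ring_morphism_incl: "ring_morphism (incl :: ('n::finite, 'k::comm_ring_1) mpoly \<Rightarrow> _)"
  unfolding incl_def by (rule ring_morphism_poly_subst[OF ring_morphism_Const])

lemma incl_Const [simp]: "incl (Const c) = Const c"
  and incl_Var [simp]: "incl (Var i) = Var (Some i)"
  by (simp_all add: incl_def poly_subst_Const poly_subst_Var ring_morphism_Const)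

lemma ring_morphism_quot: "ring_morphism (quot :: ('n::finite option, 'k::comm_ring_1) mpoly \<Rightarrow> _)"
  unfolding quot_def by (rule ring_morphism_poly_subst[OF ring_morphism_Const])

lemma quot_Const [simp]: "quot (Const c) = Const c"
  and quot_Var [simp]: "quot (Var None) = 0" "quot (Var (Some i)) = Var i"
  by (simp_all add: quot_def poly_subst_Const poly_subst_Var ring_morphism_Const)

lemma quot_incl [simp]: "quot (incl f) = f"
  by (rule ring_morphism_eqI[of "\<lambda>f. quot (incl f)" "\<lambda>f. f"])
    (simp_all add: ring_morphism_comp ring_morphism_quot ring_morphism_incl, simp add: ring_morphism_def)

subsection \<open>The last variable\<close>

text \<open>The isomorphism of the polynomial ring in one more variable with univariate polynomials
  over R, where \<open>Var None\<close> becomes the indeterminate. It pulls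
  \<open>ext_ideal I\<close> back to the extension of I and \<open>contr_ideal I\<close> back to the
  preimage of I under \<open>quot\<close>.\<close>

definition last_var :: "('n::finite option, 'k::comm_ring_1) mpoly \<Rightarrow> ('n, 'k) mpoly poly" where
  "last_var = poly_subst (\<lambda>c. [:Const c:]) (\<lambda>j. case j of None \<Rightarrow> [:0, 1:] | Some i \<Rightarrow> [:Var i:])"

definition last_var_inv :: "('n::finite, 'k::comm_ring_1) mpoly poly \<Rightarrow> ('n option, 'k) mpoly" where
  "last_var_inv p = poly (map_poly incl p) (Var None)"

lemma ring_morphism_last_var: "ring_morphism (last_var :: ('n::finite option, 'k::comm_ring_1) mpoly \<Rightarrow> _)"
  unfolding last_var_def by (rule ring_morphism_poly_subst[OF ring_morphism_Const_const])

lemma last_var_Const [simp]: "last_var (Const c) = [:Const c:]"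
  and last_var_Var [simp]: "last_var (Var None) = [:0, 1:]" "last_var (Var (Some i)) = [:Var i:]"
  by (simp_all add: last_var_def poly_subst_Const poly_subst_Var ring_morphism_Const_const)

lemma last_var_incl [simp]: "last_var (incl f) = [:f:]"
  by (rule ring_morphism_eqI[of "\<lambda>f. last_var (incl f)" "\<lambda>f. [:f:]"])
    (simp_all add: ring_morphism_comp ring_morphism_last_var ring_morphism_incl ring_morphism_const)

lemma coeff_last_var_0: "Polynomial.coeff (last_var f) 0 = quot f"
proof (rule ring_morphism_eqI[of "\<lambda>f. Polynomial.coeff (last_var f) 0" quot])
  show "Polynomial.coeff (last_var (Var i)) 0 = quot (Var i)" for i
    by (cases i) simp_all
qed (simp_all add: ring_morphism_comp[OF ring_morphism_coeff_0 ring_morphism_last_var] ring_morphism_quot)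

lemma ring_morphism_last_var_inv:
  "ring_morphism (last_var_inv :: ('n::finite, 'k::comm_ring_1) mpoly poly \<Rightarrow> _)"
  unfolding last_var_inv_def
  by (rule ring_morphism_comp[OF ring_morphism_poly ring_morphism_map_poly[OF ring_morphism_incl]])

lemma last_var_inv_pCons: "last_var_inv (pCons a p) = incl a + Var None * last_var_inv p"
  by (simp add: last_var_inv_def map_poly_pCons ring_morphism.h_zero[OF ring_morphism_incl])

lemma last_var_inv_0: "last_var_inv 0 = 0"
  by (rule ring_morphism.h_zero[OF ring_morphism_last_var_inv])

lemma last_var_last_var_inv [simp]: "last_var (last_var_inv p) = p"
proof -
  interpret L: ring_morphism last_var
    by (rule ring_morphism_last_var)
  show ?thesis
    by (induction p) (simp_all add: last_var_inv_0 last_var_inv_pCons)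
qed

lemma last_var_inv_last_var [simp]: "last_var_inv (last_var f) = f"
proof (rule ring_morphism_eqI[of "\<lambda>f. last_var_inv (last_var f)" "\<lambda>f. f"])
  interpret incl: ring_morphism incl
    by (rule ring_morphism_incl)
  show "last_var_inv (last_var (Var i)) = Var i" for i :: "'a option"
    by (cases i) (simp_all add: last_var_inv_pCons last_var_inv_0)
  show "last_var_inv (last_var (Const c)) = Const c" for c :: 'b
    by (simp add: last_var_inv_pCons last_var_inv_0)
qed (simp add: ring_morphism_comp[OF ring_morphism_last_var_inv ring_morphism_last_var], simp add: ring_morphism_def)

lemma extended_ideal_eq:
  assumes I: "idl.subspace I"
  shows "extended_ideal I = last_var -` ext_ideal I"
proof
  interpret L: ring_morphism last_var
    by (rule ring_morphism_last_var)
  interpret L': ring_morphism last_var_inv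
    by (rule ring_morphism_last_var_inv)
  show "extended_ideal I \<subseteq> last_var -` ext_ideal I"
    unfolding extended_ideal_def genideal_ring_of
    by (intro idl.span_minimal L.subspace_vimage subspace_ext_ideal I) (auto simp: const_mem_ext_ideal I)
  have "last_var_inv [:a:] \<in> idl.span (incl ` I)" if "a \<in> I" for a
    using that by (simp add: last_var_inv_pCons last_var_inv_0 idl.span_base)
  then have "ext_ideal I \<subseteq> last_var_inv -` idl.span (incl ` I)"
    by (intro ext_ideal_subset L'.subspace_vimage) auto
  then have "last_var_inv (last_var f) \<in> idl.span (incl ` I)" if "last_var f \<in> ext_ideal I" for f
    using that by blast
  then show "last_var -` ext_ideal I \<subseteq> extended_ideal I"
    unfolding extended_ideal_def genideal_ring_of by auto
qed

lemma quot_vimage_eq: "quot -` I = last_var -` contr_ideal I"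
  by (auto simp: contr_ideal_def coeff_last_var_0)

section \<open>Polynomials over a field\<close>

subsection \<open>Kronecker substitution\<close>

text \<open>Digits in a mixed radix: when a variable is added, its exponents on K are below D and
  the old weights are multiplied by D. The new exponent is then the residue modulo D, and the
  quotient is the old weighted sum.\<close>

lemma ex_separating_weights:
  fixes K :: "('n::finite \<Rightarrow>\<^sub>0 nat) set"
  assumes "finite K"
  shows "\<exists>w. inj_on (\<lambda>\<mu>. \<Sum>i\<in>UNIV. w i * Poly_Mapping.lookup \<mu> i) K"
proof -
  have "\<exists>w. \<forall>\<mu>\<in>K. \<forall>\<nu>\<in>K. (\<Sum>i\<in>S. w i * Poly_Mapping.lookup \<mu> i) = (\<Sum>i\<in>S. w i * Poly_Mapping.lookup \<nu> i) \<longrightarrow>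
      (\<forall>i\<in>S. Poly_Mapping.lookup \<mu> i = Poly_Mapping.lookup \<nu> i)" (is "\<exists>w. ?P w S") if "finite S" for S
    using that
  proof induction
    case (insert i S)
    then obtain w where w: "?P w S"
      by blast
    define D where "D = Suc (Max ((\<lambda>\<mu>. Poly_Mapping.lookup \<mu> i) ` K))"
    have D: "Poly_Mapping.lookup \<mu> i < D" if "\<mu> \<in> K" for \<mu>
      using assms that unfolding D_def by (simp add: less_Suc_eq_le)
    define w' where "w' j = (if j = i then 1 else D * w j)" for j
    have sum: "(\<Sum>j\<in>insert i S. w' j * Poly_Mapping.lookup \<mu> j)
        = Poly_Mapping.lookup \<mu> i + D * (\<Sum>j\<in>S. w j * Poly_Mapping.lookup \<mu> j)" for \<mu>
    proof -
      have "(\<Sum>j\<in>S. w' j * Poly_Mapping.lookup \<mu> j) = (\<Sum>j\<in>S. D * (w j * Poly_Mapping.lookup \<mu> j))"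
        using insert.hyps by (intro sum.cong) (auto simp: w'_def)
      then show ?thesis
        using insert.hyps by (simp add: sum_distrib_left w'_def)
    qed
    have "?P w' (insert i S)"
    proof (intro ballI impI)
      fix \<mu> \<nu> j assume \<mu>: "\<mu> \<in> K" "\<nu> \<in> K" and j: "j \<in> insert i S"
        and "(\<Sum>j\<in>insert i S. w' j * Poly_Mapping.lookup \<mu> j) = (\<Sum>j\<in>insert i S. w' j * Poly_Mapping.lookup \<nu> j)"
      then have eq: "Poly_Mapping.lookup \<mu> i + D * (\<Sum>j\<in>S. w j * Poly_Mapping.lookup \<mu> j)
          = Poly_Mapping.lookup \<nu> i + D * (\<Sum>j\<in>S. w j * Poly_Mapping.lookup \<nu> j)"
        by (simp only: sum)
      from arg_cong[OF eq, of "\<lambda>x. x mod D"] have "Poly_Mapping.lookup \<mu> i = Poly_Mapping.lookup \<nu> i"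
        using D \<mu> by simp
      moreover from this eq have "(\<Sum>j\<in>S. w j * Poly_Mapping.lookup \<mu> j) = (\<Sum>j\<in>S. w j * Poly_Mapping.lookup \<nu> j)"
        using D[OF \<mu>(1)] by simp
      then have "\<forall>j\<in>S. Poly_Mapping.lookup \<mu> j = Poly_Mapping.lookup \<nu> j"
        using w \<mu> by blast
      ultimately show "Poly_Mapping.lookup \<mu> j = Poly_Mapping.lookup \<nu> j"
        using j by blast
    qed
    then show ?case
      by blast
  qed simp
  from this[OF finite] obtain w where w: "\<And>\<mu> \<nu>. \<mu> \<in> K \<Longrightarrow> \<nu> \<in> K \<Longrightarrow>
      (\<Sum>i\<in>UNIV. w i * Poly_Mapping.lookup \<mu> i) = (\<Sum>i\<in>UNIV. w i * Poly_Mapping.lookup \<nu> i) \<Longrightarrow>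
      (\<forall>i\<in>UNIV. Poly_Mapping.lookup \<mu> i = Poly_Mapping.lookup \<nu> i)"
    by blast
  have "inj_on (\<lambda>\<mu>. \<Sum>i\<in>UNIV. w i * Poly_Mapping.lookup \<mu> i) K"
    by (intro inj_onI poly_mapping_eqI) (use w in blast)
  then show ?thesis
    by blast
qed

text \<open>The substitution of t^(w i) for the i-th variable. With weights separating the monomials
  of f no cancellation can occur, so questions about nonvanishing become univariate.\<close>

definition kronecker :: "('n::finite \<Rightarrow> nat) \<Rightarrow> ('n, 'k::comm_ring_1) mpoly \<Rightarrow> 'k poly" where
  "kronecker w = poly_subst (\<lambda>c. [:c:]) (\<lambda>i. Polynomial.monom 1 (w i))"

lemma ring_morphism_kronecker: "ring_morphism (kronecker w)"
  unfolding kronecker_def by (rule ring_morphism_poly_subst[OF ring_morphism_const])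

lemma prod_monom: "(\<Prod>i\<in>S. Polynomial.monom (a i) (d i)) = Polynomial.monom (\<Prod>i\<in>S. a i) (\<Sum>i\<in>S. d i)"
  by (induction S rule: infinite_finite_induct) (simp_all add: mult_monom monom_eq_1)

lemma kronecker_eq_0_iff:
  fixes f :: "('n::finite, 'k::comm_ring_1) mpoly"
  assumes "inj_on (\<lambda>\<mu>. \<Sum>i\<in>UNIV. w i * Poly_Mapping.lookup \<mu> i) (Poly_Mapping.keys f)"
  shows "kronecker w f = 0 \<longleftrightarrow> f = 0"
proof
  let ?d = "\<lambda>\<mu>. \<Sum>i\<in>UNIV. w i * Poly_Mapping.lookup \<mu> i"
  assume 0: "kronecker w f = 0"
  show "f = 0"
  proof (rule ccontr)
    assume "f \<noteq> 0"
    then obtain \<mu> where \<mu>: "\<mu> \<in> Poly_Mapping.keys f"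
      by (metis all_not_in_conv keys_eq_empty)
    have "kronecker w f = (\<Sum>\<nu>\<in>Poly_Mapping.keys f. Polynomial.monom (Poly_Mapping.lookup f \<nu>) (?d \<nu>))"
      by (simp add: kronecker_def poly_subst_def monom_power prod_monom smult_monom)
    then have "Polynomial.coeff (kronecker w f) (?d \<mu>)
        = (\<Sum>\<nu>\<in>Poly_Mapping.keys f. if ?d \<nu> = ?d \<mu> then Poly_Mapping.lookup f \<nu> else 0)"
      by (simp add: coeff_sum)
    also have "\<dots> = (\<Sum>\<nu>\<in>Poly_Mapping.keys f. if \<nu> = \<mu> then Poly_Mapping.lookup f \<nu> else 0)"
      using \<mu> assms by (intro sum.cong refl if_cong) (auto dest: inj_onD)
    also have "\<dots> = Poly_Mapping.lookup f \<mu>"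
      using \<mu> by simp
    finally show False
      using 0 \<mu> by (simp add: in_keys_iff)
  qed
qed (simp add: ring_morphism.h_zero[OF ring_morphism_kronecker])

text \<open>Weights separating the union of both supports are separating for f and for g, and
  univariate polynomials over a domain form a domain.\<close>

lemma mpoly_no_zero_divisors:
  fixes f g :: "('n::finite, 'k::idom) mpoly"
  assumes "f * g = 0"
  shows "f = 0 \<or> g = 0"
proof -
  interpret K: ring_morphism "kronecker w" for w
    by (rule ring_morphism_kronecker)
  obtain w where w: "inj_on (\<lambda>\<mu>. \<Sum>i\<in>UNIV. w i * Poly_Mapping.lookup \<mu> i)
      (Poly_Mapping.keys f \<union> Poly_Mapping.keys g)"
    using ex_separating_weights[of "Poly_Mapping.keys f \<union> Poly_Mapping.keys g"] by auto
  have "kronecker w f * kronecker w g = 0"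
    using assms by (metis K.h_mult K.h_zero)
  then show ?thesis
    using w by (simp add: kronecker_eq_0_iff inj_on_Un)
qed

lemma mpoly_power_nonzero: "(f :: ('n::finite, 'k::idom) mpoly) \<noteq> 0 \<Longrightarrow> f ^ n \<noteq> 0"
  by (induction n) (auto dest: mpoly_no_zero_divisors)

lemma ring_morphism_id: "ring_morphism (id :: 'a::comm_ring_1 \<Rightarrow> 'a)"
  by unfold_locales simp_all

text \<open>On the monomial curve with coordinates t^(w i), for separating weights, f becomes a
  nonzero univariate polynomial, which has finitely many roots.\<close>

lemma ex_nonvanishing_point:
  fixes f :: "('n::finite, 'k::idom) mpoly"
  assumes "infinite (UNIV :: 'k set)" "f \<noteq> 0"
  shows "\<exists>v. poly_subst id v f \<noteq> 0"
proof -
  obtain w where "inj_on (\<lambda>\<mu>. \<Sum>i\<in>UNIV. w i * Poly_Mapping.lookup \<mu> i) (Poly_Mapping.keys f)"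
    using ex_separating_weights[of "Poly_Mapping.keys f"] by auto
  then have "kronecker w f \<noteq> 0"
    using assms(2) by (simp add: kronecker_eq_0_iff)
  then obtain t where "poly (kronecker w f) t \<noteq> 0"
    using poly_roots_finite[of "kronecker w f"] assms(1) by (metis (mono_tags, lifting) Collect_cong UNIV_def)
  moreover have "poly (kronecker w f) t = poly_subst id (\<lambda>i. t ^ w i) f"
  proof (rule ring_morphism_eqI[of "\<lambda>f. poly (kronecker w f) t" "poly_subst id (\<lambda>i. t ^ w i)"])
    show "ring_morphism (\<lambda>f. poly (kronecker w f) t)"
      by (rule ring_morphism_comp[OF ring_morphism_poly ring_morphism_kronecker])
  qed (simp_all add: ring_morphism_poly_subst ring_morphism_id kronecker_def poly_subst_Const poly_subst_Var
        ring_morphism_const poly_monom)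
  ultimately show ?thesis
    by metis
qed

subsection \<open>Hilbert's basis theorem\<close>

text \<open>Lexicographic comparison along an explicit list, so that the type of variables needs no
  order. It is always well-founded, and total once the list exhausts the type.\<close>

primrec lexl :: "'n list \<Rightarrow> ('n \<Rightarrow>\<^sub>0 nat) \<Rightarrow> ('n \<Rightarrow>\<^sub>0 nat) \<Rightarrow> bool" where
  "lexl [] \<mu> \<nu> \<longleftrightarrow> False"
| "lexl (x # xs) \<mu> \<nu> \<longleftrightarrow> Poly_Mapping.lookup \<mu> x < Poly_Mapping.lookup \<nu> x \<or>
    Poly_Mapping.lookup \<mu> x = Poly_Mapping.lookup \<nu> x \<and> lexl xs \<mu> \<nu>"

lemma wf_lexl: "wf {(\<mu>, \<nu>). lexl xs \<mu> \<nu>}"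
proof (induction xs)
  case (Cons x xs)
  have "{(\<mu>, \<nu>). lexl (x # xs) \<mu> \<nu>} =
      inv_image (less_than <*lex*> {(\<mu>, \<nu>). lexl xs \<mu> \<nu>}) (\<lambda>\<mu>. (Poly_Mapping.lookup \<mu> x, \<mu>))"
    by auto
  then show ?case
    using Cons by (simp add: wf_lex_prod)
qed simp

lemma lexl_trans: "lexl xs \<mu> \<nu> \<Longrightarrow> lexl xs \<nu> \<rho> \<Longrightarrow> lexl xs \<mu> \<rho>"
  by (induction xs) auto

lemma lexl_total: "lexl xs \<mu> \<nu> \<or> lexl xs \<nu> \<mu> \<or> (\<forall>x\<in>set xs. Poly_Mapping.lookup \<mu> x = Poly_Mapping.lookup \<nu> x)"
  by (induction xs) auto

lemma lexl_add_iff: "lexl xs (\<mu> + \<rho>) (\<nu> + \<rho>) \<longleftrightarrow> lexl xs \<mu> \<nu>"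
  by (induction xs) (auto simp: lookup_add)

definition leading :: "'n list \<Rightarrow> ('n, 'k::zero) mpoly \<Rightarrow> ('n \<Rightarrow>\<^sub>0 nat) \<Rightarrow> bool" where
  "leading xs f \<mu> \<longleftrightarrow> \<mu> \<in> Poly_Mapping.keys f \<and> (\<forall>\<nu>\<in>Poly_Mapping.keys f. \<nu> \<noteq> \<mu> \<longrightarrow> lexl xs \<nu> \<mu>)"

lemma ex_leading:
  assumes "set xs = UNIV" "f \<noteq> 0"
  shows "\<exists>\<mu>. leading xs f \<mu>"
proof -
  have "\<exists>\<mu>\<in>K. \<forall>\<nu>\<in>K. \<nu> \<noteq> \<mu> \<longrightarrow> lexl xs \<nu> \<mu>" if "finite K" "K \<noteq> {}" for K
    using that
  proof (induction rule: finite_ne_induct)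
    case (insert \<rho> K)
    then obtain \<mu> where \<mu>: "\<mu> \<in> K" "\<forall>\<nu>\<in>K. \<nu> \<noteq> \<mu> \<longrightarrow> lexl xs \<nu> \<mu>"
      by blast
    have "\<rho> \<noteq> \<mu>"
      using insert.hyps \<mu>(1) by blast
    then consider "lexl xs \<rho> \<mu>" | "lexl xs \<mu> \<rho>"
      using lexl_total[of xs \<rho> \<mu>] assms(1) poly_mapping_eqI[of \<rho> \<mu>] by auto
    then show ?case
    proof cases
      case 1
      then show ?thesis
        using \<mu> by blast
    next
      case 2
      have "lexl xs \<nu> \<rho>" if "\<nu> \<in> K" for \<nu>
        using \<mu>(2) that 2 lexl_trans by (cases "\<nu> = \<mu>") blast+
      then show ?thesis
        by blast
    qed
  qed simp
  then show ?thesis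
    using assms(2) unfolding leading_def by (metis finite_keys keys_eq_empty)
qed

text \<open>A decreasing sequence of natural numbers is constant from the point where its minimum is
  attained, so a decreasing subsequence yields a nondecreasing one after a shift.\<close>

lemma nat_sequence_mono_subsequence:
  fixes f :: "nat \<Rightarrow> nat"
  shows "\<exists>r :: nat \<Rightarrow> nat. strict_mono r \<and> mono (\<lambda>n. f (r n))"
proof -
  obtain r :: "nat \<Rightarrow> nat" where r: "strict_mono r" "monoseq (\<lambda>n. f (r n))"
    using seq_monosub[of f] by blast
  show ?thesis
  proof (cases "incseq (\<lambda>n. f (r n))")
    case True
    then show ?thesis
      using r by blast
  next
    case False
    then have dec: "decseq (\<lambda>n. f (r n))"
      using r(2) by (simp add: monoseq_iff)
    obtain n where n: "\<And>m. f (r n) \<le> f (r m)"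
      using ex_has_least_nat[of "\<lambda>_. True" _ "\<lambda>n. f (r n)"] by auto
    have "f (r (n + m)) = f (r n)" for m
      using n[of "n + m"] decseqD[OF dec, of n "n + m"] by simp
    moreover have "strict_mono (\<lambda>m. r (n + m))"
      using r(1) by (simp add: strict_mono_def)
    ultimately show ?thesis
      by (intro exI[of _ "\<lambda>m. r (n + m)"]) (simp add: mono_def)
  qed
qed

text \<open>Passing to subsequences once per variable makes all exponents nondecreasing at the same
  time; the first two terms of the resulting subsequence are as required.\<close>

lemma dickson:
  fixes \<mu> :: "nat \<Rightarrow> 'n::finite \<Rightarrow>\<^sub>0 nat"
  shows "\<exists>i j. i < j \<and> (\<forall>x. Poly_Mapping.lookup (\<mu> i) x \<le> Poly_Mapping.lookup (\<mu> j) x)"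
proof -
  have "\<exists>r :: nat \<Rightarrow> nat. strict_mono r \<and> (\<forall>x\<in>S. mono (\<lambda>n. Poly_Mapping.lookup (\<mu> (r n)) x))" if "finite S" for S
    using that
  proof induction
    case empty
    show ?case
      by (rule exI[of _ id]) (simp add: strict_mono_def)
  next
    case (insert x S)
    then obtain r :: "nat \<Rightarrow> nat" where r: "strict_mono r" "\<forall>y\<in>S. mono (\<lambda>n. Poly_Mapping.lookup (\<mu> (r n)) y)"
      by blast
    obtain s :: "nat \<Rightarrow> nat" where s: "strict_mono s" "mono (\<lambda>n. Poly_Mapping.lookup (\<mu> (r (s n))) x)"
      using nat_sequence_mono_subsequence[of "\<lambda>n. Poly_Mapping.lookup (\<mu> (r n)) x"] by blast
    have "mono (\<lambda>n. Poly_Mapping.lookup (\<mu> (r (s n))) y)" if "y \<in> S" for y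
      using r(2) that strict_mono_mono[OF s(1)] unfolding mono_def by blast
    moreover have "strict_mono (\<lambda>n. r (s n))"
      using r(1) s(1) by (simp add: strict_mono_def)
    ultimately show ?case
      using s(2) by (intro exI[of _ "\<lambda>n. r (s n)"]) auto
  qed
  then obtain r :: "nat \<Rightarrow> nat" where r: "strict_mono r" "\<And>x. mono (\<lambda>n. Poly_Mapping.lookup (\<mu> (r n)) x)"
    by (metis UNIV_I finite)
  have "r 0 < r 1"
    using r(1) by (simp add: strict_mono_def)
  moreover have "Poly_Mapping.lookup (\<mu> (r 0)) x \<le> Poly_Mapping.lookup (\<mu> (r 1)) x" for x
    using monoD[OF r(2)[of x], of 0 1] by simp
  ultimately show ?thesis
    by blast
qed

lemma lookup_single_mult:
  fixes f :: "('n, 'k::comm_ring_1) mpoly"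
  shows "Poly_Mapping.lookup (Poly_Mapping.single \<delta> c * f) (\<mu> + \<delta>) = c * Poly_Mapping.lookup f \<mu>"
proof -
  have "\<mu> + \<delta> = \<delta> + q \<longleftrightarrow> \<mu> = q" for q
    by (simp add: add.commute)
  then show ?thesis
    by (simp add: lookup_mult lookup_single when_mult)
qed

text \<open>In a strictly increasing chain of ideals choose \<open>f n \<in> I (n + 1) - I n\<close> with minimal leading
  monomial; Dickson's lemma provides \<open>i < j\<close> such that \<open>f j\<close> can be reduced by \<open>f i\<close>.\<close>

theorem noetherian_mpoly: "noetherian TYPE(('n::finite, 'k::field) mpoly)"
  unfolding noetherian_def wf_iff_no_infinite_down_chain
proof (rule notI, elim exE)
  fix I :: "nat \<Rightarrow> ('n, 'k) mpoly set"
  assume "\<forall>n. (I (Suc n), I n) \<in> {(J, I). idl.subspace I \<and> idl.subspace J \<and> I \<subset> J}"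
  then have I: "idl.subspace (I n)" and psub: "I n \<subset> I (Suc n)" for n
    by auto
  have mono: "I m \<subseteq> I n" if "m \<le> n" for m n
    using psub by (intro lift_Suc_mono_le[of I, OF _ that]) blast
  obtain xs :: "'n list" where xs: "set xs = UNIV"
    using finite_list[OF finite] by blast
  define M where "M n = {\<mu>. \<exists>f\<in>I (Suc n) - I n. leading xs f \<mu>}" for n
  have "\<exists>\<mu>. \<mu> \<in> M n \<and> (\<forall>\<nu>. lexl xs \<nu> \<mu> \<longrightarrow> \<nu> \<notin> M n)" for n
  proof -
    obtain f where f: "f \<in> I (Suc n) - I n"
      using psub by blast
    then have "f \<noteq> 0"
      using idl.subspace_0[OF I] by auto
    then obtain \<mu> where "\<mu> \<in> M n"
      using f ex_leading[OF xs] unfolding M_def by blast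
    from wfE_min[OF wf_lexl[of xs] this] show ?thesis
      by (metis (mono_tags, lifting) case_prodI mem_Collect_eq)
  qed
  then obtain \<mu> where \<mu>: "\<And>n. \<mu> n \<in> M n" "\<And>n \<nu>. lexl xs \<nu> (\<mu> n) \<Longrightarrow> \<nu> \<notin> M n"
    by metis
  have "\<exists>f. f \<in> I (Suc n) \<and> f \<notin> I n \<and> leading xs f (\<mu> n)" for n
    using \<mu>(1)[of n] unfolding M_def by blast
  then obtain f where f: "\<And>n. f n \<in> I (Suc n)" "\<And>n. f n \<notin> I n" "\<And>n. leading xs (f n) (\<mu> n)"
    by metis
  obtain i j where ij: "i < j" "\<And>x. Poly_Mapping.lookup (\<mu> i) x \<le> Poly_Mapping.lookup (\<mu> j) x"
    using dickson[of \<mu>] by blast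
  define \<delta> where "\<delta> = \<mu> j - \<mu> i"
  have \<delta>: "\<mu> j = \<mu> i + \<delta>"
    using ij(2) by (intro poly_mapping_eqI) (simp add: \<delta>_def lookup_add lookup_minus)
  \<comment> \<open>The scalar for which the leading terms of \<open>f j\<close> and of the monomial
    multiple h of \<open>f i\<close> cancel.\<close>
  define a where "a = Poly_Mapping.lookup (f j) (\<mu> j) / Poly_Mapping.lookup (f i) (\<mu> i)"
  define h where "h = Poly_Mapping.single \<delta> a * f i"
  have h: "h \<in> I j"
    unfolding h_def using f(1)[of i] mono[of "Suc i" j] ij(1) by (intro idl.subspace_scale[OF I]) auto
  define g where "g = f j - h"
  have "g \<in> I (Suc j)"
    unfolding g_def using h mono[of j "Suc j"] f(1) by (intro idl.subspace_diff[OF I]) auto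
  moreover have "g \<notin> I j"
    using f(2)[of j] idl.subspace_add[OF I _ h, of g] by (auto simp: g_def)
  moreover from this have "g \<noteq> 0"
    using idl.subspace_0[OF I] by auto
  then obtain \<nu> where \<nu>: "leading xs g \<nu>"
    using ex_leading[OF xs] by blast
  ultimately have "\<nu> \<in> M j"
    unfolding M_def by blast
  have "\<nu> \<in> Poly_Mapping.keys g"
    using \<nu> by (simp add: leading_def)
  have "Poly_Mapping.lookup (f i) (\<mu> i) \<noteq> 0"
    using f(3)[of i] by (simp add: leading_def in_keys_iff)
  then have "Poly_Mapping.lookup g (\<mu> j) = 0"
    by (simp add: g_def lookup_minus h_def \<delta> lookup_single_mult a_def)
  then have "\<nu> \<noteq> \<mu> j"
    using \<open>\<nu> \<in> Poly_Mapping.keys g\<close> by (auto simp: in_keys_iff)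
  have "\<nu> \<in> Poly_Mapping.keys (f j) \<or> \<nu> \<in> Poly_Mapping.keys h"
    using \<open>\<nu> \<in> Poly_Mapping.keys g\<close> by (auto simp: in_keys_iff g_def lookup_minus)
  \<comment> \<open>The leading monomial of g comes from \<open>f j\<close> or from h, both with
    leading monomial \<open>\<mu> j\<close>, which has been cancelled. Lying below it contradicts
    its minimality in \<open>M j\<close>.\<close>
  then have "lexl xs \<nu> (\<mu> j)"
  proof
    assume "\<nu> \<in> Poly_Mapping.keys (f j)"
    then show ?thesis
      using f(3)[of j] \<open>\<nu> \<noteq> \<mu> j\<close> by (simp add: leading_def)
  next
    assume "\<nu> \<in> Poly_Mapping.keys h"
    then obtain \<rho> where \<rho>: "\<nu> = \<delta> + \<rho>" "\<rho> \<in> Poly_Mapping.keys (f i)"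
      using keys_mult[of "Poly_Mapping.single \<delta> a" "f i"] unfolding h_def by (auto split: if_splits)
    then have "lexl xs \<rho> (\<mu> i)"
      using f(3)[of i] \<open>\<nu> \<noteq> \<mu> j\<close> by (auto simp: leading_def \<delta> add.commute)
    then show ?thesis
      using lexl_add_iff[of xs \<rho> \<delta> "\<mu> i"] \<rho>(1) \<delta> by (simp add: add.commute)
  qed
  then show False
    using \<mu>(2) \<open>\<nu> \<in> M j\<close> by blast
qed

subsection \<open>Gradings\<close>

text \<open>Multiplies the variables in S by a new indeterminate t. The coefficient of t^d is the
  component of degree d in these variables: S = UNIV gives the standard grading, smaller S the order
  of vanishing along a coordinate subspace.\<close>

definition grade :: "'n set \<Rightarrow> ('n::finite, 'k::comm_ring_1) mpoly \<Rightarrow> ('n, 'k) mpoly poly" where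
  "grade S = poly_subst (\<lambda>c. [:Const c:]) (\<lambda>i. if i \<in> S then Polynomial.monom (Var i) 1 else [:Var i:])"

lemma ring_morphism_grade: "ring_morphism (grade S)"
  unfolding grade_def by (rule ring_morphism_poly_subst[OF ring_morphism_Const_const])

lemma grade_Const [simp]: "grade S (Const c) = [:Const c:]"
  and grade_Var [simp]: "grade S (Var i) = (if i \<in> S then Polynomial.monom (Var i) 1 else [:Var i:])"
  by (simp_all add: grade_def poly_subst_Const poly_subst_Var ring_morphism_Const_const)

lemma poly_grade_1: "poly (grade S f) 1 = f"
  by (rule ring_morphism_eqI[of "\<lambda>f. poly (grade S f) 1" "\<lambda>f. f"])
    (simp_all add: ring_morphism_comp[OF ring_morphism_poly ring_morphism_grade] poly_monom,
     simp add: ring_morphism_def)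

lemma grade_single:
  fixes \<mu> :: "'n::finite \<Rightarrow>\<^sub>0 nat" and a :: "'k::comm_ring_1"
  shows "grade S (Poly_Mapping.single \<mu> a) =
    Polynomial.monom (Poly_Mapping.single \<mu> a) (\<Sum>i\<in>S. Poly_Mapping.lookup \<mu> i)"
proof -
  interpret G: ring_morphism "grade S :: ('n, 'k) mpoly \<Rightarrow> _"
    by (rule ring_morphism_grade)
  have "grade S (Var i :: ('n, 'k) mpoly) ^ Poly_Mapping.lookup \<mu> i =
      Polynomial.monom (Var i ^ Poly_Mapping.lookup \<mu> i) (if i \<in> S then Poly_Mapping.lookup \<mu> i else 0)" for i
    by (cases "i \<in> S") (simp_all add: monom_power poly_const_pow monom_0)
  then have "grade S (Poly_Mapping.single \<mu> a) = [:Const a:] *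
      Polynomial.monom (\<Prod>i\<in>UNIV. Var i ^ Poly_Mapping.lookup \<mu> i)
        (\<Sum>i\<in>UNIV. if i \<in> S then Poly_Mapping.lookup \<mu> i else 0)"
    by (simp add: single_eq_Const_mult_prod_Var prod_monom del: grade_Var)
  also have "(\<Sum>i\<in>UNIV. if i \<in> S then Poly_Mapping.lookup \<mu> i else 0) = (\<Sum>i\<in>S. Poly_Mapping.lookup \<mu> i)"
    by (simp add: sum.If_cases)
  finally show ?thesis
    by (simp add: smult_monom single_eq_Const_mult_prod_Var)
qed

lemma lookup_coeff_grade:
  "Poly_Mapping.lookup (Polynomial.coeff (grade S f) d) \<mu>
    = (if (\<Sum>i\<in>S. Poly_Mapping.lookup \<mu> i) = d then Poly_Mapping.lookup f \<mu> else 0)"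
proof -
  let ?s = "\<lambda>\<mu>. Poly_Mapping.single \<mu> (Poly_Mapping.lookup f \<mu>)"
  have "grade S f = grade S (\<Sum>\<nu>\<in>Poly_Mapping.keys f. ?s \<nu>)"
    by (simp only: sum_single_lookup)
  also have "\<dots> = (\<Sum>\<nu>\<in>Poly_Mapping.keys f. grade S (?s \<nu>))"
    by (rule ring_morphism.h_sum[OF ring_morphism_grade])
  finally have "Poly_Mapping.lookup (Polynomial.coeff (grade S f) d) \<mu> =
      (\<Sum>\<nu>\<in>Poly_Mapping.keys f. Poly_Mapping.lookup (if (\<Sum>i\<in>S. Poly_Mapping.lookup \<nu> i) = d then ?s \<nu> else 0) \<mu>)"
    by (simp add: grade_single coeff_sum lookup_sum)
  also have "\<dots> = (\<Sum>\<nu>\<in>Poly_Mapping.keys f. if \<nu> = \<mu> then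
      (if (\<Sum>i\<in>S. Poly_Mapping.lookup \<mu> i) = d then Poly_Mapping.lookup f \<mu> else 0) else 0)"
    by (intro sum.cong) (auto simp: lookup_single)
  also have "\<dots> = (if (\<Sum>i\<in>S. Poly_Mapping.lookup \<mu> i) = d then Poly_Mapping.lookup f \<mu> else 0)"
    by (simp add: in_keys_iff)
  finally show ?thesis .
qed

lemma homogeneous_coeff_grade: "homogeneous (Polynomial.coeff (grade UNIV f) d)"
  unfolding homogeneous_def
  by (rule exI[of _ d]) (auto simp: in_keys_iff lookup_coeff_grade split: if_splits)

lemma grade_homogeneous:
  assumes "homogeneous f"
  obtains d where "grade UNIV f = Polynomial.monom f d"
proof -
  obtain d where d: "\<And>\<mu>. \<mu> \<in> Poly_Mapping.keys f \<Longrightarrow> (\<Sum>i\<in>UNIV. Poly_Mapping.lookup \<mu> i) = d"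
    using assms by (auto simp: homogeneous_def)
  have "Polynomial.coeff (grade UNIV f) e = Polynomial.coeff (Polynomial.monom f d) e" for e
    by (rule poly_mapping_eqI) (use d in \<open>auto simp: lookup_coeff_grade in_keys_iff\<close>)
  then have "grade UNIV f = Polynomial.monom f d"
    by (simp add: poly_eq_iff)
  then show ?thesis
    by (rule that)
qed

text \<open>An ideal is homogeneous iff it contains the components of its elements; setting t = 1
  writes an element as the sum of its components. In the form of an inclusion into a preimage the
  criterion passes to powers by \<open>ipow_subset_vimage\<close>.\<close>

lemma homogeneous_ideal_iff:
  "homogeneous_ideal I \<longleftrightarrow> idl.subspace I \<and> I \<subseteq> grade UNIV -` ext_ideal I"
proof
  assume "homogeneous_ideal I"
  then obtain S where S: "\<And>f. f \<in> S \<Longrightarrow> homogeneous f" "I = idl.span S"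
    by (auto simp: homogeneous_ideal_def genideal_ring_of)
  have I: "idl.subspace I"
    by (simp add: S)
  have "S \<subseteq> grade UNIV -` ext_ideal I"
  proof
    fix f assume f: "f \<in> S"
    obtain d where d: "grade UNIV f = Polynomial.monom f d"
      using S(1)[OF f] by (rule grade_homogeneous)
    have "f \<in> I"
      using f by (simp add: S(2) idl.span_base)
    then show "f \<in> grade UNIV -` ext_ideal I"
      using idl.subspace_0[OF I] by (simp add: d ext_ideal_def)
  qed
  then have "idl.span S \<subseteq> grade UNIV -` ext_ideal I"
    by (intro idl.span_minimal ring_morphism.subspace_vimage ring_morphism_grade subspace_ext_ideal I)
  with I show "idl.subspace I \<and> I \<subseteq> grade UNIV -` ext_ideal I"
    using S(2) by blast
next
  assume I: "idl.subspace I \<and> I \<subseteq> grade UNIV -` ext_ideal I"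
  define S where "S = {f \<in> I. homogeneous f}"
  have "I = idl.span S"
  proof
    show "idl.span S \<subseteq> I"
      using I by (intro idl.span_minimal) (auto simp: S_def)
    show "I \<subseteq> idl.span S"
    proof
      fix f assume "f \<in> I"
      then have "Polynomial.coeff (grade UNIV f) d \<in> I" for d
        using I by (auto intro: ext_idealD)
      then have "Polynomial.coeff (grade UNIV f) d \<in> idl.span S" for d
        by (intro idl.span_base) (simp add: S_def homogeneous_coeff_grade)
      then have "(\<Sum>d\<le>Polynomial.degree (grade UNIV f). Polynomial.coeff (grade UNIV f) d) \<in> idl.span S"
        by (rule idl.span_sum)
      also have "(\<Sum>d\<le>Polynomial.degree (grade UNIV f). Polynomial.coeff (grade UNIV f) d) = f"
        using poly_altdef[of "grade UNIV f" 1] by (simp add: poly_grade_1)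
      finally show "f \<in> idl.span S" .
    qed
  qed
  moreover have "\<forall>f\<in>S. homogeneous f"
    by (simp add: S_def)
  ultimately show "homogeneous_ideal I"
    unfolding homogeneous_ideal_def genideal_ring_of by blast
qed

section \<open>Orders of vanishing and initial degrees\<close>

definition ord_ge :: "nat \<Rightarrow> 'a::comm_ring_1 poly set" where
  "ord_ge n = {p. \<forall>i<n. Polynomial.coeff p i = 0}"

lemma ord_ge_coeff_mult:
  assumes "p \<in> ord_ge m" "q \<in> ord_ge n"
  shows "Polynomial.coeff (p * q) (m + n) = Polynomial.coeff p m * Polynomial.coeff q n"
proof -
  let ?t = "\<lambda>i. Polynomial.coeff p i * Polynomial.coeff q (m + n - i)"
  have "?t i = 0" if "i \<in> {..m + n} - {m}" for i
  proof -
    have "i < m \<or> m + n - i < n"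
      using that by auto
    then show ?thesis
      using assms by (auto simp: ord_ge_def)
  qed
  then have "sum ?t ({..m + n} - {m}) = 0"
    by (intro sum.neutral) blast
  then show ?thesis
    unfolding coeff_mult by (subst sum.remove[of _ m]) auto
qed

lemma mult_ord_ge:
  assumes "p \<in> ord_ge m" "q \<in> ord_ge n"
  shows "p * q \<in> ord_ge (m + n)"
proof -
  have "Polynomial.coeff p i * Polynomial.coeff q (k - i) = 0" if "k < m + n" "i \<le> k" for i k
  proof -
    have "i < m \<or> k - i < n"
      using that by auto
    then show ?thesis
      using assms by (auto simp: ord_ge_def)
  qed
  then show ?thesis
    by (simp add: ord_ge_def coeff_mult)
qed

lemma subspace_ord_ge: "idl.subspace (ord_ge n)"
proof (rule idl.subspaceI)
  show "c * p \<in> ord_ge n" if "p \<in> ord_ge n" for c p :: "'a poly"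
    using mult_ord_ge[of c 0 p n] that by (simp add: ord_ge_def)
qed (simp_all add: ord_ge_def)

lemma ipow_subset_ord_ge:
  assumes "ring_morphism \<tau>" "I \<subseteq> \<tau> -` ord_ge d"
  shows "ipow I m \<subseteq> \<tau> -` ord_ge (d * m)"
proof (induction m)
  case 0
  show ?case
    by (simp add: ord_ge_def)
next
  case (Suc m)
  show ?case
  proof (rule ipow_Suc_least[OF ring_morphism.subspace_vimage[OF assms(1) subspace_ord_ge]])
    fix a b assume "a \<in> ipow I m" "b \<in> I"
    then have "\<tau> a * \<tau> b \<in> ord_ge (d * m + d)"
      using Suc assms(2) by (intro mult_ord_ge) auto
    then show "a * b \<in> \<tau> -` ord_ge (d * Suc m)"
      by (simp add: ring_morphism.h_mult[OF assms(1)] add.commute)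
  qed
qed

lemma power_ord_ge:
  assumes "p \<in> ord_ge d"
  shows "p ^ m \<in> ord_ge (d * m) \<and> Polynomial.coeff (p ^ m) (d * m) = Polynomial.coeff p d ^ m"
proof (induction m)
  case 0
  show ?case
    by (simp add: ord_ge_def)
next
  case (Suc m)
  then show ?case
    using mult_ord_ge[OF assms, of "p ^ m" "d * m"] ord_ge_coeff_mult[OF assms, of "p ^ m" "d * m"] by simp
qed

text \<open>The initial degree of \<open>I\<^sup>r\<close> is \<open>r\<close> times that of \<open>I\<close>.\<close>

lemma homogeneous_ideal_ipow_not_subset:
  fixes I :: "('n::finite, 'k::field) mpoly set"
  assumes hom: "homogeneous_ideal I" and nz: "I \<noteq> {0}" and proper: "I \<noteq> UNIV" and "m < r"
  shows "\<not> ipow I m \<subseteq> ipow I r"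
proof -
  have I: "idl.subspace I" and gr: "I \<subseteq> grade UNIV -` ext_ideal I"
    using hom by (auto simp: homogeneous_ideal_iff)
  interpret G: ring_morphism "grade UNIV"
    by (rule ring_morphism_grade)
  define D where "D d \<longleftrightarrow> (\<exists>f\<in>I. Polynomial.coeff (grade UNIV f) d \<noteq> 0)" for d
  obtain f where f: "f \<in> I" "f \<noteq> 0"
    using nz idl.subspace_0[OF I] by blast
  then have "grade UNIV f \<noteq> 0"
    using poly_grade_1[of UNIV f] by auto
  then obtain e where "Polynomial.coeff (grade UNIV f) e \<noteq> 0"
    using leading_coeff_0_iff by blast
  then have "D e"
    using f(1) unfolding D_def by blast
  \<comment> \<open>The initial degree of I, the least degree in which some element of I has a
    nonzero component.\<close>
  define d where "d = (LEAST d. D d)"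
  have "D d"
    unfolding d_def using \<open>D e\<close> by (rule LeastI)
  then obtain g where g: "g \<in> I" "Polynomial.coeff (grade UNIV g) d \<noteq> 0"
    unfolding D_def by blast
  have ord: "I \<subseteq> grade UNIV -` ord_ge d"
    using not_less_Least[of _ D] unfolding d_def ord_ge_def D_def by blast
  \<comment> \<open>A nonzero component of degree 0 would be a unit, and by homogeneity it would lie
    in I.\<close>
  have "d \<noteq> 0"
  proof
    assume "d = 0"
    let ?g = "Polynomial.coeff (grade UNIV g) d"
    define c where "c = Poly_Mapping.lookup ?g 0"
    have "?g = Const c"
    proof (rule poly_mapping_eqI)
      fix \<mu> :: "'n \<Rightarrow>\<^sub>0 nat"
      have "(\<Sum>i\<in>UNIV. Poly_Mapping.lookup \<mu> i) = 0 \<longleftrightarrow> \<mu> = 0"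
        by (auto simp: poly_mapping_eq_iff fun_eq_iff)
      then show "Poly_Mapping.lookup ?g \<mu> = Poly_Mapping.lookup (Const c) \<mu>"
        by (auto simp: lookup_coeff_grade \<open>d = 0\<close> Const_def c_def lookup_single)
    qed
    moreover have "?g \<in> I"
      using gr g(1) ext_idealD by blast
    ultimately have "Const (1 / c) * Const c \<in> I" "c \<noteq> 0"
      using g(2) by (auto intro: idl.subspace_scale[OF I] simp: Const_def)
    then have "1 \<in> I"
      by (simp add: Const_def mult_single)
    then show False
      using proper subspace_UNIV_iff[OF I] by blast
  qed
  have "grade UNIV g \<in> ord_ge d"
    using ord g(1) by blast
  \<comment> \<open>Lowest components multiply, so g^m has a nonzero component in degree dm, below
    the initial degree bound dr for the r-th power.\<close>
  then have "Polynomial.coeff (grade UNIV (g ^ m)) (d * m) = Polynomial.coeff (grade UNIV g) d ^ m"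
    using power_ord_ge[of "grade UNIV g" d m] by simp
  then have nz: "Polynomial.coeff (grade UNIV (g ^ m)) (d * m) \<noteq> 0"
    using mpoly_power_nonzero[OF g(2)] by simp
  have "g ^ m \<notin> ipow I r"
  proof
    assume "g ^ m \<in> ipow I r"
    then have "grade UNIV (g ^ m) \<in> ord_ge (d * r)"
      using ipow_subset_ord_ge[OF ring_morphism_grade ord] by blast
    moreover have "d * m < d * r"
      using \<open>d \<noteq> 0\<close> \<open>m < r\<close> by simp
    ultimately show False
      using nz by (simp add: ord_ge_def)
  qed
  then show ?thesis
    using power_mem_ipow[OF I g(1)] by blast
qed

section \<open>Cones and hyperplane sections\<close>

theorem resurgence_extended_ideal:
  fixes I :: "('n::finite, 'k::field) mpoly set"
  assumes "idl.subspace I"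
  shows "resurgence ring_of (extended_ideal I) = resurgence ring_of I"
  unfolding extended_ideal_eq[OF assms]
  by (simp add: resurgence_vimage_iso[OF ring_morphism_last_var, of last_var_inv] subspace_ext_ideal assms
      resurgence_ext_ideal noetherian_mpoly)

theorem resurgence_quot_vimage:
  fixes I :: "('n::finite, 'k::field) mpoly set"
  assumes "homogeneous_ideal I" "I \<noteq> {0}" "I \<noteq> UNIV"
  shows "resurgence ring_of (quot -` I) = resurgence ring_of I"
proof -
  have I: "idl.subspace I"
    using assms(1) by (simp add: homogeneous_ideal_iff)
  have "resurgence ring_of (quot -` I) = resurgence ring_of (contr_ideal I)"
    unfolding quot_vimage_eq
    by (rule resurgence_vimage_iso[OF ring_morphism_last_var, of last_var_inv])
      (simp_all add: subspace_contr_ideal I)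
  also have "\<dots> = resurgence ring_of I"
    by (intro resurgence_contr_ideal I homogeneous_ideal_ipow_not_subset assms)
  finally show ?thesis .
qed

section \<open>Homogeneity and saturation of extended and contracted ideals\<close>

lemma homogeneous_ideal_extended_ideal:
  assumes "homogeneous_ideal I"
  shows "homogeneous_ideal (extended_ideal I)"
proof -
  have I: "idl.subspace I" "I \<subseteq> grade UNIV -` ext_ideal I"
    using assms by (simp_all add: homogeneous_ideal_iff)
  have grade_incl: "grade UNIV (incl f) = map_poly incl (grade UNIV f)" for f :: "('a, 'b) mpoly"
    by (rule ring_morphism_eqI[of "\<lambda>f. grade UNIV (incl f)" "\<lambda>f. map_poly incl (grade UNIV f)"])
      (simp_all add: ring_morphism_comp[OF ring_morphism_grade ring_morphism_incl] map_poly_monom map_poly_pCons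
        ring_morphism_comp[OF ring_morphism_map_poly[OF ring_morphism_incl] ring_morphism_grade]
        ring_morphism.h_zero[OF ring_morphism_incl])
  have E: "idl.subspace (extended_ideal I)"
    by (simp add: extended_ideal_def genideal_ring_of)
  have "incl a \<in> extended_ideal I" if "a \<in> I" for a
    using that by (simp add: extended_ideal_def genideal_ring_of idl.span_base)
  then have "map_poly incl p \<in> ext_ideal (extended_ideal I)" if "p \<in> ext_ideal I" for p
    using that by (simp add: ext_ideal_def coeff_map_poly ring_morphism.h_zero[OF ring_morphism_incl])
  then have "incl ` I \<subseteq> grade UNIV -` ext_ideal (extended_ideal I)"
    using I(2) by (auto simp: grade_incl)
  then have "extended_ideal I \<subseteq> grade UNIV -` ext_ideal (extended_ideal I)"
    by (subst (1) extended_ideal_def, unfold genideal_ring_of,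
      intro idl.span_minimal ring_morphism.subspace_vimage ring_morphism_grade subspace_ext_ideal E)
  then show ?thesis
    using E by (simp add: homogeneous_ideal_iff)
qed

lemma homogeneous_ideal_quot_vimage:
  assumes "homogeneous_ideal I"
  shows "homogeneous_ideal (quot -` I)"
proof -
  have I: "idl.subspace I" "I \<subseteq> grade UNIV -` ext_ideal I"
    using assms by (simp_all add: homogeneous_ideal_iff)
  interpret Q: ring_morphism quot
    by (rule ring_morphism_quot)
  have grade_quot: "grade UNIV (quot f) = map_poly quot (grade UNIV f)" for f :: "('a option, 'b) mpoly"
  proof (rule ring_morphism_eqI[of "\<lambda>f. grade UNIV (quot f)" "\<lambda>f. map_poly quot (grade UNIV f)"])
    show "grade UNIV (quot (Var i)) = map_poly quot (grade UNIV (Var i))" for i :: "'a option"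
      by (cases i) (simp_all add: map_poly_monom ring_morphism.h_zero[OF ring_morphism_grade])
  qed (simp_all add: ring_morphism_comp[OF ring_morphism_grade ring_morphism_quot] map_poly_pCons
        ring_morphism_comp[OF ring_morphism_map_poly[OF ring_morphism_quot] ring_morphism_grade])
  have "grade UNIV f \<in> ext_ideal (quot -` I)" if "quot f \<in> I" for f
  proof -
    have "map_poly quot (grade UNIV f) \<in> ext_ideal I"
      using I(2) that unfolding grade_quot[symmetric] by blast
    then show ?thesis
      by (simp add: ext_ideal_def coeff_map_poly)
  qed
  then show ?thesis
    using Q.subspace_vimage[OF I(1)] by (auto simp: homogeneous_ideal_iff)
qed

definition irrelevant :: "('n::finite, 'k::comm_ring_1) mpoly set" where
  "irrelevant = idl.span (range Var)"

lemma saturation_iff: "f \<in> saturation J \<longleftrightarrow> (\<exists>t. \<forall>g\<in>ipow irrelevant t. g * f \<in> J)"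
  by (simp add: saturation_def genideal_ring_of irrelevant_def)

lemma subset_saturation: "idl.subspace J \<Longrightarrow> J \<subseteq> saturation J"
  by (auto simp: saturation_iff intro!: exI[of _ 0] idl.subspace_scale)

lemma incl_ipow_irrelevant: "ipow irrelevant t \<subseteq> incl -` ipow irrelevant t"
proof (rule ring_morphism.ipow_subset_vimage[OF ring_morphism_incl])
  show "irrelevant \<subseteq> incl -` irrelevant"
    unfolding irrelevant_def
    by (intro idl.span_minimal ring_morphism.subspace_vimage ring_morphism_incl)
      (auto intro!: idl.span_base rangeI)
qed (simp add: irrelevant_def)

text \<open>Testing f only against included elements g of the smaller irrelevant power is enough:
  they act on each coefficient of f separately, and saturatedness of I applies to each coefficient.
  The point of the lemma is that \<open>subscheme_of\<close> saturates, so the ideal of the cone is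
  known only once this saturation is seen to change nothing.\<close>

lemma saturation_extended_ideal:
  assumes I: "idl.subspace I" and sat: "saturation I = I"
  shows "saturation (extended_ideal I) = extended_ideal I"
proof
  show "saturation (extended_ideal I) \<subseteq> extended_ideal I"
  proof
    fix f assume "f \<in> saturation (extended_ideal I)"
    then obtain t where t: "\<And>g. g \<in> ipow irrelevant t \<Longrightarrow> g * f \<in> extended_ideal I"
      by (auto simp: saturation_iff)
    have "Polynomial.coeff (last_var f) n \<in> I" for n
    proof -
      have "g * Polynomial.coeff (last_var f) n \<in> I" if "g \<in> ipow irrelevant t" for g
      proof -
        have "incl g * f \<in> extended_ideal I"
          using that incl_ipow_irrelevant by (intro t) blast
        then have "[:g:] * last_var f \<in> ext_ideal I"
          by (simp add: extended_ideal_eq I ring_morphism.h_mult[OF ring_morphism_last_var])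
        then show ?thesis
          using ext_idealD[of "[:g:] * last_var f" I n] by simp
      qed
      then have "Polynomial.coeff (last_var f) n \<in> saturation I"
        by (auto simp: saturation_iff)
      then show ?thesis
        by (simp add: sat)
    qed
    then show "f \<in> extended_ideal I"
      by (simp add: extended_ideal_eq I ext_ideal_def)
  qed
  show "extended_ideal I \<subseteq> saturation (extended_ideal I)"
    by (rule subset_saturation) (simp add: extended_ideal_def genideal_ring_of)
qed

lemma saturation_quot_vimage:
  assumes I: "idl.subspace I" and sat: "saturation I = I"
  shows "saturation (quot -` I) = quot -` I"
proof
  interpret Q: ring_morphism quot
    by (rule ring_morphism_quot)
  show "saturation (quot -` I) \<subseteq> quot -` I"
  proof
    fix f assume "f \<in> saturation (quot -` I)"
    then obtain t where t: "\<And>g. g \<in> ipow irrelevant t \<Longrightarrow> quot (g * f) \<in> I"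
      by (auto simp: saturation_iff)
    have "g * quot f \<in> I" if "g \<in> ipow irrelevant t" for g
      using t[of "incl g"] that incl_ipow_irrelevant by auto
    then have "quot f \<in> saturation I"
      by (auto simp: saturation_iff)
    then show "f \<in> quot -` I"
      by (simp add: sat)
  qed
  show "quot -` I \<subseteq> saturation (quot -` I)"
    by (intro subset_saturation Q.subspace_vimage I)
qed

lemma homogeneous_ideal_of: "homogeneous_ideal (ideal_of Z)"
  and saturation_ideal_of: "saturation (ideal_of Z) = ideal_of Z"
  using ideal_of[of Z] by simp_all

lemma ideal_of_subscheme_of: "homogeneous_ideal J \<Longrightarrow> saturation J = J \<Longrightarrow> ideal_of (subscheme_of J) = J"
  by (simp add: subscheme_of_def Abs_subscheme_inverse)

lemma resurgence_scheme_cone: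
  fixes Z :: "('n::finite, 'k::field) subscheme"
  shows "resurgence_scheme (cone Z) = resurgence_scheme Z"
proof -
  have I: "idl.subspace (ideal_of Z)"
    using homogeneous_ideal_of[of Z] by (simp add: homogeneous_ideal_iff)
  have "ideal_of (cone Z) = extended_ideal (ideal_of Z)"
    unfolding cone_def
    by (intro ideal_of_subscheme_of homogeneous_ideal_extended_ideal saturation_extended_ideal I
        homogeneous_ideal_of saturation_ideal_of)
  then show ?thesis
    by (simp add: resurgence_scheme_def resurgence_extended_ideal I)
qed

lemma resurgence_scheme_hyperplane_image:
  fixes Z :: "('n::finite, 'k::field) subscheme"
  assumes "nontrivial Z"
  shows "resurgence_scheme (hyperplane_image Z) = resurgence_scheme Z"
proof -
  have I: "idl.subspace (ideal_of Z)"
    using homogeneous_ideal_of[of Z] by (simp add: homogeneous_ideal_iff)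
  have "ideal_of (hyperplane_image Z) = quot -` ideal_of Z"
    unfolding hyperplane_image_def
    by (intro ideal_of_subscheme_of homogeneous_ideal_quot_vimage saturation_quot_vimage I
        homogeneous_ideal_of saturation_ideal_of)
  then show ?thesis
    using assms by (simp add: resurgence_scheme_def resurgence_quot_vimage homogeneous_ideal_of nontrivial_def)
qed

section \<open>Intersections of powers of primes\<close>

text \<open>If w carries A into I, each of the s factors from A absorbs one of the s factors
  w.\<close>

lemma colon_ipow:
  assumes I: "idl.subspace I" and "A \<subseteq> colon I w"
  shows "ipow A s \<subseteq> colon (ipow I s) (w ^ s)"
proof (induction s)
  case 0
  show ?case
    by (simp add: colon_def)
next
  case (Suc s)
  show ?case
  proof (rule ipow_Suc_least[OF subspace_colon[OF subspace_ipow[OF I]]])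
    fix a b assume "a \<in> ipow A s" "b \<in> A"
    then have "a * w ^ s * (b * w) \<in> ipow I (Suc s)"
      using Suc assms(2) by (intro mult_ipow_Suc) (auto simp: colon_def)
    then show "a * b \<in> colon (ipow I (Suc s)) (w ^ Suc s)"
      by (simp add: colon_def mult_ac)
  qed
qed

lemma prime_idl_power: "prime_idl P \<Longrightarrow> a ^ n \<in> P \<Longrightarrow> a \<in> P"
  by (induction n) (auto dest: prime_idlD)

lemma prime_idl_prod:
  assumes "prime_idl P" "finite K" "\<And>x. x \<in> K \<Longrightarrow> g x \<notin> P"
  shows "prod g K \<notin> P"
  using assms(2,3)
proof induction
  case empty
  then show ?case
    using prime_idlD(2)[OF assms(1)] by simp
next
  case (insert x K)
  then show ?case
    by (simp add: prime_idl_mult_iff[OF assms(1)])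
qed

text \<open>The properties of ideals of nonempty linear subspaces on which (c) rests: powers that
  are primary and strictly decreasing, and pairwise incomparability.\<close>

locale fat_primes =
  fixes T :: "'i set" and P :: "'i \<Rightarrow> 'a::comm_ring_1 set"
  assumes finite_T: "finite T"
    and prime: "i \<in> T \<Longrightarrow> prime_idl (P i)"
    and primary: "i \<in> T \<Longrightarrow> a * g \<in> ipow (P i) m \<Longrightarrow> a \<notin> P i \<Longrightarrow> g \<in> ipow (P i) m"
    and strict: "i \<in> T \<Longrightarrow> \<not> ipow (P i) m \<subseteq> ipow (P i) (Suc m)"
    and incomparable: "i \<in> T \<Longrightarrow> j \<in> T \<Longrightarrow> i \<noteq> j \<Longrightarrow> \<not> P i \<subseteq> P j"
begin

definition fat :: "('i \<Rightarrow> nat) \<Rightarrow> 'a set" where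
  "fat e = (\<Inter>i\<in>T. ipow (P i) (e i))"

lemma subspace_P: "i \<in> T \<Longrightarrow> idl.subspace (P i)"
  by (rule prime_idlD(1)[OF prime])

lemma subspace_fat: "idl.subspace (fat e)"
  unfolding fat_def by (intro idl.subspace_Inter) (auto intro: subspace_ipow subspace_P)

lemma ipow_subset_P:
  assumes "i \<in> T" "0 < n"
  shows "ipow (P i) n \<subseteq> P i"
  using ipow_antimono[OF subspace_P[OF assms(1)], of "Suc 0" n] assms subspace_P by simp

text \<open>The product of powers \<open>a j ^ e j\<close> with \<open>a j\<close> in
  \<open>P j\<close> but not in \<open>P i\<close>, which exist by incomparability.\<close>

lemma separator:
  assumes i: "i \<in> T"
  obtains w where "w \<notin> P i" "\<And>j. j \<in> T \<Longrightarrow> j \<noteq> i \<Longrightarrow> w \<in> ipow (P j) (e j)"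
proof -
  have "\<forall>j\<in>T - {i}. \<exists>a. a \<in> P j \<and> a \<notin> P i"
    using incomparable i by blast
  then have "\<exists>a. \<forall>j\<in>T - {i}. a j \<in> P j \<and> a j \<notin> P i"
    by (rule bchoice)
  then obtain a where a: "\<And>j. j \<in> T \<Longrightarrow> j \<noteq> i \<Longrightarrow> a j \<in> P j" "\<And>j. j \<in> T \<Longrightarrow> j \<noteq> i \<Longrightarrow> a j \<notin> P i"
    by blast
  define w where "w = (\<Prod>j\<in>T - {i}. a j ^ e j)"
  have "w \<notin> P i"
    unfolding w_def
  proof (rule prime_idl_prod[OF prime[OF i]])
    fix j assume "j \<in> T - {i}"
    then show "a j ^ e j \<notin> P i"
      using a(2)[of j] prime_idl_power[OF prime[OF i], of "a j" "e j"] by blast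
  qed (use finite_T in simp)
  moreover have "w \<in> ipow (P j) (e j)" if j: "j \<in> T" "j \<noteq> i" for j
  proof -
    have "w = (\<Prod>k\<in>T - {i} - {j}. a k ^ e k) * a j ^ e j"
      unfolding w_def using j finite_T by (subst prod.remove[of _ j]) (auto simp: mult.commute)
    then show ?thesis
      using a(1)[OF j] j by (simp add: idl.subspace_scale subspace_ipow subspace_P power_mem_ipow)
  qed
  ultimately show ?thesis
    by (rule that)
qed

lemma colon_fat: "colon (fat e) g = (\<Inter>i\<in>T. colon (ipow (P i) (e i)) g)"
  by (auto simp: colon_def fat_def)

text \<open>A prime colon of the intersection is a colon of a single
  \<open>ipow (P i) (e i)\<close>: primariness puts it inside \<open>P i\<close>, and it contains
  \<open>P i\<close> because it contains the \<open>e i\<close>-th powers of its elements. The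
  condition \<open>0 < e i\<close> is needed since the zeroth power is the whole ring.\<close>

lemma ass_fat: "ass (fat e) = P ` {i \<in> T. 0 < e i}"
proof
  show "ass (fat e) \<subseteq> P ` {i \<in> T. 0 < e i}"
  proof
    fix Q assume "Q \<in> ass (fat e)"
    then obtain g where Q: "prime_idl Q" "Q = colon (fat e) g"
      by (rule assE)
    have "\<exists>i\<in>T. colon (ipow (P i) (e i)) g \<subseteq> Q"
      using Q by (intro prime_idl_INT_subset finite_T subspace_colon subspace_ipow subspace_P)
        (auto simp: colon_fat)
    then obtain i where i: "i \<in> T" and Qi: "Q = colon (ipow (P i) (e i)) g"
      using Q(2) unfolding colon_fat by blast
    have g: "g \<notin> ipow (P i) (e i)"
      using prime_idlD(2)[OF Q(1)] by (simp add: Qi colon_def)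
    then have pos: "0 < e i"
      by (cases "e i") auto
    have "Q = P i"
    proof
      show "Q \<subseteq> P i"
        using primary[OF i] g unfolding Qi colon_def by blast
      show "P i \<subseteq> Q"
      proof
        fix a assume "a \<in> P i"
        then have "a ^ e i \<in> ipow (P i) (e i)"
          by (rule power_mem_ipow[OF subspace_P[OF i]])
        then have "a ^ e i \<in> Q"
          using idl.subspace_scale[OF subspace_ipow[OF subspace_P[OF i]], of "a ^ e i" "e i" g]
          by (simp add: Qi colon_def mult.commute)
        then show "a \<in> Q"
          by (rule prime_idl_power[OF Q(1)])
      qed
    qed
    then show "Q \<in> P ` {i \<in> T. 0 < e i}"
      using i pos by blast
  qed
  show "P ` {i \<in> T. 0 < e i} \<subseteq> ass (fat e)"
  proof clarify
    fix i assume i: "i \<in> T" and pos: "0 < e i"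
    \<comment> \<open>Multiplication by \<open>P i\<close> takes such a g into the
      \<open>e i\<close>-th power. The factor w takes care of the other components without touching
      \<open>P i\<close>, so w g has annihilator exactly \<open>P i\<close>.\<close>
    obtain g where g: "g \<in> ipow (P i) (e i - 1)" "g \<notin> ipow (P i) (e i)"
      using strict[OF i, of "e i - 1"] pos by auto
    obtain w where w: "w \<notin> P i" "\<And>j. j \<in> T \<Longrightarrow> j \<noteq> i \<Longrightarrow> w \<in> ipow (P j) (e j)"
      using separator[OF i, of e] by blast
    have "P i = colon (fat e) (w * g)"
    proof
      show "P i \<subseteq> colon (fat e) (w * g)"
      proof
        fix a assume a: "a \<in> P i"
        have "g * a \<in> ipow (P i) (Suc (e i - 1))"
          by (rule mult_ipow_Suc[OF g(1) a])
        then have "w * (g * a) \<in> ipow (P i) (e i)"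
          using pos i by (simp add: idl.subspace_scale subspace_ipow subspace_P)
        moreover have "(g * a) * w \<in> ipow (P j) (e j)" if "j \<in> T" "j \<noteq> i" for j
          using w(2)[OF that] that by (simp add: idl.subspace_scale subspace_ipow subspace_P)
        ultimately have "w * (g * a) \<in> fat e"
          unfolding fat_def by (auto simp: mult_ac)
        then show "a \<in> colon (fat e) (w * g)"
          by (simp add: colon_def mult_ac)
      qed
      show "colon (fat e) (w * g) \<subseteq> P i"
      proof
        fix a assume "a \<in> colon (fat e) (w * g)"
        then have "(a * w) * g \<in> ipow (P i) (e i)"
          using i by (auto simp: colon_def fat_def mult.assoc)
        then have "a * w \<in> P i"
          using primary[OF i] g(2) by blast
        then show "a \<in> P i"
          using prime_idlD(3)[OF prime[OF i]] w(1) by blast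
      qed
    qed
    then show "P i \<in> ass (fat e)"
      using assI prime[OF i] by metis
  qed
qed

lemma mem_ass_comp_fat: "s \<in> ass_comp (fat e) \<longleftrightarrow> (\<forall>i\<in>T. 0 < e i \<longrightarrow> s \<notin> P i)"
  by (auto simp: ass_comp_def ass_fat)

lemma sympow_fat:
  assumes s: "1 \<le> s"
  shows "sympow (fat e) s = fat (\<lambda>i. s * e i)"
proof (rule subset_antisym; rule subsetI)
  fix f assume "f \<in> sympow (fat e) s"
  then obtain u where u: "u \<in> ass_comp (fat e)" "u * f \<in> ipow (fat e) s"
    by (auto simp: sympow_iff subspace_fat)
  have "f \<in> ipow (P i) (s * e i)" if i: "i \<in> T" for i
  proof (cases "0 < e i")
    case True
    have "ipow (fat e) s \<subseteq> ipow (ipow (P i) (e i)) s"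
      using i by (intro ipow_mono subspace_ipow subspace_P) (auto simp: fat_def)
    also have "\<dots> \<subseteq> ipow (P i) (e i * s)"
      by (rule ipow_ipow_subset[OF subspace_P[OF i]])
    finally have "u * f \<in> ipow (P i) (s * e i)"
      using u(2) by (auto simp: mult.commute)
    then show ?thesis
      using primary[OF i] u(1) True i by (auto simp: mem_ass_comp_fat)
  qed simp
  then show "f \<in> fat (\<lambda>i. s * e i)"
    by (simp add: fat_def)
next
  fix f assume f: "f \<in> fat (\<lambda>i. s * e i)"
  have "\<forall>i\<in>T. \<exists>w. w \<notin> P i \<and> (\<forall>j\<in>T. j \<noteq> i \<longrightarrow> w \<in> ipow (P j) (e j))"
    using separator by metis
  then have "\<exists>w. \<forall>i\<in>T. w i \<notin> P i \<and> (\<forall>j\<in>T. j \<noteq> i \<longrightarrow> w i \<in> ipow (P j) (e j))"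
    by (rule bchoice)
  then obtain w where w: "\<And>i. i \<in> T \<Longrightarrow> w i \<notin> P i"
    "\<And>i j. i \<in> T \<Longrightarrow> j \<in> T \<Longrightarrow> j \<noteq> i \<Longrightarrow> w i \<in> ipow (P j) (e j)"
    by blast
  define T' where "T' = {i \<in> T. 0 < e i}"
  \<comment> \<open>One denominator for all primes: modulo \<open>P i\<close> only the summand
    \<open>w i ^ s\<close> survives, so v lies outside every relevant prime, while each
    \<open>w i ^ s\<close> carries f into \<open>ipow (fat e) s\<close>. Indices with
    \<open>e i = 0\<close> are left out because no other \<open>w j\<close> need lie in such a
    \<open>P i\<close>, and s \<ge> 1 is needed for \<open>w j ^ s\<close> to lie in
    \<open>P i\<close>.\<close>
  define v where "v = (\<Sum>i\<in>T'. w i ^ s)"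
  have "v \<notin> P i" if i: "i \<in> T'" for i
  proof
    assume "v \<in> P i"
    have iT: "i \<in> T" "0 < e i"
      using i by (auto simp: T'_def)
    have "(\<Sum>j\<in>T' - {i}. w j ^ s) \<in> P i"
    proof (rule idl.subspace_sum[OF subspace_P[OF iT(1)]])
      fix j assume "j \<in> T' - {i}"
      then have "w j \<in> P i"
        using w(2)[of j i] ipow_subset_P[OF iT] iT(1) by (auto simp: T'_def)
      then have "w j ^ (s - 1) * w j \<in> P i"
        by (rule idl.subspace_scale[OF subspace_P[OF iT(1)]])
      then show "w j ^ s \<in> P i"
        using s power_minus_mult[of s "w j"] by simp
    qed
    moreover have "v = w i ^ s + (\<Sum>j\<in>T' - {i}. w j ^ s)"
      unfolding v_def using i finite_T by (intro sum.remove) (auto simp: T'_def)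
    ultimately have "w i ^ s \<in> P i"
      using \<open>v \<in> P i\<close> idl.subspace_diff[OF subspace_P[OF iT(1)]] by (metis add_diff_cancel_right')
    then show False
      using w(1)[OF iT(1)] prime_idl_power[OF prime[OF iT(1)]] by blast
  qed
  then have "v \<in> ass_comp (fat e)"
    by (auto simp: mem_ass_comp_fat T'_def)
  moreover have "v * f \<in> ipow (fat e) s"
    unfolding v_def sum_distrib_right
  proof (rule idl.subspace_sum[OF subspace_ipow[OF subspace_fat]])
    fix i assume "i \<in> T'"
    then have i: "i \<in> T"
      by (simp add: T'_def)
    have "ipow (P i) (e i) \<subseteq> colon (fat e) (w i)"
    proof
      fix a assume a: "a \<in> ipow (P i) (e i)"
      have "w i * a \<in> ipow (P i) (e i)"
        using a i by (simp add: idl.subspace_scale subspace_ipow subspace_P)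
      moreover have "a * w i \<in> ipow (P j) (e j)" if "j \<in> T" "j \<noteq> i" for j
        using w(2)[OF i that] that by (simp add: idl.subspace_scale subspace_ipow subspace_P)
      ultimately show "a \<in> colon (fat e) (w i)"
        by (auto simp: colon_def fat_def mult.commute)
    qed
    then have "ipow (ipow (P i) (e i)) s \<subseteq> colon (ipow (fat e) s) (w i ^ s)"
      by (rule colon_ipow[OF subspace_fat])
    moreover have "f \<in> ipow (P i) (e i * s)"
      using f i by (auto simp: fat_def mult.commute)
    then have "f \<in> ipow (ipow (P i) (e i)) s"
      using ipow_mult_subset[OF subspace_P[OF i]] by blast
    ultimately have "f * w i ^ s \<in> ipow (fat e) s"
      by (auto simp: colon_def)
    then show "w i ^ s * f \<in> ipow (fat e) s"
      by (simp add: mult.commute)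
  qed
  ultimately show "f \<in> sympow (fat e) s"
    by (auto simp: sympow_iff subspace_fat)
qed

theorem resurgence_fat:
  assumes m: "1 \<le> m"
  shows "resurgence ring_of (fat (\<lambda>i. m * e i)) \<le> resurgence ring_of (fat e)"
proof (rule resurgence_mono)
  fix s r :: nat
  assume sr: "1 \<le> s" "1 \<le> r" "\<not> sympow (fat (\<lambda>i. m * e i)) s \<subseteq> ipow (fat (\<lambda>i. m * e i)) r"
  have sm: "1 \<le> s * m" "1 \<le> m * r"
    using m sr by simp_all
  have sym: "sympow (fat (\<lambda>i. m * e i)) s = sympow (fat e) (s * m)"
    by (simp add: sympow_fat[OF sr(1)] sympow_fat[OF sm(1)] mult.assoc)
  have "ipow (fat e) (m * r) \<subseteq> ipow (ipow (fat e) m) r"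
    by (rule ipow_mult_subset[OF subspace_fat])
  also have "\<dots> \<subseteq> ipow (fat (\<lambda>i. m * e i)) r"
    using ipow_subset_sympow[OF subspace_fat, of e m] by (intro ipow_mono subspace_fat) (simp add: sympow_fat[OF m])
  finally have "\<not> sympow (fat e) (s * m) \<subseteq> ipow (fat e) (m * r)"
    using sr(3) unfolding sym by blast
  moreover have "real s / real r \<le> real (s * m) / real (m * r)"
    using m by (simp add: field_simps)
  ultimately show "\<exists>m' r'. 1 \<le> m' \<and> 1 \<le> r' \<and> \<not> sympow (fat e) m' \<subseteq> ipow (fat e) r' \<and>
      real s / real r \<le> real m' / real r'"
    using sm by blast
qed

end

section \<open>Ideals of linear subspaces\<close>

text \<open>Over a finite field the product of all X - a, plus 1, would be a polynomial of positive
  degree without roots.\<close>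

lemma infinite_alg_closed_field: "infinite (UNIV :: 'k::alg_closed_field set)"
proof
  assume fin: "finite (UNIV :: 'k set)"
  define p where "p = (\<Prod>a\<in>(UNIV :: 'k set). [:- a, 1:])"
  have "Polynomial.degree p = (\<Sum>a\<in>(UNIV :: 'k set). Polynomial.degree [:- a, 1:])"
    unfolding p_def by (rule degree_prod_eq_sum_degree) auto
  then have "Polynomial.degree p = card (UNIV :: 'k set)"
    by simp
  then have "0 < Polynomial.degree p"
    using fin by (simp add: finite_UNIV_card_ge_0)
  then have "0 < Polynomial.degree (p + 1)"
    by (simp add: degree_add_eq_left)
  then obtain x where "poly (p + 1) x = 0"
    using alg_closed_imp_poly_has_root by blast
  moreover have "poly p x = 0"
    unfolding p_def poly_prod using fin by (subst prod_zero_iff) auto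
  ultimately show False
    by simp
qed

abbreviation peval :: "'k::comm_ring_1 ^ 'n \<Rightarrow> ('n::finite, 'k) mpoly \<Rightarrow> 'k" where
  "peval v \<equiv> poly_subst id (\<lambda>i. v $ i)"

lemma ring_morphism_peval: "ring_morphism (peval v)"
  by (rule ring_morphism_poly_subst[OF ring_morphism_id])

lemma peval_Const [simp]: "peval v (Const c) = c"
  and peval_Var [simp]: "peval v (Var i) = v $ i"
  by (simp_all add: poly_subst_Const poly_subst_Var ring_morphism_id)

text \<open>Vanishing on the affine cone, origin included, without reference to homogeneous
  generators; \<open>linear_ideal\<close> tests homogeneous polynomials at nonzero vectors
  only.\<close>

definition vanishing_ideal :: "('k::field ^ 'n) set \<Rightarrow> ('n::finite, 'k) mpoly set" where
  "vanishing_ideal V = {f. \<forall>v\<in>V. peval v f = 0}"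

lemma subspace_vanishing_ideal:
  fixes V :: "('k::field ^ 'n::finite) set"
  shows "idl.subspace (vanishing_ideal V)"
proof -
  interpret E: ring_morphism "peval v" for v :: "'k ^ 'n"
    by (rule ring_morphism_peval)
  show ?thesis
    by (rule idl.subspaceI) (simp_all add: vanishing_ideal_def)
qed

text \<open>As a polynomial in c, the value at c v has the values at v of the homogeneous components
  of f as coefficients.\<close>

lemma peval_scale: "peval (c *s v) f = poly (map_poly (peval v) (grade UNIV f)) c"
proof (rule ring_morphism_eqI[of "peval (c *s v)" "\<lambda>f. poly (map_poly (peval v) (grade UNIV f)) c"])
  show "ring_morphism (\<lambda>f. poly (map_poly (peval v) (grade UNIV f)) c)"
    by (intro ring_morphism_comp[OF ring_morphism_poly] ring_morphism_comp[OF ring_morphism_map_poly]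
        ring_morphism_peval ring_morphism_grade)
  show "peval (c *s v) (Const a) = poly (map_poly (peval v) (grade UNIV (Const a))) c" for a
    unfolding peval_Const
    by (simp add: map_poly_pCons ring_morphism.h_zero[OF ring_morphism_peval])
  show "peval (c *s v) (Var i) = poly (map_poly (peval v) (grade UNIV (Var i))) c" for i
    unfolding peval_Var
    by (simp add: map_poly_monom map_poly_pCons poly_monom ring_morphism.h_zero[OF ring_morphism_peval] mult.commute)
qed (rule ring_morphism_peval)

lemma homogeneous_linear_ideal: "homogeneous_ideal (linear_ideal V)"
  unfolding homogeneous_ideal_def linear_ideal_def by (intro exI conjI[rotated] refl) auto

lemma linear_ideal_0:
  fixes V :: "('k::field ^ 'n::finite) set"
  assumes "V \<subseteq> {0}"
  shows "linear_ideal V = UNIV"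
proof -
  have "homogeneous (1 :: ('n, 'k) mpoly)"
    by (simp add: homogeneous_def)
  then have "1 \<in> linear_ideal V"
    using assms unfolding linear_ideal_def genideal_ring_of by (intro idl.span_base) auto
  moreover have "idl.subspace (linear_ideal V)"
    by (simp add: linear_ideal_def genideal_ring_of)
  ultimately show ?thesis
    using subspace_UNIV_iff by blast
qed

text \<open>If f vanishes on V, then on each line of V it is a polynomial in the scalar with
  infinitely many roots, so all homogeneous components of f vanish there. The zero subspace must be
  excluded: its linear ideal is the unit ideal, whereas 1 does not vanish at the origin.\<close>

lemma linear_ideal_eq_vanishing_ideal:
  fixes V :: "('k::field ^ 'n::finite) set"
  assumes inf: "infinite (UNIV :: 'k set)" and V: "vec.subspace V" and nz: "\<not> V \<subseteq> {0}"
  shows "linear_ideal V = vanishing_ideal V"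
proof
  interpret E: ring_morphism "peval v" for v :: "'k ^ 'n"
    by (rule ring_morphism_peval)
  show "linear_ideal V \<subseteq> vanishing_ideal V"
    unfolding linear_ideal_def genideal_ring_of
  proof (intro idl.span_minimal subspace_vanishing_ideal subsetI)
    fix f assume "f \<in> {f. homogeneous f \<and> (\<forall>v\<in>V. v \<noteq> 0 \<longrightarrow> peval v f = 0)}"
    then have hom: "homogeneous f" and van: "\<And>v. v \<in> V \<Longrightarrow> v \<noteq> 0 \<Longrightarrow> peval v f = 0"
      by auto
    obtain d where d: "grade UNIV f = Polynomial.monom f d"
      using hom by (rule grade_homogeneous)
    obtain v where "v \<in> V" "v \<noteq> 0"
      using nz by blast
    \<comment> \<open>The value at the origin is 0^d times the value at v. For d = 0 the first
      factor is 1, and it is the zero at a nonzero vector of V that counts.\<close>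
    then have "peval (0 *s v) f = 0"
      using van unfolding peval_scale by (simp add: d map_poly_monom poly_monom)
    then have "peval 0 f = 0"
      by simp
    then have "peval v f = 0" if "v \<in> V" for v
      using van[OF that] by (cases "v = 0") simp_all
    then show "f \<in> vanishing_ideal V"
      by (simp add: vanishing_ideal_def)
  qed
  show "vanishing_ideal V \<subseteq> linear_ideal V"
  proof
    fix f assume f: "f \<in> vanishing_ideal V"
    have "peval v (Polynomial.coeff (grade UNIV f) d) = 0" if v: "v \<in> V" for v d
    proof -
      let ?p = "map_poly (peval v) (grade UNIV f)"
      have "peval (c *s v) f = 0" for c
        using f vec.subspace_scale[OF V v, of c] unfolding vanishing_ideal_def by blast
      then have "poly ?p c = 0" for c
        unfolding peval_scale .
      then have "?p = 0"
        using inf poly_roots_finite[of ?p] by auto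
      then have "Polynomial.coeff ?p d = 0"
        by simp
      then show ?thesis
        by (simp add: coeff_map_poly)
    qed
    then have "Polynomial.coeff (grade UNIV f) d \<in> linear_ideal V" for d
      unfolding linear_ideal_def genideal_ring_of
      by (intro idl.span_base) (simp add: homogeneous_coeff_grade)
    then have "(\<Sum>d\<le>Polynomial.degree (grade UNIV f). Polynomial.coeff (grade UNIV f) d) \<in> linear_ideal V"
      unfolding linear_ideal_def genideal_ring_of by (rule idl.span_sum)
    also have "(\<Sum>d\<le>Polynomial.degree (grade UNIV f). Polynomial.coeff (grade UNIV f) d) = f"
      using poly_altdef[of "grade UNIV f" 1] by (simp add: poly_grade_1)
    finally show "f \<in> linear_ideal V" .
  qed
qed

lemma mpoly_eqI_peval:
  fixes f g :: "('n::finite, 'k::field) mpoly"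
  assumes inf: "infinite (UNIV :: 'k set)" and eq: "\<And>v. peval v f = peval v g"
  shows "f = g"
proof (rule ccontr)
  assume "f \<noteq> g"
  then obtain u where u: "poly_subst id u (f - g) \<noteq> 0"
    using ex_nonvanishing_point[OF inf, of "f - g"] by auto
  have "peval (\<chi> i. u i) (f - g) = 0"
    by (simp only: ring_morphism.h_diff[OF ring_morphism_peval] eq diff_self)
  then show False
    using u by simp
qed

subsection \<open>Coordinate subspaces\<close>

definition coord_subspace :: "'n set \<Rightarrow> ('k::field ^ 'n::finite) set" where
  "coord_subspace S = {w. \<forall>i\<in>S. w $ i = 0}"

text \<open>The constant coefficient of \<open>grade S f\<close> is f with the variables of S set to
  0, that is, f composed with the projection \<open>pr\<close> onto the coordinate subspace.\<close>

lemma vanishing_ideal_coord_subspace: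
  fixes S :: "'n::finite set"
  assumes inf: "infinite (UNIV :: 'k::field set)"
  shows "vanishing_ideal (coord_subspace S :: ('k ^ 'n) set) = grade S -` ord_ge 1"
proof -
  define pr :: "'k ^ 'n \<Rightarrow> 'k ^ 'n" where "pr w = (\<chi> i. if i \<in> S then 0 else w $ i)" for w
  have eval: "peval w (Polynomial.coeff (grade S f) 0) = peval (pr w) f" for w f
  proof (rule ring_morphism_eqI[of "\<lambda>f. peval w (Polynomial.coeff (grade S f) 0)" "peval (pr w)"])
    show "ring_morphism (\<lambda>f. peval w (Polynomial.coeff (grade S f) 0))"
      by (rule ring_morphism_comp[OF ring_morphism_peval ring_morphism_comp[OF ring_morphism_coeff_0 ring_morphism_grade]])
  qed (simp_all add: pr_def poly_subst_Const poly_subst_Var ring_morphism_poly_subst ring_morphism_id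
      ring_morphism.h_zero[OF ring_morphism_peval])
  have "f \<in> vanishing_ideal (coord_subspace S) \<longleftrightarrow> grade S f \<in> ord_ge 1" for f :: "('n, 'k) mpoly"
  proof
    assume f: "f \<in> vanishing_ideal (coord_subspace S)"
    have "pr w \<in> coord_subspace S" for w
      by (simp add: coord_subspace_def pr_def)
    then have "peval w (Polynomial.coeff (grade S f) 0) = peval w 0" for w
      using f by (simp add: eval vanishing_ideal_def ring_morphism.h_zero[OF ring_morphism_peval])
    then have "Polynomial.coeff (grade S f) 0 = 0"
      by (rule mpoly_eqI_peval[OF inf])
    then show "grade S f \<in> ord_ge 1"
      by (simp add: ord_ge_def)
  next
    assume "grade S f \<in> ord_ge 1"
    then have "Polynomial.coeff (grade S f) 0 = 0"
      by (simp add: ord_ge_def)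
    then have 0: "peval (pr w) f = 0" for w
      using eval[of w f] by (simp add: ring_morphism.h_zero[OF ring_morphism_peval])
    have "pr w = w" if "w \<in> coord_subspace S" for w
      using that by (auto simp: coord_subspace_def pr_def vec_eq_iff)
    then show "f \<in> vanishing_ideal (coord_subspace S)"
      using 0 by (auto simp: vanishing_ideal_def) metis
  qed
  then show ?thesis
    by blast
qed

lemma prod_power_mem_ipow:
  assumes I: "idl.subspace I" and "\<And>i. i \<in> S \<Longrightarrow> x i \<in> I"
  shows "(\<Prod>i\<in>S. x i ^ d i) \<in> ipow I (\<Sum>i\<in>S. d i)"
  using assms(2)
proof (induction S rule: infinite_finite_induct)
  case (insert i S)
  then show ?case
    by (simp add: mult_ipow power_mem_ipow I)
qed simp_all

text \<open>The right side consists of the f all of whose monomials have degree at least m in the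
  variables of S, and such a monomial is a multiple of a product of m variables from the
  ideal.\<close>

lemma ipow_vanishing_ideal_coord_subspace:
  fixes S :: "'n::finite set"
  assumes inf: "infinite (UNIV :: 'k::field set)"
  shows "ipow (vanishing_ideal (coord_subspace S :: ('k ^ 'n) set)) m = grade S -` ord_ge m"
proof
  let ?I = "vanishing_ideal (coord_subspace S :: ('k ^ 'n) set)"
  have I: "idl.subspace ?I"
    by (rule subspace_vanishing_ideal)
  show "ipow ?I m \<subseteq> grade S -` ord_ge m"
    using ipow_subset_ord_ge[OF ring_morphism_grade, of ?I S 1 m]
    by (simp add: vanishing_ideal_coord_subspace[OF inf])
  show "grade S -` ord_ge m \<subseteq> ipow ?I m"
  proof
    fix f :: "('n, 'k) mpoly" assume f: "f \<in> grade S -` ord_ge m"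
    have "Poly_Mapping.single \<mu> (Poly_Mapping.lookup f \<mu>) \<in> ipow ?I m"
      if \<mu>: "\<mu> \<in> Poly_Mapping.keys f" for \<mu>
    proof -
      let ?d = "\<Sum>i\<in>S. Poly_Mapping.lookup \<mu> i"
      have "Poly_Mapping.lookup (Polynomial.coeff (grade S f) ?d) \<mu> \<noteq> 0"
        using \<mu> by (simp add: lookup_coeff_grade in_keys_iff)
      then have "Polynomial.coeff (grade S f) ?d \<noteq> 0"
        by auto
      then have "m \<le> ?d"
        using f by (auto simp: ord_ge_def not_le[symmetric])
      have "Var i \<in> ?I" if "i \<in> S" for i
        using that by (simp add: vanishing_ideal_def coord_subspace_def)
      then have "(\<Prod>i\<in>S. Var i ^ Poly_Mapping.lookup \<mu> i) \<in> ipow ?I ?d"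
        by (rule prod_power_mem_ipow[OF I])
      then have "(\<Prod>i\<in>S. Var i ^ Poly_Mapping.lookup \<mu> i) \<in> ipow ?I m"
        using ipow_antimono[OF I \<open>m \<le> ?d\<close>] by blast
      then have "Const (Poly_Mapping.lookup f \<mu>) * (\<Prod>i\<in>UNIV - S. Var i ^ Poly_Mapping.lookup \<mu> i) *
          (\<Prod>i\<in>S. Var i ^ Poly_Mapping.lookup \<mu> i) \<in> ipow ?I m"
        by (rule idl.subspace_scale[OF subspace_ipow[OF I]])
      moreover have "(\<Prod>i\<in>UNIV. Var i ^ Poly_Mapping.lookup \<mu> i :: ('n, 'k) mpoly) =
          (\<Prod>i\<in>UNIV - S. Var i ^ Poly_Mapping.lookup \<mu> i) * (\<Prod>i\<in>S. Var i ^ Poly_Mapping.lookup \<mu> i)"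
        by (rule prod.subset_diff) auto
      ultimately show ?thesis
        by (simp add: single_eq_Const_mult_prod_Var[of \<mu>] mult.assoc)
    qed
    then have "(\<Sum>\<mu>\<in>Poly_Mapping.keys f. Poly_Mapping.single \<mu> (Poly_Mapping.lookup f \<mu>)) \<in> ipow ?I m"
      by (rule idl.subspace_sum[OF subspace_ipow[OF I]])
    then show "f \<in> ipow ?I m"
      by (simp only: sum_single_lookup)
  qed
qed

text \<open>A basis of V is extended to a basis of the whole space, whose vectors become the columns
  of A; S indexes the added ones.\<close>

lemma ex_adapted_coordinates:
  fixes V :: "('k::field ^ 'n::finite) set"
  assumes V: "vec.subspace V"
  obtains A B :: "'k ^ 'n ^ 'n" and S where "\<And>w. A *v (B *v w) = w" "\<And>w. B *v (A *v w) = w"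
    "\<And>w. A *v w \<in> V \<longleftrightarrow> w \<in> coord_subspace S"
proof -
  obtain B0 where B0: "B0 \<subseteq> V" "vec.independent B0" "V \<subseteq> vec.span B0"
    using vec.maximal_independent_subset[of V] by blast
  obtain C where C: "B0 \<subseteq> C" "C \<subseteq> UNIV" "vec.independent C" "UNIV \<subseteq> vec.span C"
    using vec.maximal_independent_subset_extend[OF subset_UNIV B0(2)] .
  have finC: "finite C"
    using C(3) by (rule vec.finiteI_independent)
  have "card C = CARD('n)"
    using vec.basis_card_eq_dim[OF C(2,4,3)] unfolding vec_dim_card by simp
  then obtain e :: "'n \<Rightarrow> 'k ^ 'n" where e: "bij_betw e UNIV C"
    using finite_same_card_bij[of "UNIV :: 'n set" C] finC by auto
  define A :: "'k ^ 'n ^ 'n" where "A = (\<chi> i j. e j $ i)"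
  have A_axis: "A *v axis j 1 = e j" for j
    by (simp add: vec_eq_iff A_def matrix_vector_mult_def axis_def if_distrib[of "\<lambda>x. _ * x"] cong: if_cong)
  have A_sub: "vec.subspace ((*v) A ` W)" if "vec.subspace W" for W
    using that by (rule vec.linear_subspace_image[OF matrix_vector_mul_linear_gen])
  have "C \<subseteq> range ((*v) A)"
    using e A_axis by (metis bij_betw_imp_surj_on image_subsetI rangeI)
  then have "vec.span C \<subseteq> range ((*v) A)"
    by (rule vec.span_minimal[OF _ A_sub]) simp
  then have "surj ((*v) A)"
    using C(4) by blast
  then obtain B where B: "A ** B = mat 1"
    using matrix_right_invertible_surjective[of A] by blast
  then have B': "B ** A = mat 1"
    by (rule matrix_left_right_inverse1)
  have AB: "A *v (B *v w) = w" and BA: "B *v (A *v w) = w" for w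
    by (simp_all add: matrix_vector_mul_assoc B B')
  define S where "S = {j. e j \<notin> B0}"
  have "A *v w \<in> V \<longleftrightarrow> w \<in> coord_subspace S" for w
  proof
    have "vec.subspace (coord_subspace S :: ('k ^ 'n) set)"
      by (simp add: vec.subspace_def coord_subspace_def)
    then have sub: "vec.subspace ((*v) A ` coord_subspace S)"
      by (rule A_sub)
    have "B0 \<subseteq> (*v) A ` coord_subspace S"
    proof
      fix b assume b: "b \<in> B0"
      then obtain j where j: "b = e j"
        using C(1) e by (metis bij_betw_imp_surj_on imageE subsetD)
      then have "axis j (1 :: 'k) \<in> coord_subspace S"
        using b by (auto simp: coord_subspace_def S_def axis_def)
      then show "b \<in> (*v) A ` coord_subspace S"
        using A_axis[of j] j by (metis imageI)
    qed
    then have "V \<subseteq> (*v) A ` coord_subspace S"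
      using vec.span_minimal[OF _ sub] B0(3) by blast
    moreover assume "A *v w \<in> V"
    ultimately obtain w' where "w' \<in> coord_subspace S" "A *v w = A *v w'"
      by blast
    then show "w \<in> coord_subspace S"
      using BA by metis
  next
    assume w: "w \<in> coord_subspace S"
    have "A *v w = (\<Sum>j\<in>UNIV. w $ j *s e j)"
      by (simp add: matrix_mult_sum column_def A_def)
    also have "\<dots> \<in> V"
    proof (rule vec.subspace_sum[OF V])
      fix j
      show "w $ j *s e j \<in> V"
      proof (cases "j \<in> S")
        case True
        then show ?thesis
          using w vec.subspace_0[OF V] by (simp add: coord_subspace_def)
      next
        case False
        then have "e j \<in> V"
          using B0(1) by (auto simp: S_def)
        then show ?thesis
          by (rule vec.subspace_scale[OF V])
      qed
    qed
    finally show "A *v w \<in> V" .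
  qed
  with AB BA show ?thesis
    by (rule that)
qed

definition lin_subst :: "'k::field ^ 'n ^ 'n \<Rightarrow> ('n::finite, 'k) mpoly \<Rightarrow> ('n, 'k) mpoly" where
  "lin_subst A = poly_subst Const (\<lambda>i. \<Sum>j\<in>UNIV. Const (A $ i $ j) * Var j)"

lemma ring_morphism_lin_subst: "ring_morphism (lin_subst A)"
  unfolding lin_subst_def by (rule ring_morphism_poly_subst[OF ring_morphism_Const])

lemma peval_lin_subst: "peval w (lin_subst A f) = peval (A *v w) f"
proof (rule ring_morphism_eqI[of "\<lambda>f. peval w (lin_subst A f)" "peval (A *v w)"])
  interpret E: ring_morphism "peval w"
    by (rule ring_morphism_peval)
  show "peval w (lin_subst A (Var i)) = peval (A *v w) (Var i)" for i
    by (simp add: lin_subst_def poly_subst_Var[OF ring_morphism_Const] poly_subst_Var[OF ring_morphism_id]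
        matrix_vector_mult_def)
  show "peval w (lin_subst A (Const c)) = peval (A *v w) (Const c)" for c
    by (simp add: lin_subst_def poly_subst_Const[OF ring_morphism_Const] poly_subst_Const[OF ring_morphism_id])
qed (rule ring_morphism_comp[OF ring_morphism_peval ring_morphism_lin_subst] ring_morphism_peval)+

text \<open>The powers of the ideal of a linear subspace are the ideals of a multiplicative filtration; this
  makes them primary.\<close>

lemma ipow_vanishing_ideal:
  fixes V :: "('k::field ^ 'n::finite) set"
  assumes inf: "infinite (UNIV :: 'k set)" and V: "vec.subspace V"
  obtains \<tau> :: "('n, 'k) mpoly \<Rightarrow> ('n, 'k) mpoly poly"
  where "ring_morphism \<tau>" "\<And>m. ipow (vanishing_ideal V) m = \<tau> -` ord_ge m"
proof -
  obtain A B :: "'k ^ 'n ^ 'n" and S where AB: "\<And>w. A *v (B *v w) = w" and BA: "\<And>w. B *v (A *v w) = w"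
    and S: "\<And>w. A *v w \<in> V \<longleftrightarrow> w \<in> coord_subspace S"
    using ex_adapted_coordinates[OF V] by metis
  \<comment> \<open>Over an infinite field it suffices to compare values, where the substitutions
    become multiplication by inverse matrices.\<close>
  have inv: "lin_subst B (lin_subst A f) = f" "lin_subst A (lin_subst B f) = f" for f
    by (rule mpoly_eqI_peval[OF inf], simp add: peval_lin_subst AB BA)+
  have van: "vanishing_ideal V = lin_subst A -` vanishing_ideal (coord_subspace S)"
  proof (rule subset_antisym; rule subsetI)
    fix f assume "f \<in> vanishing_ideal V"
    then show "f \<in> lin_subst A -` vanishing_ideal (coord_subspace S)"
      using S by (simp add: vanishing_ideal_def peval_lin_subst)
  next
    fix f assume f: "f \<in> lin_subst A -` vanishing_ideal (coord_subspace S)"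
    have "peval v f = 0" if "v \<in> V" for v
    proof -
      have "B *v v \<in> coord_subspace S"
        using that S[of "B *v v"] by (simp add: AB)
      then have "peval (A *v (B *v v)) f = 0"
        using f by (simp add: vanishing_ideal_def peval_lin_subst)
      then show ?thesis
        by (simp add: AB)
    qed
    then show "f \<in> vanishing_ideal V"
      by (simp add: vanishing_ideal_def)
  qed
  have "ipow (vanishing_ideal V) m = (\<lambda>f. grade S (lin_subst A f)) -` ord_ge m" for m
  proof -
    have "ipow (vanishing_ideal V) m = lin_subst A -` ipow (vanishing_ideal (coord_subspace S)) m"
      unfolding van by (rule ipow_vimage_iso[OF ring_morphism_lin_subst inv subspace_vanishing_ideal])
    then show ?thesis
      by (simp add: ipow_vanishing_ideal_coord_subspace[OF inf] vimage_def)
  qed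
  then show ?thesis
    by (rule that[OF ring_morphism_comp[OF ring_morphism_grade ring_morphism_lin_subst]])
qed

text \<open>In adapted coordinates one of the coordinates that cut out V is nonzero at v; f is that
  linear form. It shows both that these ideals are nonzero and that they are incomparable.\<close>

lemma ex_vanishing_ideal_nonvanishing:
  fixes V :: "('k::field ^ 'n::finite) set"
  assumes V: "vec.subspace V" and v: "v \<notin> V"
  obtains f where "f \<in> vanishing_ideal V" "peval v f \<noteq> 0"
proof -
  obtain A B :: "'k ^ 'n ^ 'n" and S where AB: "\<And>w. A *v (B *v w) = w"
    and S: "\<And>w. A *v w \<in> V \<longleftrightarrow> w \<in> coord_subspace S"
    using ex_adapted_coordinates[OF V] by metis
  have "B *v v \<notin> coord_subspace S"
    using S[of "B *v v"] v by (simp add: AB)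
  then obtain i where i: "i \<in> S" "(B *v v) $ i \<noteq> 0"
    by (auto simp: coord_subspace_def)
  have "B *v u \<in> coord_subspace S" if "u \<in> V" for u
    using S[of "B *v u"] that by (simp add: AB)
  then have "lin_subst B (Var i) \<in> vanishing_ideal V"
    using i(1) by (simp add: vanishing_ideal_def peval_lin_subst coord_subspace_def)
  moreover have "peval v (lin_subst B (Var i)) \<noteq> 0"
    using i(2) by (simp add: peval_lin_subst)
  ultimately show ?thesis
    by (rule that)
qed

text \<open>The constant coefficient of \<open>\<tau> a\<close> is nonzero, so over a domain each
  vanishing coefficient of the product forces the next coefficient of \<open>\<tau> g\<close> to
  vanish. With m = 1 this is also primality.\<close>

lemma vimage_ord_ge_primary:
  fixes \<tau> :: "'a::comm_ring_1 \<Rightarrow> ('n::finite, 'k::idom) mpoly poly"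
  assumes \<tau>: "ring_morphism \<tau>" and "a * g \<in> \<tau> -` ord_ge m" "a \<notin> \<tau> -` ord_ge 1"
  shows "g \<in> \<tau> -` ord_ge m"
proof -
  have a: "Polynomial.coeff (\<tau> a) 0 \<noteq> 0"
    using assms(3) by (simp add: ord_ge_def)
  have "\<tau> g \<in> ord_ge j" if "j \<le> m" for j
    using that
  proof (induction j)
    case 0
    show ?case
      by (simp add: ord_ge_def)
  next
    case (Suc j)
    then have g: "\<tau> g \<in> ord_ge j"
      by simp
    have "\<tau> a * \<tau> g \<in> ord_ge m"
      using assms(2) by (simp add: ring_morphism.h_mult[OF \<tau>])
    then have "Polynomial.coeff (\<tau> a * \<tau> g) (0 + j) = 0"
      using Suc.prems by (simp add: ord_ge_def)
    moreover have "\<tau> a \<in> ord_ge 0"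
      by (simp add: ord_ge_def)
    ultimately have "Polynomial.coeff (\<tau> a) 0 * Polynomial.coeff (\<tau> g) j = 0"
      using ord_ge_coeff_mult[OF _ g] by metis
    then have "Polynomial.coeff (\<tau> g) j = 0"
      using a mpoly_no_zero_divisors by blast
    then show ?case
      using g by (auto simp: ord_ge_def less_Suc_eq)
  qed
  then show ?thesis
    by simp
qed

lemma prime_idl_vimage_ord_ge:
  fixes \<tau> :: "'a::comm_ring_1 \<Rightarrow> ('n::finite, 'k::idom) mpoly poly"
  assumes \<tau>: "ring_morphism \<tau>"
  shows "prime_idl (\<tau> -` ord_ge 1)"
  unfolding prime_idl_def
proof (intro conjI allI impI)
  show "idl.subspace (\<tau> -` ord_ge 1)"
    by (intro ring_morphism.subspace_vimage \<tau> subspace_ord_ge)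
  show "1 \<notin> \<tau> -` ord_ge 1"
    by (simp add: ring_morphism.h_one[OF \<tau>] ord_ge_def)
  show "a \<in> \<tau> -` ord_ge 1 \<or> b \<in> \<tau> -` ord_ge 1" if "a * b \<in> \<tau> -` ord_ge 1" for a b
    using vimage_ord_ge_primary[OF \<tau> that] by blast
qed

section \<open>Fat flats\<close>

lemma fat_primes_linear_ideal:
  fixes L :: "nat \<Rightarrow> ('k::field ^ 'n::finite) set"
  assumes inf: "infinite (UNIV :: 'k set)" and flats: "flats n L" and nz: "\<And>i. i < n \<Longrightarrow> \<not> L i \<subseteq> {0}"
  shows "fat_primes {..<n} (\<lambda>i. linear_ideal (L i))"
proof
  have L: "vec.subspace (L i)" "L i \<noteq> UNIV" if "i < n" for i
    using flats that by (auto simp: flats_def)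
  have eq: "linear_ideal (L i) = vanishing_ideal (L i)" if "i < n" for i
    using that by (intro linear_ideal_eq_vanishing_ideal inf L nz)
  show "finite {..<n}"
    by simp
  fix i assume "i \<in> {..<n}"
  then have i: "i < n"
    by simp
  obtain \<tau> :: "('n, 'k) mpoly \<Rightarrow> ('n, 'k) mpoly poly"
    where \<tau>: "ring_morphism \<tau>" "\<And>m. ipow (linear_ideal (L i)) m = \<tau> -` ord_ge m"
    using ipow_vanishing_ideal[OF inf L(1)[OF i]] unfolding eq[OF i] by metis
  have sub: "idl.subspace (linear_ideal (L i))"
    by (simp add: linear_ideal_def genideal_ring_of)
  have \<tau>1: "linear_ideal (L i) = \<tau> -` ord_ge 1"
    using \<tau>(2)[of 1] by (simp add: sub)
  show prime: "prime_idl (linear_ideal (L i))"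
    unfolding \<tau>1 by (rule prime_idl_vimage_ord_ge[OF \<tau>(1)])
  show "g \<in> ipow (linear_ideal (L i)) m"
    if "a * g \<in> ipow (linear_ideal (L i)) m" "a \<notin> linear_ideal (L i)" for a g m
    using vimage_ord_ge_primary[OF \<tau>(1), of a g m] that \<tau>1 \<tau>(2)[of m] by simp
  show "\<not> ipow (linear_ideal (L i)) m \<subseteq> ipow (linear_ideal (L i)) (Suc m)" for m
  proof (rule homogeneous_ideal_ipow_not_subset)
    obtain v where "v \<notin> L i"
      using L(2)[OF i] by blast
    then obtain f where "f \<in> linear_ideal (L i)" "peval v f \<noteq> 0"
      using ex_vanishing_ideal_nonvanishing[OF L(1)[OF i]] unfolding eq[OF i] by metis
    then show "linear_ideal (L i) \<noteq> {0}"
      using ring_morphism.h_zero[OF ring_morphism_peval] by fastforce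
    show "linear_ideal (L i) \<noteq> UNIV"
      using prime_idlD(2)[OF prime] by blast
  qed (simp_all add: homogeneous_linear_ideal)
  fix j assume "j \<in> {..<n}" and ij: "i \<noteq> j"
  then have j: "j < n"
    by simp
  \<comment> \<open>Passage to ideals reverses inclusions, so the other direction of incomparability
    of the flats is used.\<close>
  have "\<not> L j \<subseteq> L i"
    using flats i j ij by (auto simp: flats_def)
  then obtain v where v: "v \<in> L j" "v \<notin> L i"
    by blast
  obtain f where "f \<in> vanishing_ideal (L i)" "peval v f \<noteq> 0"
    using ex_vanishing_ideal_nonvanishing[OF L(1)[OF i] v(2)] .
  then show "\<not> linear_ideal (L i) \<subseteq> linear_ideal (L j)"
    using v(1) unfolding eq[OF i] eq[OF j] by (auto simp: vanishing_ideal_def)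
qed

lemma homogeneous_ideal_ipow:
  assumes "homogeneous_ideal I"
  shows "homogeneous_ideal (ipow I m)"
proof -
  have I: "idl.subspace I" "I \<subseteq> grade UNIV -` ext_ideal I"
    using assms by (simp_all add: homogeneous_ideal_iff)
  have "ipow I m \<subseteq> grade UNIV -` ipow (ext_ideal I) m"
    by (rule ring_morphism.ipow_subset_vimage[OF ring_morphism_grade subspace_ext_ideal[OF I(1)] I(2)])
  then show ?thesis
    by (simp add: homogeneous_ideal_iff ipow_ext_ideal I(1) subspace_ipow)
qed

lemma homogeneous_ideal_INT:
  assumes "\<And>i. i \<in> T \<Longrightarrow> homogeneous_ideal (J i)"
  shows "homogeneous_ideal (\<Inter>i\<in>T. J i)"
proof -
  have J: "idl.subspace (J i)" "J i \<subseteq> grade UNIV -` ext_ideal (J i)" if "i \<in> T" for i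
    using assms[OF that] by (simp_all add: homogeneous_ideal_iff)
  have "idl.subspace (\<Inter>i\<in>T. J i)"
    by (intro idl.subspace_Inter) (auto intro: J(1))
  moreover have "(\<Inter>i\<in>T. J i) \<subseteq> grade UNIV -` ext_ideal (\<Inter>i\<in>T. J i)"
    using J(2) by (fastforce simp: ext_ideal_def)
  ultimately show ?thesis
    by (simp add: homogeneous_ideal_iff)
qed

text \<open>The intersection is already saturated: each \<open>L i\<close> contains a nonzero
  vector, so some variable lies outside its prime ideal, and a power of that variable can be
  cancelled by primariness.\<close>

lemma ideal_of_fat_flat:
  fixes L :: "nat \<Rightarrow> ('k::field ^ 'n::finite) set"
  assumes inf: "infinite (UNIV :: 'k set)" and flats: "flats n L" and nz: "\<And>i. i < n \<Longrightarrow> \<not> L i \<subseteq> {0}"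
  shows "ideal_of (fat_flat n L \<mu>) = fat_primes.fat {..<n} (\<lambda>i. linear_ideal (L i)) \<mu>"
proof -
  interpret F: fat_primes "{..<n}" "\<lambda>i. linear_ideal (L i)"
    by (rule fat_primes_linear_ideal[OF assms])
  have "saturation (F.fat \<mu>) \<subseteq> F.fat \<mu>"
  proof
    fix f assume "f \<in> saturation (F.fat \<mu>)"
    then obtain t where t: "\<And>g. g \<in> ipow irrelevant t \<Longrightarrow> g * f \<in> F.fat \<mu>"
      by (auto simp: saturation_iff)
    have "f \<in> ipow (linear_ideal (L i)) (\<mu> i)" if i: "i \<in> {..<n}" for i
    proof -
      obtain v where v: "v \<in> L i" "v \<noteq> 0"
        using nz[of i] i by auto
      then obtain k where k: "v $ k \<noteq> 0"
        by (auto simp: vec_eq_iff)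
      have "vec.subspace (L i)"
        using flats i by (simp add: flats_def)
      then have "linear_ideal (L i) = vanishing_ideal (L i)"
        using i nz by (intro linear_ideal_eq_vanishing_ideal inf) auto
      then have "Var k \<notin> linear_ideal (L i)"
        using v(1) k by (auto simp: vanishing_ideal_def)
      then have notin: "Var k ^ t \<notin> linear_ideal (L i)"
        using prime_idl_power[OF F.prime[OF i]] by blast
      have "Var k ^ t \<in> ipow irrelevant t"
        by (rule power_mem_ipow) (simp_all add: irrelevant_def idl.span_base)
      then have "Var k ^ t * f \<in> ipow (linear_ideal (L i)) (\<mu> i)"
        using t i unfolding F.fat_def by blast
      then show ?thesis
        using F.primary[OF i] notin by blast
    qed
    then show "f \<in> F.fat \<mu>"
      by (simp add: F.fat_def)
  qed
  then have "saturation (F.fat \<mu>) = F.fat \<mu>"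
    using subset_saturation[OF F.subspace_fat] by blast
  moreover have "homogeneous_ideal (F.fat \<mu>)"
    unfolding F.fat_def by (intro homogeneous_ideal_INT homogeneous_ideal_ipow homogeneous_linear_ideal)
  ultimately have "ideal_of (subscheme_of (F.fat \<mu>)) = F.fat \<mu>"
    by (intro ideal_of_subscheme_of)
  then show ?thesis
    by (simp add: fat_flat_def F.fat_def)
qed

text \<open>The zero subspace is contained in every other flat, so if it occurs it is the only one,
  and the ideal is then the unit ideal.\<close>

lemma nontrivial_fat_flat_not_zero:
  fixes L :: "nat \<Rightarrow> ('k::field ^ 'n::finite) set"
  assumes flats: "flats n L" and nt: "nontrivial (fat_flat n L \<mu>)" and i: "i < n"
  shows "\<not> L i \<subseteq> {0}"
proof
  assume Li: "L i \<subseteq> {0}"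
  have "j = i" if "j < n" for j
  proof (rule ccontr)
    assume "j \<noteq> i"
    then have "\<not> L i \<subseteq> L j"
      using flats i that by (auto simp: flats_def)
    moreover have "0 \<in> L j"
      using flats that by (auto simp: flats_def intro: vec.subspace_0)
    ultimately show False
      using Li by blast
  qed
  then have "linear_ideal (L j) = UNIV" if "j < n" for j
    using linear_ideal_0[OF Li] that by metis
  moreover have "ipow (UNIV :: ('n, 'k) mpoly set) m = UNIV" for m
    using power_mem_ipow[of UNIV "1 :: ('n, 'k) mpoly" m] subspace_UNIV_iff[OF subspace_ipow[of "UNIV :: ('n, 'k) mpoly set" m]]
    by simp
  ultimately have J: "(\<Inter>i<n. ipow (linear_ideal (L i)) (\<mu> i)) = UNIV"
    by simp
  have "homogeneous_ideal (UNIV :: ('n, 'k) mpoly set)"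
    by (simp add: homogeneous_ideal_iff ext_ideal_def)
  moreover have "saturation (UNIV :: ('n, 'k) mpoly set) = UNIV"
    by (simp add: saturation_def)
  ultimately have "ideal_of (fat_flat n L \<mu>) = UNIV"
    unfolding fat_flat_def J by (rule ideal_of_subscheme_of)
  then show False
    using nt by (simp add: nontrivial_def)
qed

lemma resurgence_scheme_fat_flat:
  fixes L :: "nat \<Rightarrow> ('k::field ^ 'n::finite) set"
  assumes inf: "infinite (UNIV :: 'k set)" and flats: "flats n L"
    and "nontrivial (fat_flat n L \<mu>)" and m: "1 \<le> m"
  shows "resurgence_scheme (fat_flat n L (\<lambda>i. m * \<mu> i)) \<le> resurgence_scheme (fat_flat n L \<mu>)"
proof -
  have nz: "\<not> L i \<subseteq> {0}" if "i < n" for i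
    using flats assms(3) that by (rule nontrivial_fat_flat_not_zero)
  interpret F: fat_primes "{..<n}" "\<lambda>i. linear_ideal (L i)"
    by (rule fat_primes_linear_ideal[OF inf flats nz])
  have "ideal_of (fat_flat n L \<mu>) = F.fat \<mu>" for \<mu>
    by (intro ideal_of_fat_flat inf flats nz)
  then show ?thesis
    unfolding resurgence_scheme_def by (simp add: F.resurgence_fat[OF m])
qed

theorem proposition2p5p1:
  fixes N :: nat
    and I :: "('n::finite, 'k::alg_closed_field) mpoly set"
  assumes "1 \<le> N" and "CARD('n) = N + 1"
    and "homogeneous_ideal I" and "I \<noteq> {0}" and "I \<noteq> UNIV"
  shows "(resurgence mpoly_ring I = resurgence mpoly_ring (extended_ideal I) \<and>
          (\<forall>Z :: ('n, 'k) subscheme. nontrivial Z \<longrightarrow>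
             resurgence_scheme Z = resurgence_scheme (cone Z))) \<and>
         (resurgence mpoly_ring I = resurgence mpoly_ring (quot -` I) \<and>
          (\<forall>Z :: ('n, 'k) subscheme. nontrivial Z \<longrightarrow>
             resurgence_scheme Z = resurgence_scheme (hyperplane_image Z))) \<and>
         (\<forall>n (L :: nat \<Rightarrow> ('k ^ 'n) set) \<mu> m.
             flats n L \<and> nontrivial (fat_flat n L \<mu>) \<and> 1 \<le> m \<longrightarrow>
             resurgence_scheme (fat_flat n L (\<lambda>i. m * \<mu> i)) \<le> resurgence_scheme (fat_flat n L \<mu>))"
proof -
  have "idl.subspace I"
    using assms(3) by (simp add: homogeneous_ideal_iff)
  then show ?thesis
    using assms(3-5)
    by (auto simp: resurgence_extended_ideal resurgence_quot_vimage resurgence_scheme_cone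
        resurgence_scheme_hyperplane_image resurgence_scheme_fat_flat infinite_alg_closed_field)
qed

end
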